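(* Let $C=11\cdot 195^2+4$. Let $n\ge 2$ and let $\mathbf G=(G_1,G_2,G_3)$ be a graph triple of order $n$ with $\Delta_1,\Delta_2\le n-2$ and $\Delta_3\le n-1$. If $F(\mathbf G):=e_1+e_2+e_3+\mathcal D\le 3n-C$, then $\mathbf G$ packs.
   Context: A graph triple $\mathbf G=(G_1,G_2,G_3)$ of order $n$ consists of two disjoint $n$-vertex graphs $G_1=(V_1,E_1)$, $G_2=(V_2,E_2)$ and a bipartite graph $G_3=(V_1\cup V_2,E_3)$ with parts $V_1,V_2$. $\mathbf G$ packs if there is a bijection $f:V_1\to V_2$ with $vf(v)\notin E_3$ for all $v\in V_1$ and such that $uv\in E_1$ implies $f(u)f(v)\notin E_2$. For $v\in V_i$ ($i=1,2$), $d_i(v)$ is its degree in $G_i$ and $d_3(v)$ its degree in $G_3$. Let $e_i=|E_i|$, $\Delta_i=\max_v d_i(v)$ for $i=1,2,3$, $\Delta_{3|i}=\max_{v\in V_i}d_3(v)$, and $\mathcal D=\max\{\Delta_1+\max\{\Delta_{3|2}-4,0\},\ \Delta_2+\max\{\Delta_{3|1}-4,0\}\}$. *)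

theory Defs
  imports Main
begin

definition graph_on :: "'a set \<Rightarrow> 'a set set \<Rightarrow> bool" where
  "graph_on V E \<longleftrightarrow> E \<subseteq> {{u, v} | u v. u \<in> V \<and> v \<in> V \<and> u \<noteq> v}"

definition bipartite_on :: "'a set \<Rightarrow> 'a set \<Rightarrow> 'a set set \<Rightarrow> bool" where
  "bipartite_on V1 V2 E \<longleftrightarrow> E \<subseteq> {{u, v} | u v. u \<in> V1 \<and> v \<in> V2}"

definition graph_triple ::
  "nat \<Rightarrow> 'a set \<Rightarrow> 'a set \<Rightarrow> 'a set set \<Rightarrow> 'a set set \<Rightarrow> 'a set set \<Rightarrow> bool" where
  "graph_triple n V1 V2 E1 E2 E3 \<longleftrightarrow>
     finite V1 \<and> finite V2 \<and> V1 \<inter> V2 = {} \<and> card V1 = n \<and> card V2 = n \<and>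
     graph_on V1 E1 \<and> graph_on V2 E2 \<and> bipartite_on V1 V2 E3"

definition deg :: "'a set set \<Rightarrow> 'a \<Rightarrow> nat" where
  "deg E v = card {e \<in> E. v \<in> e}"

definition maxdeg :: "'a set set \<Rightarrow> 'a set \<Rightarrow> nat" where
  "maxdeg E V = Max (deg E ` V)"

definition packs ::
  "'a set \<Rightarrow> 'a set \<Rightarrow> 'a set set \<Rightarrow> 'a set set \<Rightarrow> 'a set set \<Rightarrow> bool" where
  "packs V1 V2 E1 E2 E3 \<longleftrightarrow>
     (\<exists>f. bij_betw f V1 V2 \<and> (\<forall>v\<in>V1. {v, f v} \<notin> E3) \<and>
          (\<forall>u\<in>V1. \<forall>v\<in>V1. {u, v} \<in> E1 \<longrightarrow> {f u, f v} \<notin> E2))"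

text \<open>The quantity D; nat subtraction \<open>d - 4\<close> is exactly \<open>max (d - 4) 0\<close>.\<close>
definition calD ::
  "'a set \<Rightarrow> 'a set \<Rightarrow> 'a set set \<Rightarrow> 'a set set \<Rightarrow> 'a set set \<Rightarrow> nat" where
  "calD V1 V2 E1 E2 E3 =
     max (maxdeg E1 V1 + max (maxdeg E3 V2 - 4) 0)
         (maxdeg E2 V2 + max (maxdeg E3 V1 - 4) 0)"

end

theory Submission
  imports Defs
begin

text \<open>
  In a counterexample of minimal order no partial packing can be fixed such that the rest still satisfies the
  hypothesis; here the rest consists of the unplaced vertices, and a pair of vertices with placed
  neighbours \<open>a\<close> and \<open>f(a)\<close> becomes a new forbidden pair. So a set of \<open>m\<close> pairs may be placed
  whenever it removes at least \<open>3m\<close> more edges than it creates. Single pairs and small stars of this kind show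
  that no vertex is joined to almost all of its own or of the other side.

  If a side has no vertex of degree \<open>n/600\<close> and the other none of degree \<open>n/10\<close>, one packs directly: vertices of
  degree above about \<open>sqrt n\<close> are placed greedily on vertices of low degree, and a bijection between the rest
  with the fewest conflicts has none. A vertex of degree \<open>n/10\<close> opposite to a side without a vertex of degree
  \<open>n/600\<close> can be placed, together with vertices for the neighbours of its image, at the cost of few new edges.
  Hence both sides have a vertex of degree \<open>n/600\<close>. The same placement then shows that every vertex that has few
  own neighbours, all of low degree, is joined to such a vertex of the other side.

  Call the boundedly many vertices of degree at least \<open>n/27000\<close> heavy. With heavy neighbours counted twice every
  light vertex has weighted degree at least 2, while the sum of the weighted degrees is at most \<open>6n - 2C\<close>. So
  there are many leaves attached to heavy vertices: enough to place two light vertices of one side on two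
  heavy vertices of the other and their neighbours on leaves of these heavy vertices, without creating any
  edge.
\<close>

section \<open>Triples and partial packings\<close>

text \<open>The constants are linked. If no vertex of one side reaches degree \<open>n/600\<close>,
  the greedy placement of the large vertices can afford to avoid the neighbourhoods of 180 of its
  vertices, which hold at most \<open>3n/10\<close> vertices. A vertex of degree
  \<open>n/600\<close> can in turn pay for its own placement together with three low-degree vertices
  when light means degree below \<open>n/27000\<close>: about \<open>27 * n/27000 = n/1000\<close>
  edges arise. As the degree sum is below \<open>6n\<close>, there are at most
  \<open>6 * 27000 = 162000\<close> heavy vertices, and with up to four exceptional ones each costs
  4 in the final count; \<open>4 * 162004\<close> is below \<open>2C\<close>, and the rest of
  \<open>2C\<close> gives the leaves. The obstacle is a vertex of almost full degree. On the cross
  side the summand \<open>D\<close> is then almost \<open>n\<close> as well, and lowering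
  \<open>D\<close> by one counts like one removed edge; several single placements remove only two
  edges and take the third unit from \<open>D\<close>. On the own side few non-neighbours are left
  to be placed on the neighbours of the image, and up to two vertices opposite may be joined to
  nearly all of those of low degree; these exceptional vertices are treated as heavy.\<close>

text \<open>A triple is given by its two sides and one symmetric adjacency relation, the union of the three edge sets;
  for \<open>v\<close> in \<open>P\<close> the degrees \<open>dg R v P\<close> and \<open>dg R v Q\<close> are then those in the own graph and in the bipartite graph.
  All quantities are doubled: \<open>sd R V\<close> is twice the number of edges and \<open>836558 = 2C\<close>. The number \<open>D\<close> is
  only an upper bound of the quantity in the theorem, so that it may stay unchanged when vertices are removed.\<close>

definition nb :: "('a \<Rightarrow> 'a \<Rightarrow> bool) \<Rightarrow> 'a \<Rightarrow> 'a set \<Rightarrow> 'a set" where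
  "nb R v S = {u \<in> S. R v u}"

definition dg :: "('a \<Rightarrow> 'a \<Rightarrow> bool) \<Rightarrow> 'a \<Rightarrow> 'a set \<Rightarrow> nat" where
  "dg R v S = card (nb R v S)"

definition sd :: "('a \<Rightarrow> 'a \<Rightarrow> bool) \<Rightarrow> 'a set \<Rightarrow> nat" where
  "sd R V = (\<Sum>v\<in>V. dg R v V)"

definition tri :: "'a set \<Rightarrow> 'a set \<Rightarrow> ('a \<Rightarrow> 'a \<Rightarrow> bool) \<Rightarrow> bool" where
  "tri P Q R \<longleftrightarrow> finite P \<and> finite Q \<and> P \<inter> Q = {} \<and> card P = card Q \<and>
     (\<forall>u v. R u v \<longrightarrow> R v u) \<and> (\<forall>u. \<not> R u u) \<and> (\<forall>u v. R u v \<longrightarrow> u \<in> P \<union> Q)"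

definition pk :: "'a set \<Rightarrow> 'a set \<Rightarrow> ('a \<Rightarrow> 'a \<Rightarrow> bool) \<Rightarrow> bool" where
  "pk P Q R \<longleftrightarrow> (\<exists>f. bij_betw f P Q \<and> (\<forall>v\<in>P. \<not> R v (f v)) \<and>
     (\<forall>u\<in>P. \<forall>v\<in>P. R u v \<longrightarrow> \<not> R (f u) (f v)))"

text \<open>Says that \<open>D\<close> is at least the quantity of the theorem. The bounds with
  \<open>D + 4\<close> avoid a truncated subtraction, and the bounds by \<open>D\<close> alone are
  the case in which the maximum with 0 is 0.\<close>

definition bnd :: "'a set \<Rightarrow> 'a set \<Rightarrow> ('a \<Rightarrow> 'a \<Rightarrow> bool) \<Rightarrow> nat \<Rightarrow> bool" where
  "bnd P Q R D \<longleftrightarrow> (\<forall>v\<in>P. dg R v P \<le> D) \<and> (\<forall>y\<in>Q. dg R y Q \<le> D) \<and>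
     (\<forall>v\<in>P. \<forall>y\<in>Q. dg R v P + dg R y P \<le> D + 4 \<and> dg R y Q + dg R v Q \<le> D + 4)"

definition good :: "'a set \<Rightarrow> 'a set \<Rightarrow> ('a \<Rightarrow> 'a \<Rightarrow> bool) \<Rightarrow> nat \<Rightarrow> bool" where
  "good P Q R D \<longleftrightarrow> tri P Q R \<and> bnd P Q R D \<and>
     (\<forall>v\<in>P. dg R v P + 2 \<le> card P \<and> dg R v Q + 1 \<le> card P) \<and>
     (\<forall>y\<in>Q. dg R y Q + 2 \<le> card P \<and> dg R y P + 1 \<le> card P) \<and>
     sd R (P \<union> Q) + 2 * D + 836558 \<le> 6 * card P"

lemma tri_swap: "tri P Q R \<Longrightarrow> tri Q P R"
  unfolding tri_def by (auto simp: Int_commute)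

lemma bnd_swap: "bnd P Q R D \<Longrightarrow> bnd Q P R D"
  unfolding bnd_def by auto

lemma good_swap: "good P Q R D \<Longrightarrow> good Q P R D"
  unfolding good_def using tri_swap bnd_swap by (metis Un_commute tri_def)

lemma pk_swap:
  assumes "tri P Q R" "pk Q P R" shows "pk P Q R"
proof -
  obtain f where f: "bij_betw f Q P" "\<forall>v\<in>Q. \<not> R v (f v)"
    "\<forall>u\<in>Q. \<forall>v\<in>Q. R u v \<longrightarrow> \<not> R (f u) (f v)" using assms(2) unfolding pk_def by blast
  let ?g = "inv_into Q f"
  have g: "bij_betw ?g P Q" using f(1) by (rule bij_betw_inv_into)
  have fg: "f (?g v) = v" "?g v \<in> Q" if "v \<in> P" for v
    using f(1) that g by (auto simp: bij_betw_inv_into_right bij_betwE)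
  show ?thesis unfolding pk_def
    using g f fg assms(1) unfolding tri_def by (intro exI[of _ ?g]) metis
qed

lemma dg_Un: "finite S \<Longrightarrow> finite T \<Longrightarrow> S \<inter> T = {} \<Longrightarrow> dg R v (S \<union> T) = dg R v S + dg R v T"
  unfolding dg_def nb_def
  by (subst card_Un_disjoint[symmetric]) (auto intro!: arg_cong[where f=card])

lemma dg_mono: "finite T \<Longrightarrow> S \<subseteq> T \<Longrightarrow> dg R v S \<le> dg R v T"
  unfolding dg_def nb_def by (intro card_mono) auto

lemma dg_Diff:
  assumes "finite S" "Z \<subseteq> S" shows "dg R v S = dg R v (S - Z) + dg R v Z"
proof -
  have "dg R v ((S - Z) \<union> Z) = dg R v (S - Z) + dg R v Z"
    using assms by (intro dg_Un) (auto intro: finite_subset)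
  moreover have "(S - Z) \<union> Z = S" using assms by blast
  ultimately show ?thesis by simp
qed

lemma dg_eq_sum: "finite S \<Longrightarrow> dg R v S = (\<Sum>u\<in>S. if R v u then 1 else 0)"
  unfolding dg_def nb_def by (simp add: sum.If_cases Int_def)

lemma dg_sum_swap:
  assumes "finite S" "finite T" "\<And>u v. R u v \<longleftrightarrow> R v u"
  shows "(\<Sum>v\<in>S. dg R v T) = (\<Sum>u\<in>T. dg R u S)"
  using assms by (simp add: dg_eq_sum sum.swap[of _ S T])

text \<open>Markov's inequality; most counts of vertices of large degree rest on it.\<close>

lemma card_ge_le_sum:
  fixes f :: "'a \<Rightarrow> nat"
  assumes "finite S"
  shows "card {s \<in> S. t \<le> f s} * t \<le> sum f S"
proof -
  have "card {s \<in> S. t \<le> f s} * t = (\<Sum>s\<in>{s \<in> S. t \<le> f s}. t)" by simp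
  also have "\<dots> \<le> (\<Sum>s\<in>{s \<in> S. t \<le> f s}. f s)" by (intro sum_mono) auto
  also have "\<dots> \<le> sum f S" using assms by (intro sum_mono2) auto
  finally show ?thesis .
qed

text \<open>The degrees of the vertices of \<open>Z\<close> count every edge inside \<open>Z\<close>
  twice although it disappears only once; \<open>sd R Z\<close> corrects this.\<close>

lemma sd_remove:
  assumes "finite V" "Z \<subseteq> V" "\<And>u v. R u v \<longleftrightarrow> R v u"
  shows "sd R (V - Z) + 2 * (\<Sum>z\<in>Z. dg R z V) = sd R V + sd R Z"
proof -
  have fZ: "finite Z" using assms finite_subset by blast
  have d: "dg R v V = dg R v (V - Z) + dg R v Z" for v using dg_Diff[OF assms(1,2)] .
  have "sd R V = (\<Sum>v\<in>V-Z. dg R v V) + (\<Sum>z\<in>Z. dg R z V)"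
    unfolding sd_def using sum.subset_diff[OF assms(2,1)] by blast
  also have "(\<Sum>v\<in>V-Z. dg R v V) = sd R (V - Z) + (\<Sum>v\<in>V-Z. dg R v Z)"
    unfolding sd_def by (simp add: d sum.distrib)
  also have "(\<Sum>v\<in>V-Z. dg R v Z) = (\<Sum>z\<in>Z. dg R z (V - Z))"
    by (rule dg_sum_swap) (use assms(1) fZ assms(3) in auto)
  finally have 1: "sd R V = sd R (V - Z) + (\<Sum>z\<in>Z. dg R z (V - Z)) + (\<Sum>z\<in>Z. dg R z V)" by simp
  have "(\<Sum>z\<in>Z. dg R z V) = (\<Sum>z\<in>Z. dg R z (V - Z)) + sd R Z"
    unfolding sd_def by (simp add: d sum.distrib)
  with 1 show ?thesis by simp
qed

lemma sd_le_square:
  assumes "finite Z" "\<And>u. \<not> R u u" shows "sd R Z \<le> card Z * (card Z - 1)"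
proof -
  have "dg R z Z \<le> card Z - 1" if "z \<in> Z" for z
  proof -
    have "nb R z Z \<subseteq> Z - {z}" using assms unfolding nb_def by auto
    then have "card (nb R z Z) \<le> card (Z - {z})" using assms by (intro card_mono) auto
    then show ?thesis using that assms by (simp add: dg_def)
  qed
  then have "sd R Z \<le> (\<Sum>z\<in>Z. card Z - 1)" unfolding sd_def by (intro sum_mono) auto
  then show ?thesis by simp
qed

text \<open>The triple that remains once the pairs \<open>a \<mapsto> g a\<close> with \<open>a \<in> A\<close> have been fixed: a vertex next to
  \<open>a\<close> may no longer be sent to a vertex next to \<open>g a\<close>, which is recorded by a new cross edge.\<close>

definition newe :: "('a \<Rightarrow> 'a \<Rightarrow> bool) \<Rightarrow> 'a set \<Rightarrow> ('a \<Rightarrow> 'a) \<Rightarrow> 'a \<Rightarrow> 'a \<Rightarrow> bool" where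
  "newe R A g u y \<longleftrightarrow> (\<exists>a\<in>A. R a u \<and> R (g a) y)"

definition resid :: "'a set \<Rightarrow> 'a set \<Rightarrow> ('a \<Rightarrow> 'a \<Rightarrow> bool) \<Rightarrow> 'a set \<Rightarrow> ('a \<Rightarrow> 'a) \<Rightarrow> 'a \<Rightarrow> 'a \<Rightarrow> bool" where
  "resid P Q R A g u v \<longleftrightarrow> u \<in> (P - A) \<union> (Q - g ` A) \<and> v \<in> (P - A) \<union> (Q - g ` A) \<and>
     (R u v \<or> (u \<in> P - A \<and> v \<in> Q - g ` A \<and> newe R A g u v) \<or>
               (v \<in> P - A \<and> u \<in> Q - g ` A \<and> newe R A g v u))"

definition ppk :: "('a \<Rightarrow> 'a \<Rightarrow> bool) \<Rightarrow> 'a set \<Rightarrow> 'a set \<Rightarrow> 'a set \<Rightarrow> ('a \<Rightarrow> 'a) \<Rightarrow> bool" where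
  "ppk R P Q A g \<longleftrightarrow> A \<subseteq> P \<and> g ` A \<subseteq> Q \<and> inj_on g A \<and> (\<forall>a\<in>A. \<not> R a (g a)) \<and>
     (\<forall>a\<in>A. \<forall>b\<in>A. R a b \<longrightarrow> \<not> R (g a) (g b))"

lemma tri_resid:
  assumes "tri P Q R" "ppk R P Q A g"
  shows "tri (P - A) (Q - g ` A) (resid P Q R A g)"
proof -
  have "card (P - A) = card (Q - g ` A)"
    using assms unfolding tri_def ppk_def
    by (metis card_Diff_subset card_image finite_subset)
  then show ?thesis using assms unfolding tri_def resid_def by blast
qed

text \<open>A conflict of the combined map lies among the placed vertices, among the rest, or
  between the two. The first is excluded by \<open>ppk\<close>, the second by the packing of the
  rest. In the third, an edge from a placed \<open>u\<close> to an unplaced \<open>v\<close> makes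
  \<open>{v, f v}\<close> one of the new cross edges, and \<open>f\<close> avoids these.\<close>

lemma pk_resid:
  assumes t: "tri P Q R" and p: "ppk R P Q A g"
    and k: "pk (P - A) (Q - g ` A) (resid P Q R A g)"
  shows "pk P Q R"
proof -
  let ?R = "resid P Q R A g"
  obtain f where f: "bij_betw f (P - A) (Q - g ` A)" "\<forall>v\<in>P-A. \<not> ?R v (f v)"
    "\<forall>u\<in>P-A. \<forall>v\<in>P-A. ?R u v \<longrightarrow> \<not> ?R (f u) (f v)" using k unfolding pk_def by blast
  define h where "h v = (if v \<in> A then g v else f v)" for v
  have AP: "A \<subseteq> P" "g ` A \<subseteq> Q" using p unfolding ppk_def by auto
  have sym: "R u v \<Longrightarrow> R v u" for u v using t unfolding tri_def by blast
  have fin: "f v \<in> Q - g ` A" if "v \<in> P - A" for v using f(1) that by (auto dest: bij_betwE)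
  have "bij_betw h (A \<union> (P - A)) (g ` A \<union> (Q - g ` A))"
  proof (rule bij_betw_combine)
    have "bij_betw g A (g ` A)" using p unfolding ppk_def bij_betw_def by auto
    then show "bij_betw h A (g ` A)" by (rule bij_betw_cong[THEN iffD1, rotated]) (simp add: h_def)
    show "bij_betw h (P - A) (Q - g ` A)"
      using f(1) by (rule bij_betw_cong[THEN iffD1, rotated]) (simp add: h_def)
    show "g ` A \<inter> (Q - g ` A) = {}" by blast
  qed
  then have b: "bij_betw h P Q" using AP by (simp add: Un_absorb1)
  have c1: "\<not> R v (h v)" if "v \<in> P" for v
  proof (cases "v \<in> A")
    case True then show ?thesis using p unfolding ppk_def h_def by auto
  next
    case False
    then have "v \<in> P - A" using that by simp
    moreover from this have "f v \<in> Q - g ` A" using fin by blast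
    ultimately show ?thesis using f(2) False unfolding h_def resid_def by auto
  qed
  have mixed: "\<not> R (h u) (h v)" if "u \<in> A" "v \<in> P - A" "R u v" for u v
  proof
    assume "R (h u) (h v)"
    then have "newe R A g v (f v)" using that unfolding newe_def h_def by auto
    then have "?R v (f v)" using that fin[of v] unfolding resid_def by auto
    then show False using f(2) that by blast
  qed
  have c2: "\<not> R (h u) (h v)" if "u \<in> P" "v \<in> P" "R u v" for u v
  proof (cases "u \<in> A"; cases "v \<in> A")
    assume "u \<in> A" "v \<in> A" then show ?thesis using p that unfolding ppk_def h_def by auto
  next
    assume "u \<in> A" "v \<notin> A" then show ?thesis using mixed that by auto
  next
    assume "u \<notin> A" "v \<in> A" then show ?thesis using mixed[of v u] that sym by blast
  next
    assume a: "u \<notin> A" "v \<notin> A"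
    then have "?R u v" "f u \<in> Q - g ` A" "f v \<in> Q - g ` A" using that fin unfolding resid_def by auto
    moreover have "\<not> ?R (f u) (f v)" using f(3) a that calculation(1) by blast
    ultimately have "\<not> R (f u) (f v)" unfolding resid_def by blast
    then show ?thesis using a by (simp add: h_def)
  qed
  show ?thesis unfolding pk_def using b c1 c2 by blast
qed

section \<open>Degrees and edges of the residual triple\<close>

definition nx :: "'a set \<Rightarrow> ('a \<Rightarrow> 'a \<Rightarrow> bool) \<Rightarrow> 'a set \<Rightarrow> ('a \<Rightarrow> 'a) \<Rightarrow> 'a \<Rightarrow> nat" where
  "nx Q R A g u = card {y \<in> Q - g ` A. newe R A g u y}"

definition ny :: "'a set \<Rightarrow> ('a \<Rightarrow> 'a \<Rightarrow> bool) \<Rightarrow> 'a set \<Rightarrow> ('a \<Rightarrow> 'a) \<Rightarrow> 'a \<Rightarrow> nat" where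
  "ny P R A g y = card {u \<in> P - A. newe R A g u y}"

lemma resid_dg:
  assumes t: "tri P Q R" and p: "ppk R P Q A g"
  shows "v \<in> P - A \<Longrightarrow> dg (resid P Q R A g) v (P - A) = dg R v (P - A)"
    and "y \<in> Q - g ` A \<Longrightarrow> dg (resid P Q R A g) y (Q - g ` A) = dg R y (Q - g ` A)"
    and "v \<in> P - A \<Longrightarrow> dg (resid P Q R A g) v (Q - g ` A) \<le> dg R v (Q - g ` A) + nx Q R A g v"
    and "y \<in> Q - g ` A \<Longrightarrow> dg (resid P Q R A g) y (P - A) \<le> dg R y (P - A) + ny P R A g y"
proof -
  have d: "P \<inter> Q = {}" "finite P" "finite Q" using t unfolding tri_def by auto
  show "v \<in> P - A \<Longrightarrow> dg (resid P Q R A g) v (P - A) = dg R v (P - A)"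
    unfolding dg_def nb_def resid_def using d by (intro arg_cong[where f=card]) blast
  show "y \<in> Q - g ` A \<Longrightarrow> dg (resid P Q R A g) y (Q - g ` A) = dg R y (Q - g ` A)"
    unfolding dg_def nb_def resid_def using d by (intro arg_cong[where f=card]) blast
  assume v: "v \<in> P - A"
  have "nb (resid P Q R A g) v (Q - g ` A) \<subseteq>
     nb R v (Q - g ` A) \<union> {y \<in> Q - g ` A. newe R A g v y}"
    using d v unfolding nb_def resid_def by blast
  then have "card (nb (resid P Q R A g) v (Q - g ` A)) \<le>
     card (nb R v (Q - g ` A) \<union> {y \<in> Q - g ` A. newe R A g v y})"
    using d unfolding nb_def by (intro card_mono) auto
  also have "\<dots> \<le> dg R v (Q - g ` A) + nx Q R A g v" unfolding dg_def nx_def by (rule card_Un_le)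
  finally show "dg (resid P Q R A g) v (Q - g ` A) \<le> dg R v (Q - g ` A) + nx Q R A g v"
    unfolding dg_def .
next
  have d: "P \<inter> Q = {}" "finite P" "finite Q" using t unfolding tri_def by auto
  assume v: "y \<in> Q - g ` A"
  have "nb (resid P Q R A g) y (P - A) \<subseteq> nb R y (P - A) \<union> {u \<in> P - A. newe R A g u y}"
    using d v unfolding nb_def resid_def by blast
  then have "card (nb (resid P Q R A g) y (P - A)) \<le>
     card (nb R y (P - A) \<union> {u \<in> P - A. newe R A g u y})"
    using d unfolding nb_def by (intro card_mono) auto
  also have "\<dots> \<le> dg R y (P - A) + ny P R A g y" unfolding dg_def ny_def by (rule card_Un_le)
  finally show "dg (resid P Q R A g) y (P - A) \<le> dg R y (P - A) + ny P R A g y"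
    unfolding dg_def .
qed

lemma nx_ny_sum:
  assumes "finite P" "finite Q"
  shows "(\<Sum>y\<in>Q - g ` A. ny P R A g y) = (\<Sum>u\<in>P - A. nx Q R A g u)"
proof -
  have "ny P R A g y = (\<Sum>u\<in>P - A. if newe R A g u y then 1 else 0)" for y
    using assms unfolding ny_def by (simp add: sum.If_cases Int_def)
  moreover have "nx Q R A g u = (\<Sum>y\<in>Q - g ` A. if newe R A g u y then 1 else 0)" for u
    using assms unfolding nx_def by (simp add: sum.If_cases Int_def)
  ultimately show ?thesis by (simp add: sum.swap[of _ "P - A"])
qed

lemma sd_resid:
  assumes t: "tri P Q R" and p: "ppk R P Q A g"
  shows "sd (resid P Q R A g) ((P - A) \<union> (Q - g ` A))
    \<le> sd R ((P - A) \<union> (Q - g ` A)) + 2 * (\<Sum>u\<in>P - A. nx Q R A g u)"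
proof -
  let ?P = "P - A" and ?Q = "Q - g ` A" and ?R = "resid P Q R A g"
  have f: "finite ?P" "finite ?Q" "?P \<inter> ?Q = {}" "finite P" "finite Q" using t unfolding tri_def by auto
  have e: "sd S (?P \<union> ?Q) = (\<Sum>v\<in>?P. dg S v ?P + dg S v ?Q) + (\<Sum>v\<in>?Q. dg S v ?Q + dg S v ?P)"
    for S :: "'a \<Rightarrow> 'a \<Rightarrow> bool"
    unfolding sd_def using f by (simp add: sum.union_disjoint dg_Un add.commute)
  have "(\<Sum>v\<in>?P. dg ?R v ?P + dg ?R v ?Q) \<le> (\<Sum>v\<in>?P. (dg R v ?P + dg R v ?Q) + nx Q R A g v)"
    using resid_dg[OF t p] by (intro sum_mono) fastforce
  moreover have "(\<Sum>v\<in>?Q. dg ?R v ?Q + dg ?R v ?P) \<le> (\<Sum>v\<in>?Q. (dg R v ?Q + dg R v ?P) + ny P R A g v)"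
    using resid_dg[OF t p] by (intro sum_mono) fastforce
  ultimately show ?thesis unfolding e using nx_ny_sum[of P Q, where g=g and A=A and R=R] f by (simp add: sum.distrib)
qed

section \<open>Minimal counterexamples\<close>

text \<open>A counterexample of minimal order. By minimality no partial packing may lower the potential
  by \<open>3\<close> per placed pair.\<close>

locale mincx =
  fixes P Q :: "'a set" and R :: "'a \<Rightarrow> 'a \<Rightarrow> bool" and D :: nat
  assumes gd: "good P Q R D" and npk: "\<not> pk P Q R"
    and IH: "\<And>P' Q' R' D'. card P' < card P \<Longrightarrow> good P' Q' R' D' \<Longrightarrow> pk P' Q' (R' :: 'a \<Rightarrow> 'a \<Rightarrow> bool)"
begin

abbreviation "n \<equiv> card P"

lemma tr: "tri P Q R" using gd unfolding good_def by blast
lemma finP [simp]: "finite P" and finQ [simp]: "finite Q" and PQ: "P \<inter> Q = {}" and cardQ: "card Q = n"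
  using tr unfolding tri_def by auto
lemma sym: "R u v \<Longrightarrow> R v u" using tr unfolding tri_def by blast
lemma symiff: "R u v \<longleftrightarrow> R v u" using sym by blast
lemma irr [simp]: "\<not> R u u" using tr unfolding tri_def by blast
lemma Rin: "R u v \<Longrightarrow> u \<in> P \<union> Q" "R u v \<Longrightarrow> v \<in> P \<union> Q" using tr sym unfolding tri_def by blast+
lemma ownP: "v \<in> P \<Longrightarrow> dg R v P + 2 \<le> n" and crossP: "v \<in> P \<Longrightarrow> dg R v Q + 1 \<le> n"
  and ownQ: "y \<in> Q \<Longrightarrow> dg R y Q + 2 \<le> n" and crossQ: "y \<in> Q \<Longrightarrow> dg R y P + 1 \<le> n"
  using gd unfolding good_def by auto
lemma DP: "v \<in> P \<Longrightarrow> dg R v P \<le> D" and DQ: "y \<in> Q \<Longrightarrow> dg R y Q \<le> D"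
  and DPQ: "v \<in> P \<Longrightarrow> y \<in> Q \<Longrightarrow> dg R v P + dg R y P \<le> D + 4"
  and DQP: "v \<in> P \<Longrightarrow> y \<in> Q \<Longrightarrow> dg R y Q + dg R v Q \<le> D + 4"
  using gd unfolding good_def bnd_def by auto
lemma Fin: "sd R (P \<union> Q) + 2 * D + 836558 \<le> 6 * n" using gd unfolding good_def by blast

lemma swap: "mincx Q P R D"
proof
  show "good Q P R D" using gd good_swap by blast
  show "\<not> pk Q P R" using npk pk_swap tr by blast
  fix P' Q' :: "'a set" and R' :: "'a \<Rightarrow> 'a \<Rightarrow> bool" and D' :: nat
  assume "card P' < card Q" "good P' Q' R' D'"
  then show "pk P' Q' R'" using IH[of P' Q' R' D'] cardQ by argo
qed

text \<open>The only use of minimality. Just the edges at a chosen set \<open>Z\<close> of placed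
  vertices are credited, as losing more edges can only help. \<open>F\<close> then says that the
  doubled potential, including the change from \<open>D\<close> to \<open>D'\<close>, falls by at
  least 6 for each placed pair, while the other premises restore the degree conditions in the
  rest.\<close>

lemma reduction:
  assumes p: "ppk R P Q A g" and A: "A \<noteq> {}"
    and Z: "Z \<subseteq> A \<union> g ` A"
    and own: "\<And>v. v \<in> P - A \<Longrightarrow> dg R v (P - A) + 2 \<le> n - card A"
      "\<And>y. y \<in> Q - g ` A \<Longrightarrow> dg R y (Q - g ` A) + 2 \<le> n - card A"
    and cross: "\<And>v. v \<in> P - A \<Longrightarrow> dg R v (Q - g ` A) + nx Q R A g v + 1 \<le> n - card A"
      "\<And>y. y \<in> Q - g ` A \<Longrightarrow> dg R y (P - A) + ny P R A g y + 1 \<le> n - card A"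
    and b1: "\<And>v. v \<in> P - A \<Longrightarrow> dg R v (P - A) \<le> D'"
      "\<And>y. y \<in> Q - g ` A \<Longrightarrow> dg R y (Q - g ` A) \<le> D'"
    and b2: "\<And>v y. v \<in> P - A \<Longrightarrow> y \<in> Q - g ` A \<Longrightarrow>
        dg R v (P - A) + (dg R y (P - A) + ny P R A g y) \<le> D' + 4"
      "\<And>v y. v \<in> P - A \<Longrightarrow> y \<in> Q - g ` A \<Longrightarrow>
        dg R y (Q - g ` A) + (dg R v (Q - g ` A) + nx Q R A g v) \<le> D' + 4"
    and F: "sd R Z + 2 * (\<Sum>u\<in>P - A. nx Q R A g u) + 2 * D' + 6 * card A
        \<le> 2 * (\<Sum>z\<in>Z. dg R z (P \<union> Q)) + 2 * D"
  shows False
proof -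
  let ?P = "P - A" and ?Q = "Q - g ` A" and ?R = "resid P Q R A g"
  have AP: "A \<subseteq> P" "g ` A \<subseteq> Q" "finite A" using p finite_subset[OF _ finP] unfolding ppk_def by auto
  have cP: "card ?P = n - card A" using AP by (simp add: card_Diff_subset)
  have cA: "card A \<le> n" "card A > 0" using AP A by (auto intro: card_mono simp: card_gt_0_iff)
  have t: "tri ?P ?Q ?R" using tri_resid tr p by blast
  note d = resid_dg[OF tr p]
  have ZV: "Z \<subseteq> P \<union> Q" using Z AP by blast
  have "sd R (?P \<union> ?Q) \<le> sd R ((P \<union> Q) - Z)"
  proof -
    have sub: "?P \<union> ?Q \<subseteq> (P \<union> Q) - Z" using Z AP PQ by blast
    have "sd R (?P \<union> ?Q) \<le> (\<Sum>v\<in>?P \<union> ?Q. dg R v ((P \<union> Q) - Z))"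
      unfolding sd_def using sub by (intro sum_mono dg_mono) auto
    also have "\<dots> \<le> sd R ((P \<union> Q) - Z)" unfolding sd_def using sub by (intro sum_mono2) auto
    finally show ?thesis .
  qed
  moreover have "sd R ((P \<union> Q) - Z) + 2 * (\<Sum>z\<in>Z. dg R z (P \<union> Q)) = sd R (P \<union> Q) + sd R Z"
    by (rule sd_remove) (use ZV symiff in auto)
  moreover have "sd ?R (?P \<union> ?Q) \<le> sd R (?P \<union> ?Q) + 2 * (\<Sum>u\<in>?P. nx Q R A g u)"
    using sd_resid[OF tr p] .
  ultimately have "sd ?R (?P \<union> ?Q) + 2 * D' + 836558 \<le> 6 * (n - card A)"
    using F Fin cA by (simp add: diff_mult_distrib2)
  moreover have "bnd ?P ?Q ?R D'" unfolding bnd_def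
  proof (intro conjI ballI)
    fix v y assume v: "v \<in> ?P" and y: "y \<in> ?Q"
    show "dg ?R v ?P + dg ?R y ?P \<le> D' + 4" using d(1)[OF v] d(4)[OF y] b2(1)[OF v y] by linarith
    show "dg ?R y ?Q + dg ?R v ?Q \<le> D' + 4" using d(2)[OF y] d(3)[OF v] b2(2)[OF v y] by linarith
  qed (use d(1,2) b1 in auto)
  moreover have "dg ?R v ?P + 2 \<le> card ?P \<and> dg ?R v ?Q + 1 \<le> card ?P" if v: "v \<in> ?P" for v
    using d(1)[OF v] d(3)[OF v] own(1)[OF v] cross(1)[OF v] unfolding cP by linarith
  moreover have "dg ?R y ?Q + 2 \<le> card ?P \<and> dg ?R y ?P + 1 \<le> card ?P" if y: "y \<in> ?Q" for y
    using d(2)[OF y] d(4)[OF y] own(2)[OF y] cross(2)[OF y] unfolding cP by linarith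
  ultimately have "good ?P ?Q ?R D'" unfolding good_def cP using t by blast
  then have "pk ?P ?Q ?R" using IH[of ?P ?Q ?R D'] cP cA by linarith
  then show False using pk_resid tr p npk by blast
qed


section \<open>Degree counts and the placement of a single pair\<close>

lemma deg_split: "dg R v (P \<union> Q) = dg R v P + dg R v Q"
  using dg_Un[of P Q R v] PQ by simp

lemma dg_remove: "finite S \<Longrightarrow> x \<in> S \<Longrightarrow> dg R v S = dg R v (S - {x}) + (if R v x then 1 else 0)"
  using dg_Diff[of S "{x}" R v] by (simp add: dg_eq_sum)

lemma dg_pos_iff: "finite S \<Longrightarrow> 0 < dg R v S \<longleftrightarrow> (\<exists>u\<in>S. R v u)"
  unfolding dg_def nb_def by (auto simp: card_gt_0_iff)

lemma dg_eq_0_iff: "finite S \<Longrightarrow> dg R v S = 0 \<longleftrightarrow> (\<forall>u\<in>S. \<not> R v u)"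
  unfolding dg_def nb_def by auto

definition s1 where "s1 = (\<Sum>v\<in>P. dg R v P)"
definition s2 where "s2 = (\<Sum>y\<in>Q. dg R y Q)"
definition e3 where "e3 = (\<Sum>v\<in>P. dg R v Q)"

lemma e3_alt: "e3 = (\<Sum>y\<in>Q. dg R y P)"
  unfolding e3_def by (rule dg_sum_swap) (use symiff in auto)

lemma sd_eq: "sd R (P \<union> Q) = s1 + s2 + 2 * e3"
proof -
  have "sd R (P \<union> Q) = (\<Sum>v\<in>P. dg R v P + dg R v Q) + (\<Sum>v\<in>Q. dg R v P + dg R v Q)"
    unfolding sd_def deg_split using PQ by (simp add: sum.union_disjoint)
  then show ?thesis using e3_alt unfolding s1_def s2_def e3_def by (simp add: sum.distrib)
qed

lemma Feq: "s1 + s2 + 2 * e3 + 2 * D + 836558 \<le> 6 * n"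
  using Fin sd_eq by simp

text \<open>The additive constant alone forces this, so the induction needs no treatment of small
  orders.\<close>

lemma n_big: "139427 \<le> n" using Feq by linarith

text \<open>The star at \<open>v\<close> is counted once at its centre and once at its
  leaves.\<close>

lemma own_le_half: 
  assumes "v \<in> P" shows "2 * dg R v P \<le> s1"
proof -
  have "(\<Sum>u\<in>nb R v P. 1) \<le> (\<Sum>u\<in>nb R v P. dg R u P)"
  proof (rule sum_mono)
    fix u assume "u \<in> nb R v P"
    then have "R u v" unfolding nb_def using sym by auto
    then have "0 < dg R u P" using assms dg_pos_iff[OF finP] by blast
    then show "1 \<le> dg R u P" by simp
  qed
  then have "dg R v P + dg R v P \<le> dg R v P + (\<Sum>u\<in>nb R v P. dg R u P)" unfolding dg_def by simp
  also have "\<dots> = (\<Sum>u\<in>insert v (nb R v P). dg R u P)" unfolding nb_def by (subst sum.insert) auto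
  also have "\<dots> \<le> s1" unfolding s1_def using assms by (intro sum_mono2) (auto simp: nb_def)
  finally show ?thesis by simp
qed

text \<open>Placing \<open>x\<close> on \<open>y\<close> forbids every pair of a neighbour of
  \<open>x\<close> and a neighbour of \<open>y\<close>, at most \<open>dg R x P * dg R y Q\<close>
  new edges, and removes all edges at both. \<open>D'\<close> is left open because replacing
  \<open>D\<close> by \<open>D - 1\<close> can pay for one missing edge.\<close>

lemma single:
  assumes x: "x \<in> P" and y: "y \<in> Q" and xy: "\<not> R x y"
    and own: "\<And>v. v \<in> P \<Longrightarrow> v \<noteq> x \<Longrightarrow> dg R v (P - {x}) + 3 \<le> n"
      "\<And>q. q \<in> Q \<Longrightarrow> q \<noteq> y \<Longrightarrow> dg R q (Q - {y}) + 3 \<le> n"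
    and cross: "\<And>v. v \<in> P \<Longrightarrow> v \<noteq> x \<Longrightarrow>
        dg R v (Q - {y}) + (if R x v then dg R y Q else 0) + 2 \<le> n"
      "\<And>q. q \<in> Q \<Longrightarrow> q \<noteq> y \<Longrightarrow> dg R q (P - {x}) + (if R y q then dg R x P else 0) + 2 \<le> n"
    and b1: "\<And>v. v \<in> P \<Longrightarrow> v \<noteq> x \<Longrightarrow> dg R v (P - {x}) \<le> D'"
      "\<And>q. q \<in> Q \<Longrightarrow> q \<noteq> y \<Longrightarrow> dg R q (Q - {y}) \<le> D'"
    and b2: "\<And>v q. v \<in> P \<Longrightarrow> v \<noteq> x \<Longrightarrow> q \<in> Q \<Longrightarrow> q \<noteq> y \<Longrightarrow>
        dg R v (P - {x}) + dg R q (P - {x}) + (if R y q then dg R x P else 0) \<le> D' + 4"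
      "\<And>v q. v \<in> P \<Longrightarrow> v \<noteq> x \<Longrightarrow> q \<in> Q \<Longrightarrow> q \<noteq> y \<Longrightarrow>
        dg R q (Q - {y}) + dg R v (Q - {y}) + (if R x v then dg R y Q else 0) \<le> D' + 4"
    and F: "dg R x P * dg R y Q + D' + 3 \<le> dg R x (P \<union> Q) + dg R y (P \<union> Q) + D"
  shows False
proof -
  let ?g = "\<lambda>_. y" and ?A = "{x}"
  have xne: "x \<noteq> y" using x y PQ by blast
  have gA: "?g ` ?A = {y}" by simp
  have nx: "nx Q R ?A ?g u = (if R x u then dg R y Q else 0)" if "u \<in> P" for u
  proof -
    have "{q \<in> Q - {y}. newe R ?A ?g u q} = (if R x u then nb R y Q else {})"
      unfolding newe_def nb_def by auto
    then show ?thesis unfolding nx_def gA by (simp add: dg_def)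
  qed
  have ny: "ny P R ?A ?g q = (if R y q then dg R x P else 0)" if "q \<in> Q" for q
  proof -
    have "{u \<in> P - {x}. newe R ?A ?g u q} = (if R y q then nb R x P else {})"
      unfolding newe_def nb_def by auto
    then show ?thesis unfolding ny_def by (simp add: dg_def)
  qed
  have "(\<Sum>u\<in>P - ?A. nx Q R ?A ?g u) = (\<Sum>u\<in>P - {x}. if R x u then dg R y Q else 0)"
    using nx by (intro sum.cong) auto
  also have "\<dots> = dg R x P * dg R y Q"
  proof -
    have "(P - {x}) \<inter> {u. R x u} = nb R x P" unfolding nb_def by auto
    then show ?thesis by (simp add: sum.If_cases dg_def)
  qed
  finally have S: "(\<Sum>u\<in>P - ?A. nx Q R ?A ?g u) = dg R x P * dg R y Q" .
  have "sd R {x, y} = 0" unfolding sd_def dg_def nb_def using xy sym[of y x] xne by auto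
  then have F': "sd R {x, y} + 2 * (\<Sum>u\<in>P - ?A. nx Q R ?A ?g u) + 2 * D' + 6 * card ?A
        \<le> 2 * (\<Sum>z\<in>{x,y}. dg R z (P \<union> Q)) + 2 * D" unfolding S using F xne by simp
  show False
  proof (rule reduction[of ?A ?g "{x,y}" D'])
    show "ppk R P Q ?A ?g" unfolding ppk_def using x y xy by simp
    show "sd R {x, y} + 2 * (\<Sum>u\<in>P - ?A. nx Q R ?A ?g u) + 2 * D' + 6 * card ?A
        \<le> 2 * (\<Sum>z\<in>{x,y}. dg R z (P \<union> Q)) + 2 * D" by (rule F')
  next
    fix v assume "v \<in> P - {x}"
    then have v: "v \<in> P" "v \<noteq> x" by auto
    show "dg R v (P - {x}) + 2 \<le> n - card {x}" using own(1)[OF v] by simp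
    show "dg R v (P - {x}) \<le> D'" using b1(1)[OF v] .
    show "dg R v (Q - ?g ` {x}) + nx Q R {x} ?g v + 1 \<le> n - card {x}"
      using cross(1)[OF v] nx[OF v(1)] by simp
    fix q assume "q \<in> Q - ?g ` {x}"
    then have q: "q \<in> Q" "q \<noteq> y" by auto
    show "dg R v (P - {x}) + (dg R q (P - {x}) + ny P R {x} ?g q) \<le> D' + 4"
      using b2(1)[OF v q] ny[OF q(1)] by simp
    show "dg R q (Q - ?g ` {x}) + (dg R v (Q - ?g ` {x}) + nx Q R {x} ?g v) \<le> D' + 4"
      using b2(2)[OF v q] nx[OF v(1)] by simp
  next
    fix q assume "q \<in> Q - ?g ` {x}"
    then have q: "q \<in> Q" "q \<noteq> y" by auto
    show "dg R q (Q - ?g ` {x}) + 2 \<le> n - card {x}" using own(2)[OF q] by simp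
    show "dg R q (Q - ?g ` {x}) \<le> D'" using b1(2)[OF q] by simp
    show "dg R q (P - {x}) + ny P R {x} ?g q + 1 \<le> n - card {x}"
      using cross(2)[OF q] ny[OF q(1)] by simp
  qed (use gA in auto)
qed

lemma single_free:
  assumes x: "x \<in> P" and y: "y \<in> Q" and xy: "\<not> R x y" and z: "dg R x P = 0 \<or> dg R y Q = 0"
    and own: "\<And>v. v \<in> P \<Longrightarrow> v \<noteq> x \<Longrightarrow> dg R v (P - {x}) + 3 \<le> n"
      "\<And>q. q \<in> Q \<Longrightarrow> q \<noteq> y \<Longrightarrow> dg R q (Q - {y}) + 3 \<le> n"
    and cross: "\<And>v. v \<in> P \<Longrightarrow> v \<noteq> x \<Longrightarrow> dg R v (Q - {y}) + 2 \<le> n"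
      "\<And>q. q \<in> Q \<Longrightarrow> q \<noteq> y \<Longrightarrow> dg R q (P - {x}) + 2 \<le> n"
    and b1: "\<And>v. v \<in> P \<Longrightarrow> v \<noteq> x \<Longrightarrow> dg R v (P - {x}) \<le> D'"
      "\<And>q. q \<in> Q \<Longrightarrow> q \<noteq> y \<Longrightarrow> dg R q (Q - {y}) \<le> D'"
    and b2: "\<And>v q. v \<in> P \<Longrightarrow> v \<noteq> x \<Longrightarrow> q \<in> Q \<Longrightarrow> q \<noteq> y \<Longrightarrow>
        dg R v (P - {x}) + dg R q (P - {x}) \<le> D' + 4"
      "\<And>v q. v \<in> P \<Longrightarrow> v \<noteq> x \<Longrightarrow> q \<in> Q \<Longrightarrow> q \<noteq> y \<Longrightarrow>
        dg R q (Q - {y}) + dg R v (Q - {y}) \<le> D' + 4"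
    and F: "D' + 3 \<le> dg R x (P \<union> Q) + dg R y (P \<union> Q) + D"
  shows False
proof -
  have i1: "(if R x v then dg R y Q else 0) = 0" if "v \<in> P" for v
    using z that dg_eq_0_iff[OF finP] by auto
  have i2: "(if R y q then dg R x P else 0) = 0" if "q \<in> Q" for q
    using z that dg_eq_0_iff[OF finQ] by auto
  have p: "dg R x P * dg R y Q = 0" using z by auto
  show False
    by (rule single[OF x y xy, of D']) (use own cross b1 b2 F in \<open>simp_all add: i1 i2 p\<close>)
qed

text \<open>With \<open>D' = D\<close> all bounds by \<open>D\<close> are inherited, so three
  removed edges suffice; only the conditions that compare a degree with the order have to be
  checked.\<close>

lemma single_free_D:
  assumes x: "x \<in> P" and y: "y \<in> Q" and xy: "\<not> R x y" and z: "dg R x P = 0 \<or> dg R y Q = 0"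
    and own: "\<And>v. v \<in> P \<Longrightarrow> v \<noteq> x \<Longrightarrow> dg R v P + 3 \<le> n"
      "\<And>q. q \<in> Q \<Longrightarrow> q \<noteq> y \<Longrightarrow> dg R q Q + 3 \<le> n"
    and cross: "\<And>v. v \<in> P \<Longrightarrow> v \<noteq> x \<Longrightarrow> dg R v (Q - {y}) + 2 \<le> n"
      "\<And>q. q \<in> Q \<Longrightarrow> q \<noteq> y \<Longrightarrow> dg R q (P - {x}) + 2 \<le> n"
    and F: "3 \<le> dg R x (P \<union> Q) + dg R y (P \<union> Q)"
  shows False
proof -
  have m: "dg R v (P - {x}) \<le> dg R v P" "dg R v (Q - {y}) \<le> dg R v Q" for v
    by (auto intro!: dg_mono)
  show False
  proof (rule single_free[OF x y xy z, of D])
    fix v q assume vq: "v \<in> P" "v \<noteq> x" "q \<in> Q" "q \<noteq> y"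
    show "dg R v (P - {x}) + dg R q (P - {x}) \<le> D + 4" "dg R q (Q - {y}) + dg R v (Q - {y}) \<le> D + 4"
      using m DPQ[OF vq(1,3)] DQP[OF vq(1,3)] add_mono le_trans by meson+
  next
    fix v assume "v \<in> P" "v \<noteq> x" then show "dg R v (P - {x}) + 3 \<le> n" "dg R v (P - {x}) \<le> D"
      using m own DP by (meson add_mono order_refl le_trans)+
  next
    fix v assume "v \<in> Q" "v \<noteq> y" then show "dg R v (Q - {y}) + 3 \<le> n" "dg R v (Q - {y}) \<le> D"
      using m own DQ by (meson add_mono order_refl le_trans)+
  qed (use cross F in auto)
qed

end

section \<open>No vertex is joined to almost all of the other side\<close>

lemma pickout:
  assumes "finite B" "card B < card S" shows "\<exists>x\<in>S. x \<notin> B"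
  using assms by (metis card_mono leD subsetI)

context mincx
begin

text \<open>The slack 2 is a possible edge between \<open>u\<close> and \<open>v\<close>, seen from
  both ends.\<close>

lemma own_two:
  assumes "u \<in> P" "v \<in> P" "u \<noteq> v" shows "2 * dg R u P + 2 * dg R v P \<le> s1 + 2"
proof -
  have "sd R (P - {u,v}) + 2 * (\<Sum>z\<in>{u,v}. dg R z P) = sd R P + sd R {u,v}"
    by (rule sd_remove) (use assms symiff in auto)
  moreover have "sd R {u,v} \<le> card {u,v} * (card {u,v} - 1)" by (rule sd_le_square) auto
  moreover have "sd R P = s1" unfolding sd_def s1_def ..
  ultimately show ?thesis using assms by simp
qed

lemma cross_le_rest:
  assumes "z \<in> P" "v \<in> P" "v \<noteq> z" shows "dg R v Q + dg R z Q \<le> e3"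
proof -
  have "(\<Sum>v\<in>{v,z}. dg R v Q) \<le> e3" unfolding e3_def using assms by (intro sum_mono2) auto
  then show ?thesis using assms by simp
qed

text \<open>The edge between \<open>q\<close> and \<open>z\<close> is the only cross edge that both
  degrees can count, hence the 1.\<close>

lemma crossQ_le_rest:
  assumes "z \<in> P" "q \<in> Q" shows "dg R q P + dg R z Q \<le> e3 + 1"
proof -
  have "(\<Sum>v\<in>P-{z}. if R q v then 1 else 0) \<le> (\<Sum>v\<in>P-{z}. dg R v Q)"
    using assms sym dg_pos_iff[OF finQ] by (intro sum_mono) (auto simp: Suc_le_eq)
  then have "dg R q (P - {z}) \<le> (\<Sum>v\<in>P-{z}. dg R v Q)" by (simp add: dg_eq_sum)
  moreover have "e3 = (\<Sum>v\<in>P-{z}. dg R v Q) + dg R z Q" unfolding e3_def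
    using assms sum.remove[OF finP] by (metis add.commute)
  moreover have "dg R q P \<le> dg R q (P - {z}) + 1" using dg_remove[OF finP assms(1)] by auto
  ultimately show ?thesis by simp
qed

lemma s2_swap: "mincx.s1 Q R = s2" "mincx.s2 P R = s1" "mincx.e3 Q P R = e3"
  using mincx.s1_def[OF swap] mincx.s2_def[OF swap] mincx.e3_def[OF swap] e3_alt
  unfolding s1_def s2_def by auto

lemma own_le_halfQ: "y \<in> Q \<Longrightarrow> 2 * dg R y Q \<le> s2"
  using mincx.own_le_half[OF swap] s2_swap by simp

lemma card_pos_own: "card {v \<in> P. 0 < dg R v P} \<le> s1" and card_pos_ownQ: "card {v \<in> Q. 0 < dg R v Q} \<le> s2"
  using card_ge_le_sum[OF finP, of 1 "\<lambda>v. dg R v P"] card_ge_le_sum[OF finQ, of 1 "\<lambda>v. dg R v Q"]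
  unfolding s1_def s2_def by (simp_all add: Suc_le_eq)

lemma dgmP: "dg R v (P - {x}) \<le> dg R v P" and dgmQ: "dg R v (Q - {y}) \<le> dg R v Q"
  by (auto intro!: dg_mono)

text \<open>Own degree \<open>n - 2\<close> at \<open>u\<close> would become too large in a smaller
  triple, so \<open>x\<close> is chosen among the neighbours of \<open>u\<close>. It is placed on a
  neighbour \<open>y\<close> of \<open>z\<close> without own neighbours, which exists because the
  degrees at \<open>u\<close> and \<open>z\<close> leave little room for \<open>s2\<close>. Two
  edges vanish; the third unit is \<open>D\<close>, since every sum close to \<open>D\<close>
  involves the own degree of \<open>u\<close> or the cross degree of \<open>z\<close>, and both
  drop.\<close>

lemma near_cross_own_full:
  assumes z: "z \<in> P" "49 * n \<le> 50 * dg R z Q"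
    and c1: "\<And>v. v \<in> P \<Longrightarrow> v \<noteq> z \<Longrightarrow> dg R v Q + 2 \<le> n" and c2: "\<And>q. q \<in> Q \<Longrightarrow> dg R q P + 2 \<le> n"
    and u: "u \<in> P" "dg R u P + 2 = n"
  shows False
proof -
  have s1u: "2 * n \<le> s1 + 4" using own_le_half[OF u(1)] u(2) by linarith
  have Dn: "n \<le> D + 2" using DP[OF u(1)] u(2) by linarith
  have e3z: "dg R z Q \<le> e3" unfolding e3_def using z(1) by (intro member_le_sum) auto
  have "\<exists>x\<in>nb R u P. x \<notin> {z}"
    by (rule pickout) (use u(2) n_big in \<open>auto simp: dg_def\<close>)
  then obtain x where x: "x \<in> P" "R u x" "x \<noteq> z" unfolding nb_def by auto
  have "\<exists>y\<in>nb R z Q. y \<notin> {q \<in> Q. 0 < dg R q Q} \<union> nb R x Q"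
  proof (rule pickout)
    have "card ({q \<in> Q. 0 < dg R q Q} \<union> nb R x Q) \<le> s2 + dg R x Q"
      using card_Un_le[of "{q \<in> Q. 0 < dg R q Q}" "nb R x Q"] card_pos_ownQ unfolding dg_def by linarith
    also have "\<dots> < dg R z Q"
      using cross_le_rest[OF z(1) x(1,3)] Feq s1u Dn z(2) n_big by linarith
    finally show "card ({q \<in> Q. 0 < dg R q Q} \<union> nb R x Q) < card (nb R z Q)" unfolding dg_def .
  qed (simp add: nb_def)
  then obtain y where y: "y \<in> Q" "R z y" "dg R y Q = 0" "\<not> R x y" unfolding nb_def by auto
  have small: "4 * dg R v P \<le> n" if "v \<in> P" "v \<noteq> u" for v
    using own_two[OF u(1) that(1) that(2)[symmetric]] Feq s1u Dn z(2) n_big e3z u(2) by linarith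
  have e3s: "4 * e3 \<le> n + 4 * dg R z Q" and s2s: "4 * s2 \<le> n"
    using Feq s1u Dn z(2) n_big e3z by linarith+
  have vu: "dg R u (P - {x}) + 1 = dg R u P" using dg_remove[OF finP x(1), of u] x(2) by simp
  have vz: "dg R z (Q - {y}) + 1 = dg R z Q" using dg_remove[OF finQ y(1), of z] y(2) by simp
  show False
  proof (rule single_free[OF x(1) y(1) y(4), of "D - 1"])
    show "dg R x P = 0 \<or> dg R y Q = 0" using y by simp
    fix v assume v: "v \<in> P" "v \<noteq> x"
    have "dg R v (P - {x}) + 3 \<le> n \<and> dg R v (P - {x}) + 1 \<le> D"
    proof (cases "v = u")
      case True then show ?thesis using vu u(2) Dn by simp
    next
      case False then show ?thesis using small[OF v(1) False] dgmP[of v x] n_big Dn by linarith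
    qed
    then show "dg R v (P - {x}) + 3 \<le> n" "dg R v (P - {x}) \<le> D - 1" by auto
    show "dg R v (Q - {y}) + 2 \<le> n"
    proof (cases "v = z")
      case True then show ?thesis using vz crossP[OF z(1)] by simp
    next
      case False then show ?thesis using c1[OF v(1) False] dgmQ[of v y] by linarith
    qed
    fix q assume q: "q \<in> Q" "q \<noteq> y"
    show "dg R v (P - {x}) + dg R q (P - {x}) \<le> D - 1 + 4"
    proof (cases "v = u")
      case True
      then show ?thesis using DPQ[OF u(1) q(1)] vu dgmP[of q x] by simp
    next
      case False
      then show ?thesis using small[OF v(1) False] e3s crossQ_le_rest[OF z(1) q(1)] dgmP[of q x] dgmP[of v x] Dn n_big e3z
        by linarith
    qed
    show "dg R q (Q - {y}) + dg R v (Q - {y}) \<le> D - 1 + 4"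
    proof (cases "v = z")
      case True
      then show ?thesis using DQP[OF z(1) q(1)] vz dgmQ[of q y] by simp
    next
      case False
      then show ?thesis using s2s e3s own_le_halfQ[OF q(1)] cross_le_rest[OF z(1) v(1) False]
          dgmQ[of q y] dgmQ[of v y] Dn n_big e3z
        by linarith
    qed
  next
    fix q assume q: "q \<in> Q" "q \<noteq> y"
    show "dg R q (Q - {y}) + 3 \<le> n" "dg R q (Q - {y}) \<le> D - 1"
      using s2s own_le_halfQ[OF q(1)] dgmQ[of q y] Dn n_big by linarith+
    show "dg R q (P - {x}) + 2 \<le> n" using c2[OF q(1)] dgmP[of q x] by linarith
  next
    have "0 < dg R x P" using dg_pos_iff[OF finP] u(1) x(2) sym by blast
    moreover have "0 < dg R y P" using dg_pos_iff[OF finP] z(1) y(2) sym by blast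
    ultimately show "D - 1 + 3 \<le> dg R x (P \<union> Q) + dg R y (P \<union> Q) + D"
      using Dn n_big unfolding deg_split by linarith
  qed
qed

lemma isolated_rest_packs:
  assumes z: "z \<in> P" and iso: "\<And>x. x \<in> P \<Longrightarrow> x \<noteq> z \<Longrightarrow> dg R x (P \<union> Q) = 0"
  shows False
proof -
  have no: "\<not> R x u" if "x \<in> P" "x \<noteq> z" for x u
    using iso[OF that] dg_eq_0_iff[of "P \<union> Q" x] Rin(2) by auto
  have "\<exists>r\<in>Q. r \<notin> nb R z Q"
    by (rule pickout) (use crossP[OF z] cardQ in \<open>auto simp: dg_def nb_def\<close>)
  then obtain r where r: "r \<in> Q" "\<not> R z r" unfolding nb_def by auto
  have "card (P - {z}) = card (Q - {r})" using z r cardQ by simp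
  then obtain h where h: "bij_betw h (P - {z}) (Q - {r})" 
    using finite_same_card_bij[of "P - {z}" "Q - {r}"] by auto
  let ?f = "h(z := r)"
  have "bij_betw ?f (insert z (P - {z})) (insert r (Q - {r}))"
  proof -
    have "bij_betw ?f (P - {z}) (Q - {r})" using h by (rule bij_betw_cong[THEN iffD1, rotated]) simp
    then show ?thesis using notIn_Un_bij_betw3[of z "P - {z}" ?f "Q - {r}"] by simp
  qed
  then have "bij_betw ?f P Q" using z r by (simp add: insert_absorb)
  moreover have "\<not> R v (?f v)" if "v \<in> P" for v using no[OF that] r by (cases "v = z") auto
  moreover have "\<not> R u v" if "u \<in> P" "v \<in> P" for u v 
    using no[of u v] no[of v u] sym[of u v] that irr[of z] by (cases "u = z"; cases "v = z") auto
  ultimately have "pk P Q R" unfolding pk_def by blast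
  then show False using npk by blast
qed

text \<open>Some \<open>x\<close> of degree 1 is placed on the pendant vertex \<open>y\<close>; this
  removes two edges, so \<open>D\<close> has to drop by one. The bounds with the cross degree of
  \<open>z\<close> drop since \<open>z\<close> loses \<open>y\<close>. The other two critical bounds
  are the premises \<open>oz\<close> and \<open>bz\<close> of \<open>main\<close>, and
  \<open>x\<close> is chosen as a neighbour of whichever vertex may attain them: a vertex of
  \<open>Q\<close> with cross degree at least \<open>n/2\<close>, otherwise \<open>z\<close>
  itself.\<close>

lemma near_cross_pendant:
  assumes z: "z \<in> P" "49 * n \<le> 50 * dg R z Q"
    and c1: "\<And>v. v \<in> P \<Longrightarrow> v \<noteq> z \<Longrightarrow> dg R v Q + 2 \<le> n" and c2: "\<And>q. q \<in> Q \<Longrightarrow> dg R q P + 2 \<le> n"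
    and o1: "\<And>v. v \<in> P \<Longrightarrow> dg R v P + 3 \<le> n" and o2: "\<And>q. q \<in> Q \<Longrightarrow> dg R q Q + 3 \<le> n"
    and y: "y \<in> Q" "R z y" "dg R y Q = 0" "nb R y P = {z}"
    and le1: "\<And>x. x \<in> P \<Longrightarrow> x \<noteq> z \<Longrightarrow> dg R x (P \<union> Q) \<le> 1"
  shows False
proof -
  have Db: "dg R q Q + dg R z Q \<le> D + 4" if "q \<in> Q" for q using DQP[OF z(1) that] .
  have Dn: "49 * n \<le> 50 * D + 200" using Db[OF y(1)] z(2) by linarith
  have vz: "dg R z (Q - {y}) + 1 = dg R z Q" using dg_remove[OF finQ y(1), of z] y(2) by simp
  have own1: "dg R v P \<le> 1" "dg R v Q \<le> 1" if "v \<in> P" "v \<noteq> z" for v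
    using le1[OF that] unfolding deg_split by linarith+
  have main: False if x: "x \<in> P" "x \<noteq> z" "dg R x (P \<union> Q) = 1"
    and oz: "dg R z (P - {x}) + 1 \<le> D"
    and bz: "\<And>v q. v \<in> P \<Longrightarrow> q \<in> Q \<Longrightarrow> q \<noteq> y \<Longrightarrow> dg R v (P - {x}) + dg R q (P - {x}) + 1 \<le> D + 4" for x
  proof (rule single_free[OF x(1) y(1), of "D - 1"])
    show "\<not> R x y" using y(4) x sym unfolding nb_def by blast
    show "dg R x P = 0 \<or> dg R y Q = 0" using y by simp
    fix v assume v: "v \<in> P" "v \<noteq> x"
    show "dg R v (P - {x}) + 3 \<le> n" using o1[OF v(1)] dgmP[of v x] by linarith
    have "dg R v (P - {x}) + 1 \<le> D"
    proof (cases "v = z")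
      case True then show ?thesis using oz by simp
    next
      case False then show ?thesis using own1[OF v(1) False] dgmP[of v x] n_big Dn by linarith
    qed
    then show "dg R v (P - {x}) \<le> D - 1" by auto
    show "dg R v (Q - {y}) + 2 \<le> n"
    proof (cases "v = z")
      case True then show ?thesis using vz crossP[OF z(1)] by simp
    next
      case False then show ?thesis using c1[OF v(1) False] dgmQ[of v y] by linarith
    qed
    fix q assume q: "q \<in> Q" "q \<noteq> y"
    show "dg R v (P - {x}) + dg R q (P - {x}) \<le> D - 1 + 4" using bz[OF v(1) q] by linarith
    show "dg R q (Q - {y}) + dg R v (Q - {y}) \<le> D - 1 + 4"
    proof (cases "v = z")
      case True
      then show ?thesis using DQP[OF z(1) q(1)] vz dgmQ[of q y] by simp
    next
      case False
      then show ?thesis using own1[OF v(1) False] Db[OF q(1)] z(2)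
          dgmQ[of q y] dgmQ[of v y] Dn n_big by linarith
    qed
  next
    fix q assume q: "q \<in> Q" "q \<noteq> y"
    show "dg R q (Q - {y}) + 3 \<le> n" "dg R q (Q - {y}) \<le> D - 1"
      using Db[OF q(1)] o2[OF q(1)] dgmQ[of q y] z(2) n_big by linarith+
    show "dg R q (P - {x}) + 2 \<le> n" using c2[OF q(1)] dgmP[of q x] by linarith
  next
    have "0 < dg R y P" using dg_pos_iff[OF finP] z(1) y(2) sym by blast
    then show "D - 1 + 3 \<le> dg R x (P \<union> Q) + dg R y (P \<union> Q) + D"
      using x(3) Dn n_big unfolding deg_split[of y] by linarith
  qed
  show False
  proof (cases "\<exists>y'\<in>Q. n \<le> 2 * dg R y' P")
    case True
    then obtain y' where y': "y' \<in> Q" "n \<le> 2 * dg R y' P" by blast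
    have "\<exists>x\<in>nb R y' P. x \<notin> {z}" by (rule pickout) (use y' n_big in \<open>auto simp: dg_def\<close>)
    then obtain x where x: "x \<in> P" "R y' x" "x \<noteq> z" unfolding nb_def by auto
    have un: "False" if "v \<in> P" "v \<noteq> z" "R v a" "R v b" "a \<noteq> b" for v a b
    proof -
      have "card {a, b} \<le> dg R v (P \<union> Q)" unfolding dg_def nb_def
        using that Rin by (intro card_mono) auto
      then show False using le1[OF that(1,2)] that(5) by simp
    qed
    have "0 < dg R x (P \<union> Q)" using dg_pos_iff[of "P \<union> Q" x] x sym y' by auto
    then have dx: "dg R x (P \<union> Q) = 1" using le1[OF x(1,3)] by linarith
    have py: "dg R y' (P - {x}) + 1 = dg R y' P" using dg_remove[OF finP x(1), of y'] x(2) by simp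
    have zQ: "z \<notin> Q" using z PQ by blast
    \<comment> \<open>Vertices other than \<open>z\<close> have degree at most 1, so outside
      \<open>z\<close> the three neighbourhoods are disjoint subsets of \<open>P - {z}\<close>. At
      most two of them contain \<open>z\<close>, which turns \<open>n - 1\<close> into
      \<open>n + 1\<close>.\<close>
    have three: "dg R z P + dg R q P + dg R y' P \<le> n + 1" if q: "q \<in> Q" "q \<noteq> y'" for q
    proof -
      have "card (nb R z P \<union> (nb R q P - {z}) \<union> (nb R y' P - {z}))
          = card (nb R z P) + card (nb R q P - {z}) + card (nb R y' P - {z})"
      proof (subst card_Un_disjoint; (subst card_Un_disjoint)?)
        show "nb R z P \<inter> (nb R q P - {z}) = {}"
          using un[of _ z q] sym q zQ unfolding nb_def by blast
        show "(nb R z P \<union> (nb R q P - {z})) \<inter> (nb R y' P - {z}) = {}"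
          using un[of _ z y'] un[of _ q y'] sym q y' zQ unfolding nb_def by blast
      qed (auto simp: nb_def)
      moreover have "card (nb R z P \<union> (nb R q P - {z}) \<union> (nb R y' P - {z})) \<le> card (P - {z})"
        by (intro card_mono) (auto simp: nb_def)
      moreover have "card (P - {z}) = n - 1" using z by simp
      moreover have "card S \<le> card (S - {z}) + 1" for S :: "'a set"
        by (metis Suc_eq_plus1 card_Diff_singleton_if diff_Suc_1 eq_imp_le le_SucI le_diff_conv)
      ultimately show ?thesis using n_big \<open>\<And>S. card S \<le> card (S - {z}) + 1\<close>[of "nb R q P"]
         \<open>\<And>S. card S \<le> card (S - {z}) + 1\<close>[of "nb R y' P"] unfolding dg_def by linarith
    qed
    have two: "dg R z P + dg R y' P \<le> n + 1" 
    proof (cases "y = y'")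
      case True
      then have "dg R y' P = 1" using y(4) unfolding dg_def by simp
      then show ?thesis using y' n_big by linarith
    next
      case False then show ?thesis using three[OF y(1)] by linarith
    qed
    show False
    proof (rule main[OF x(1,3) dx])
      show "dg R z (P - {x}) + 1 \<le> D" using two dgmP[of z x] y'(2) Dn n_big by linarith
      fix v q assume v: "v \<in> P" and q: "q \<in> Q" "q \<noteq> y"
      show "dg R v (P - {x}) + dg R q (P - {x}) + 1 \<le> D + 4"
      proof (cases "q = y'")
        case True then show ?thesis using py DPQ[OF v y'(1)] dgmP[of v x] by simp
      next
        case q': False
        show ?thesis
        proof (cases "v = z")
          case True then show ?thesis using three[OF q(1) q'] dgmP[of z x] dgmP[of q x] y'(2) Dn n_big by simp
        next
          case False then show ?thesis using own1[OF v False] three[OF q(1) q'] dgmP[of v x] dgmP[of q x] y'(2) Dn n_big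
            by linarith
        qed
      qed
    qed
  next
    case False
    then have small: "2 * dg R q P \<le> n" if "q \<in> Q" for q using that by force
    show False
    proof (cases "dg R z P = 0")
      case True
      show False
      proof (cases "\<exists>x\<in>P. x \<noteq> z \<and> dg R x (P \<union> Q) = 1")
        case t: True
        then obtain x where x: "x \<in> P" "x \<noteq> z" "dg R x (P \<union> Q) = 1" by blast
        have z0: "dg R z (P - {x}) = 0" using True dgmP[of z x] by simp
        show False
        proof (rule main[OF x])
          show "dg R z (P - {x}) + 1 \<le> D" using z0 Dn n_big by linarith
          fix v q assume v: "v \<in> P" and q: "q \<in> Q" "q \<noteq> y"
          have "dg R v (P - {x}) \<le> 1" using own1[OF v] dgmP[of v x] z0 by (cases "v = z") auto
          then show "dg R v (P - {x}) + dg R q (P - {x}) + 1 \<le> D + 4"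
            using small[OF q(1)] dgmP[of q x] Dn n_big by linarith
        qed
      next
        case False
        then have "dg R x (P \<union> Q) = 0" if "x \<in> P" "x \<noteq> z" for x using le1[OF that] that by force
        then show False using isolated_rest_packs[OF z(1)] by blast
      qed
    next
      case False
      then obtain x where x: "x \<in> P" "R z x" using dg_pos_iff[OF finP] by auto
      then have xz: "x \<noteq> z" by auto
      have "0 < dg R x (P \<union> Q)" using dg_pos_iff[of "P \<union> Q" x] x sym z by auto
      then have dx: "dg R x (P \<union> Q) = 1" using le1[OF x(1) xz] by linarith
      have pz: "dg R z (P - {x}) + 1 = dg R z P" using dg_remove[OF finP x(1), of z] x(2) by simp
      show False
      proof (rule main[OF x(1) xz dx])
        show "dg R z (P - {x}) + 1 \<le> D" using pz DP[OF z(1)] by linarith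
        fix v q assume v: "v \<in> P" and q: "q \<in> Q" "q \<noteq> y"
        show "dg R v (P - {x}) + dg R q (P - {x}) + 1 \<le> D + 4"
        proof (cases "v = z")
          case True then show ?thesis using pz DPQ[OF z(1) q(1)] dgmP[of q x] by simp
        next
          case False then show ?thesis using own1[OF v False] small[OF q(1)] dgmP[of q x] dgmP[of v x] Dn n_big by linarith
        qed
      qed
    qed
  qed
qed


text \<open>Since \<open>y\<close> has one own neighbour, placing \<open>x\<close> on it creates
  \<open>dg R x P\<close> edges, just as many as the own edges of \<open>x\<close> that vanish. The
  two edges at \<open>y\<close> and a drop of \<open>D\<close> give the gain 3. The vertex
  \<open>x\<close> must not be a neighbour of \<open>z\<close>: otherwise \<open>z\<close> could
  trade its lost edge to \<open>y\<close> for a new cross edge and \<open>D\<close> would not drop.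
  That no neighbour of \<open>z\<close> is isolated in \<open>Q\<close> bounds \<open>s2\<close>
  from below and hence everything else from above.\<close>

lemma near_cross_leafy:
  assumes z: "z \<in> P" "49 * n \<le> 50 * dg R z Q"
    and o1: "\<And>v. v \<in> P \<Longrightarrow> dg R v P + 3 \<le> n" and o2: "\<And>q. q \<in> Q \<Longrightarrow> dg R q Q + 3 \<le> n"
    and y: "y \<in> Q" "R z y" "dg R y Q = 1" and no0: "\<And>q. q \<in> Q \<Longrightarrow> R z q \<Longrightarrow> dg R q Q \<noteq> 0"
  shows False
proof -
  have Db: "dg R q Q + dg R z Q \<le> D + 4" if "q \<in> Q" for q using DQP[OF z(1) that] .
  have Dn: "49 * n \<le> 50 * D + 150" using Db[OF y(1)] z(2) y(3) by linarith
  have vz: "dg R z (Q - {y}) + 1 = dg R z Q" using dg_remove[OF finQ y(1), of z] y(2) by simp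
  have e3z: "dg R z Q \<le> e3" unfolding e3_def using z(1) by (intro member_le_sum) auto
  have s2z: "dg R z Q \<le> s2"
  proof -
    have "(\<Sum>q\<in>nb R z Q. 1) \<le> (\<Sum>q\<in>nb R z Q. dg R q Q)"
      using no0 unfolding nb_def by (intro sum_mono) (auto simp: Suc_le_eq)
    also have "\<dots> \<le> s2" unfolding s2_def by (intro sum_mono2) (auto simp: nb_def)
    finally show ?thesis unfolding dg_def by simp
  qed
  have bud: "5 * s1 + 10 * (e3 - dg R z Q) + 10 * dg R q Q \<le> 6 * n" if "q \<in> Q" for q
    using Feq Db[OF that] s2z z(2) e3z n_big by linarith
  define c where "c = e3 - dg R z Q"
  have cz: "e3 = c + dg R z Q" using e3z unfolding c_def by simp
  have cP: "dg R v Q \<le> c" if "v \<in> P" "v \<noteq> z" for v using cross_le_rest[OF z(1) that] cz by linarith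
  have cQ: "dg R q P \<le> c + 1" if "q \<in> Q" for q using crossQ_le_rest[OF z(1) that] cz by linarith
  have sb: "10 * dg R v P + 10 * c \<le> 6 * n" if "v \<in> P" for v
    using bud[OF y(1)] own_le_half[OF that] unfolding c_def by linarith
  define t where "t = n div 10 + 1"
  have t: "n < 10 * t" "10 * t \<le> n + 10" unfolding t_def by presburger+
  let ?big = "{v \<in> P. t \<le> dg R v P}"
  have ct: "card ?big * t \<le> s1"
    unfolding s1_def by (rule card_ge_le_sum) simp
  have big: "card ?big < 13"
  proof (rule ccontr)
    assume "\<not> card ?big < 13"
    then have "13 * t \<le> card ?big * t" by (intro mult_right_mono) auto
    then have "13 * t \<le> s1" using ct by linarith
    then show False using bud[OF y(1)] n_big t by linarith
  qed
  have "\<exists>x\<in>P. x \<notin> nb R z P \<union> nb R y P \<union> ?big \<union> {z}"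
  proof (rule pickout)
    have "card (nb R z P \<union> nb R y P \<union> ?big \<union> {z}) \<le> card (nb R z P) + card (nb R y P) + card ?big + card {z}"
      by (meson add_mono card_Un_le le_trans order_refl)
    also have "\<dots> < n" using sb[OF z(1)] cQ[OF y(1)] big n_big unfolding dg_def by simp
    finally show "card (nb R z P \<union> nb R y P \<union> ?big \<union> {z}) < n" .
  qed (auto simp: nb_def)
  then obtain x where x: "x \<in> P" "\<not> R z x" "\<not> R y x" "dg R x P < t" "x \<noteq> z"
    unfolding nb_def by auto
  have x10: "10 * dg R x P \<le> n" using x(4) t by linarith
  have qb: "10 * dg R q Q + 10 * c \<le> 6 * n" if "q \<in> Q" for q using bud[OF that] unfolding c_def by linarith
  have yif: "(if R x v then dg R y Q else 0) \<le> 1" for v using y(3) by simp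
  have xif: "(if R y q then dg R x P else 0) \<le> dg R x P" for q by simp
  show False
  proof (rule single[OF x(1) y(1), of "D - 1"])
    show "\<not> R x y" using x(3) sym by blast
    fix v assume v: "v \<in> P" "v \<noteq> x"
    show "dg R v (P - {x}) + 3 \<le> n" using o1[OF v(1)] dgmP[of v x] by linarith
    show "dg R v (Q - {y}) + (if R x v then dg R y Q else 0) + 2 \<le> n"
    proof (cases "v = z")
      case True then show ?thesis using vz crossP[OF z(1)] x(2) sym by auto
    next
      case False then show ?thesis using cP[OF v(1) False] sb[OF v(1)] dgmQ[of v y] yif[of v] n_big by linarith
    qed
    show "dg R v (P - {x}) \<le> D - 1" using sb[OF v(1)] dgmP[of v x] Dn n_big by linarith
    fix q assume q: "q \<in> Q" "q \<noteq> y"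
    show "dg R v (P - {x}) + dg R q (P - {x}) + (if R y q then dg R x P else 0) \<le> D - 1 + 4"
      using sb[OF v(1)] cQ[OF q(1)] dgmP[of v x] dgmP[of q x] xif[of q] x10 Dn n_big by linarith
    show "dg R q (Q - {y}) + dg R v (Q - {y}) + (if R x v then dg R y Q else 0) \<le> D - 1 + 4"
    proof (cases "v = z")
      case True
      then show ?thesis using Db[OF q(1)] vz dgmQ[of q y] x(2) sym by auto
    next
      case False
      then show ?thesis using qb[OF q(1)] cP[OF v(1) False] dgmQ[of q y] dgmQ[of v y] yif[of v] Dn n_big by linarith
    qed
  next
    fix q assume q: "q \<in> Q" "q \<noteq> y"
    show "dg R q (Q - {y}) + 3 \<le> n" using o2[OF q(1)] dgmQ[of q y] by linarith
    show "dg R q (Q - {y}) \<le> D - 1" using qb[OF q(1)] dgmQ[of q y] Dn n_big by linarith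
    show "dg R q (P - {x}) + (if R y q then dg R x P else 0) + 2 \<le> n"
      using cQ[OF q(1)] sb[OF z(1)] dgmP[of q x] xif[of q] x10 n_big by linarith
  next
    have "0 < dg R y P" using dg_pos_iff[OF finP] z(1) y(2) sym by blast
    then show "dg R x P * dg R y Q + (D - 1) + 3 \<le> dg R x (P \<union> Q) + dg R y (P \<union> Q) + D"
      using y(3) Dn n_big unfolding deg_split by simp
  qed
qed

text \<open>Case distinction on the least own degree among the neighbours \<open>y\<close> of
  \<open>z\<close>. If it is 0, any non-neighbour of \<open>y\<close> can be placed on
  \<open>y\<close> without new edges, so almost no edges are left at \<open>y\<close> and on
  \<open>P\<close>. If it is at least 2, \<open>s2\<close> is so large that \<open>P\<close>
  contains an isolated vertex, and placing it on \<open>y\<close> removes three edges.\<close>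

lemma near_cross_aux:
  assumes z: "z \<in> P" "49 * n \<le> 50 * dg R z Q"
    and c1: "\<And>v. v \<in> P \<Longrightarrow> v \<noteq> z \<Longrightarrow> dg R v Q + 2 \<le> n" and c2: "\<And>q. q \<in> Q \<Longrightarrow> dg R q P + 2 \<le> n"
  shows False
proof -
  have Db: "dg R q Q + dg R z Q \<le> D + 4" if "q \<in> Q" for q using DQP[OF z(1) that] .
  have e3z: "dg R z Q \<le> e3" unfolding e3_def using z(1) by (intro member_le_sum) auto
  have o1: "dg R v P + 3 \<le> n" if "v \<in> P" for v
    using near_cross_own_full[OF z c1 c2 that] ownP[OF that] by fastforce
  have o2: "dg R q Q + 3 \<le> n" if "q \<in> Q" for q
  proof (rule ccontr)
    assume "\<not> ?thesis"
    then have "dg R q Q + 2 = n" using ownQ[OF that] by linarith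
    then show False using Db[OF that] own_le_halfQ[OF that] Feq z(2) e3z n_big by linarith
  qed
  have Qne: "\<exists>y\<in>Q. R z y" using dg_pos_iff[OF finQ, of z] z n_big by linarith
  have cz: "dg R v (Q - {y}) + 2 \<le> n" if "y \<in> Q" "R z y" "v \<in> P" for v y
  proof (cases "v = z")
    case True then show ?thesis using dg_remove[OF finQ that(1), of z] that crossP[OF z(1)] by simp
  next
    case False then show ?thesis using c1[OF that(3) False] dgmQ[of v y] by linarith
  qed
  have free: False if "x \<in> P" "y \<in> Q" "R z y" "\<not> R x y" "dg R x P = 0 \<or> dg R y Q = 0"
     "3 \<le> dg R x (P \<union> Q) + dg R y (P \<union> Q)" for x y
  proof (rule single_free_D[OF that(1,2,4,5)])
    fix q assume q: "q \<in> Q" "q \<noteq> y" show "dg R q (P - {x}) + 2 \<le> n" using c2[OF q(1)] dgmP[of q x] by linarith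
  qed (use o1 o2 cz that in auto)
  have yP: "0 < dg R y P" if "R z y" for y using dg_pos_iff[OF finP] z(1) that sym by blast
  show False
  proof (cases "\<exists>y\<in>Q. R z y \<and> dg R y Q = 0")
    case True
    then obtain y where y: "y \<in> Q" "R z y" "dg R y Q = 0" by blast
    have small: "dg R x (P \<union> Q) \<le> 1" if "x \<in> P" "\<not> R x y" for x
      using free[OF that(1) y(1,2) that(2)] y yP[OF y(2)] unfolding deg_split[of y] by fastforce
    have "\<exists>x\<in>P. x \<notin> nb R y P" by (rule pickout) (use crossQ[OF y(1)] in \<open>auto simp: dg_def nb_def\<close>)
    then obtain x where x: "x \<in> P" "\<not> R x y" unfolding nb_def using sym by blast
    have le2: "dg R y P \<le> 2" "dg R x (P \<union> Q) + dg R y P \<le> 2"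
      using free[OF x(1) y(1,2) x(2)] y yP[OF y(2)] unfolding deg_split[of y] by fastforce+
    show False
    proof (cases "dg R y P = 1")
      case True
      have "nb R y P = {z}"
      proof -
        have "z \<in> nb R y P" using z y sym unfolding nb_def by auto
        then show ?thesis using True unfolding dg_def by (metis card_1_singletonE singletonD)
      qed
      then show False using near_cross_pendant[OF z c1 c2 o1 o2 y] small sym unfolding nb_def by blast
    next
      case False
      \<comment> \<open>Now only the two neighbours of \<open>y\<close> in \<open>P\<close> can have
        any edges. Placing an isolated \<open>x\<close> on \<open>y\<close> removes just two edges,
        but every vertex of \<open>P\<close> with edges loses the cross neighbour \<open>y\<close>,
        so \<open>D\<close> can drop by one.\<close>
      then have two: "dg R y P = 2" using le2 yP[OF y(2)] by linarith
      have iso: "dg R v (P \<union> Q) = 0" if "v \<in> P" "\<not> R v y" for v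
        using free[OF that(1) y(1,2) that(2)] y two unfolding deg_split[of y] by fastforce
      have noR: "R y u" if "R u w" "u \<in> P" for u w
      proof (rule ccontr)
        assume "\<not> R y u"
        then have "\<not> R u y" using sym by blast
        then have "dg R u (P \<union> Q) = 0" using iso that(2) by blast
        then show False using that(1) dg_eq_0_iff[of "P \<union> Q" u] Rin(2)[OF that(1)] by simp
      qed
      have cq: "dg R q P \<le> 2" if "q \<in> Q" for q
      proof -
        have "nb R q P \<subseteq> nb R y P" unfolding nb_def using noR symiff by auto
        then have "dg R q P \<le> dg R y P" unfolding dg_def by (intro card_mono) (auto simp: nb_def)
        then show ?thesis using two by simp
      qed
      have ov: "dg R v P \<le> 2" if "v \<in> P" for v
      proof -
        have "nb R v P \<subseteq> nb R y P" unfolding nb_def using noR symiff by auto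
        then have "dg R v P \<le> dg R y P" unfolding dg_def by (intro card_mono) (auto simp: nb_def)
        then show ?thesis using two by simp
      qed
      show False
      proof (rule single_free[OF x(1) y(1) x(2), of "D - 1"])
        show "dg R x P = 0 \<or> dg R y Q = 0" using y by simp
        have Dn: "49 * n \<le> 50 * D + 200" using Db[OF y(1)] z(2) by linarith
        fix v assume v: "v \<in> P" "v \<noteq> x"
        show "dg R v (P - {x}) + 3 \<le> n" using o1[OF v(1)] dgmP[of v x] by linarith
        show "dg R v (P - {x}) \<le> D - 1" using ov[OF v(1)] dgmP[of v x] Dn n_big by linarith
        show "dg R v (Q - {y}) + 2 \<le> n" using cz y v by blast
        fix q assume q: "q \<in> Q" "q \<noteq> y"
        show "dg R v (P - {x}) + dg R q (P - {x}) \<le> D - 1 + 4"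
          using ov[OF v(1)] cq[OF q(1)] dgmP[of v x] dgmP[of q x] Dn n_big by linarith
        show "dg R q (Q - {y}) + dg R v (Q - {y}) \<le> D - 1 + 4"
        proof (cases "R v y")
          case True
          then show ?thesis using DQP[OF v(1) q(1)] dg_remove[OF finQ y(1), of v] dgmQ[of q y] by simp
        next
          case False
          then have "dg R v Q = 0" using iso[OF v(1)] unfolding deg_split by simp
          then show ?thesis using Db[OF q(1)] z(2) n_big dgmQ[of q y] dgmQ[of v y] by linarith
        qed
      next
        fix q assume q: "q \<in> Q" "q \<noteq> y"
        show "dg R q (Q - {y}) + 3 \<le> n" using o2[OF q(1)] dgmQ[of q y] by linarith
        show "dg R q (Q - {y}) \<le> D - 1" using Db[OF q(1)] z(2) n_big dgmQ[of q y] by linarith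
        show "dg R q (P - {x}) + 2 \<le> n" using c2[OF q(1)] dgmP[of q x] by linarith
      next
        show "D - 1 + 3 \<le> dg R x (P \<union> Q) + dg R y (P \<union> Q) + D"
          using two Db[OF y(1)] z(2) n_big unfolding deg_split[of y] by linarith
      qed
    qed
  next
    case no0: False
    show False
    proof (cases "\<exists>y\<in>Q. R z y \<and> dg R y Q = 1")
      case True
      then obtain y where y: "y \<in> Q" "R z y" "dg R y Q = 1" by blast
      show False by (rule near_cross_leafy[OF z o1 o2 y]) (use no0 in auto)
    next
      case False
      have ge2: "2 \<le> dg R y Q" if "y \<in> Q" "R z y" for y
        using that False no0 by (metis One_nat_def Suc_leI less_2_cases_iff linorder_not_less)
      have "(\<Sum>q\<in>nb R z Q. 2) \<le> (\<Sum>q\<in>nb R z Q. dg R q Q)"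
        using ge2 unfolding nb_def by (intro sum_mono) auto
      also have "\<dots> \<le> s2" unfolding s2_def by (intro sum_mono2) (auto simp: nb_def)
      finally have s2z: "2 * dg R z Q \<le> s2" unfolding dg_def by simp
      obtain y where y: "y \<in> Q" "R z y" using Qne by blast
      let ?X = "{v \<in> P. 0 < dg R v P} \<union> {v \<in> P - {z}. 1 \<le> dg R v Q} \<union> {z}"
      have "\<exists>x\<in>P. x \<notin> ?X"
      proof (rule pickout)
        have "card {v \<in> P - {z}. 1 \<le> dg R v Q} * 1 \<le> (\<Sum>v\<in>P-{z}. dg R v Q)" by (rule card_ge_le_sum) simp
        moreover have "e3 = (\<Sum>v\<in>P-{z}. dg R v Q) + dg R z Q" unfolding e3_def
          using z(1) sum.remove[OF finP] by (metis add.commute)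
        ultimately have "card {v \<in> P - {z}. 1 \<le> dg R v Q} + dg R z Q \<le> e3" by linarith
        moreover have "card ?X \<le> card {v \<in> P. 0 < dg R v P} + card {v \<in> P - {z}. 1 \<le> dg R v Q} + card {z}"
          by (meson add_mono card_Un_le le_trans order_refl)
        moreover have "card {z} = 1" by simp
        ultimately show "card ?X < n" using card_pos_own s2z Feq Db[OF y(1)] ge2[OF y] z(2) n_big by linarith
      qed auto
      then obtain x where x: "x \<in> P" "dg R x P = 0" "dg R x Q = 0" by auto
      have "\<not> R x y" using x(3) y(1) dg_eq_0_iff[OF finQ] by blast
      then show False using free[OF x(1) y _ disjI1[OF x(2)]] ge2[OF y] yP[OF y(2)] unfolding deg_split by linarith
    qed
  qed
qed

text \<open>The previous lemma wants all other cross degrees to be at most \<open>n - 2\<close>. If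
  some vertex of either side has cross degree \<open>n - 1\<close>, the lemma is applied to that
  vertex: the edge budget admits no second one.\<close>

lemma crossP_small: assumes "z \<in> P" shows "50 * dg R z Q < 49 * n"
proof (rule ccontr)
  assume "\<not> ?thesis"
  then have z: "49 * n \<le> 50 * dg R z Q" by simp
  interpret S: mincx Q P R D by (rule swap)
  show False
  proof (cases "\<exists>v\<in>P. dg R v Q + 1 = n")
    case True
    then obtain v where v: "v \<in> P" "dg R v Q + 1 = n" by blast
    have "Q \<noteq> {}" using cardQ n_big by auto
    then obtain q0 where q0: "q0 \<in> Q" by blast
    have Dv: "dg R v Q \<le> D + 4" using DQP[OF v(1) q0] by linarith
    show False
    proof (rule near_cross_aux[OF v(1)])
      show "49 * n \<le> 50 * dg R v Q" using v(2) n_big by linarith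
      show "dg R u Q + 2 \<le> n" if "u \<in> P" "u \<noteq> v" for u
        using cross_le_rest[OF v(1) that] crossP[OF that(1)] Feq Dv v(2) by linarith
      show "dg R q P + 2 \<le> n" if "q \<in> Q" for q
        using crossQ_le_rest[OF v(1) that] crossQ[OF that(1)] Feq Dv v(2) by linarith
    qed
  next
    case f1: False
    then have c1: "dg R v Q + 2 \<le> n" if "v \<in> P" for v using crossP[OF that] that by fastforce
    show False
    proof (cases "\<exists>q\<in>Q. dg R q P + 1 = n")
      case True
      then obtain q where q: "q \<in> Q" "dg R q P + 1 = n" by blast
      have Dv: "dg R q P \<le> D + 4" using DPQ[OF assms q(1)] by linarith
      show False
      proof (rule S.near_cross_aux[OF q(1)])
        show "49 * card Q \<le> 50 * dg R q P" using q(2) n_big cardQ by linarith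
        show "dg R u P + 2 \<le> card Q" if "u \<in> Q" "u \<noteq> q" for u
          using S.cross_le_rest[OF q(1) that] crossQ[OF that(1)] Feq Dv q(2) s2_swap cardQ by linarith
        show "dg R u Q + 2 \<le> card Q" if "u \<in> P" for u using c1[OF that] cardQ by linarith
      qed
    next
      case False
      then have "dg R q P + 2 \<le> n" if "q \<in> Q" for q using crossQ[OF that] that by fastforce
      then show False using near_cross_aux[OF assms z] c1 by blast
    qed
  qed
qed

end

section \<open>No vertex is joined to almost all of its own side\<close>

lemma greedy_reps:
  assumes "finite K" "\<And>q. q \<in> K \<Longrightarrow> finite (F q)" "\<And>q. q \<in> K \<Longrightarrow> card K \<le> card (F q)"
  shows "\<exists>x. inj_on x K \<and> (\<forall>q\<in>K. x q \<in> F q)"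
proof -
  have "\<exists>x. inj_on x L \<and> (\<forall>q\<in>L. x q \<in> F q)" if "L \<subseteq> K" for L
    using finite_subset[OF that assms(1)] that
  proof (induction L rule: finite_induct)
    case empty then show ?case by simp
  next
    case (insert q L)
    then obtain x where x: "inj_on x L" "\<forall>q\<in>L. x q \<in> F q" by auto
    have "card (x ` L) < card (F q)"
    proof -
      have "card (x ` L) \<le> card L" using insert.hyps by (intro card_image_le)
      also have "\<dots> < card (insert q L)" using insert.hyps by simp
      also have "\<dots> \<le> card K" using insert.prems assms(1) by (intro card_mono)
      finally show ?thesis using assms(3)[of q] insert.prems by simp
    qed
    then obtain p where p: "p \<in> F q" "p \<notin> x ` L" using pickout[of "x ` L" "F q"] insert.hyps by auto
    have "inj_on (x(q := p)) (insert q L)" using x(1) p(2) insert.hyps(2) by (auto simp: inj_on_def)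
    moreover have "\<forall>r\<in>insert q L. (x(q := p)) r \<in> F r" using x(2) p(1) by simp
    ultimately show ?case by blast
  qed
  then show ?thesis by blast
qed

context mincx
begin

lemma crossQ_small: "q \<in> Q \<Longrightarrow> 50 * dg R q P < 49 * n"
  using mincx.crossP_small[OF swap] cardQ by simp

text \<open>Here \<open>\<iota>\<close> bounds the new edges at any single vertex, so
  \<open>D + \<iota>\<close> is a valid bound for the rest; the price is the summand
  \<open>2 * \<iota>\<close> in \<open>F\<close>.\<close>

lemma reduction_cost:
  assumes p: "ppk R P Q A g" and A: "A \<noteq> {}" and Z: "Z \<subseteq> A \<union> g ` A"
    and own: "\<And>v. v \<in> P - A \<Longrightarrow> dg R v (P - A) + 2 \<le> n - card A"
      "\<And>y. y \<in> Q - g ` A \<Longrightarrow> dg R y (Q - g ` A) + 2 \<le> n - card A"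
    and i: "\<And>v. v \<in> P - A \<Longrightarrow> nx Q R A g v \<le> \<iota>" "\<And>y. y \<in> Q - g ` A \<Longrightarrow> ny P R A g y \<le> \<iota>"
    and c: "\<And>v. v \<in> P - A \<Longrightarrow> dg R v Q + \<iota> + card A + 1 \<le> n"
      "\<And>y. y \<in> Q - g ` A \<Longrightarrow> dg R y P + \<iota> + card A + 1 \<le> n"
    and F: "sd R Z + 2 * (\<Sum>u\<in>P - A. nx Q R A g u) + 2 * \<iota> + 6 * card A \<le> 2 * (\<Sum>z\<in>Z. dg R z (P \<union> Q))"
  shows False
proof (rule reduction[OF p A Z own, of "D + \<iota>"])
  have mP: "dg R v (P - A) \<le> dg R v P" and mQ: "dg R v (Q - g ` A) \<le> dg R v Q" for v
    by (auto intro!: dg_mono)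
  show "sd R Z + 2 * (\<Sum>u\<in>P - A. nx Q R A g u) + 2 * (D + \<iota>) + 6 * card A
      \<le> 2 * (\<Sum>z\<in>Z. dg R z (P \<union> Q)) + 2 * D" using F by simp
  {
    fix v assume v: "v \<in> P - A"
    then have vP: "v \<in> P" by blast
    show "dg R v (Q - g ` A) + nx Q R A g v + 1 \<le> n - card A"
      using c(1)[OF v] i(1)[OF v] mQ[of v] by linarith
    show "dg R v (P - A) \<le> D + \<iota>" using DP[OF vP] mP[of v] by linarith
    fix y assume y: "y \<in> Q - g ` A"
    then have yQ: "y \<in> Q" by blast
    show "dg R v (P - A) + (dg R y (P - A) + ny P R A g y) \<le> D + \<iota> + 4"
      using DPQ[OF vP yQ] i(2)[OF y] mP[of v] mP[of y] by linarith
    show "dg R y (Q - g ` A) + (dg R v (Q - g ` A) + nx Q R A g v) \<le> D + \<iota> + 4"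
      using DQP[OF vP yQ] i(1)[OF v] mQ[of v] mQ[of y] by linarith
  }
  fix y assume y: "y \<in> Q - g ` A"
  then have yQ: "y \<in> Q" by blast
  show "dg R y (P - A) + ny P R A g y + 1 \<le> n - card A"
    using c(2)[OF y] i(2)[OF y] mP[of y] by linarith
  show "dg R y (Q - g ` A) \<le> D + \<iota>" using DQ[OF yQ] mQ[of y] by linarith
qed

lemma reduction_free:
  assumes p: "ppk R P Q A g" and A: "A \<noteq> {}" and Z: "Z \<subseteq> A \<union> g ` A"
    and own: "\<And>v. v \<in> P - A \<Longrightarrow> dg R v (P - A) + 2 \<le> n - card A"
      "\<And>y. y \<in> Q - g ` A \<Longrightarrow> dg R y (Q - g ` A) + 2 \<le> n - card A"
    and free: "\<And>a u y. a \<in> A \<Longrightarrow> u \<in> P - A \<Longrightarrow> y \<in> Q - g ` A \<Longrightarrow> R a u \<Longrightarrow> R (g a) y \<Longrightarrow> False"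
    and s: "50 * card A + 50 \<le> n"
    and F: "sd R Z + 6 * card A \<le> 2 * (\<Sum>z\<in>Z. dg R z (P \<union> Q))"
  shows False
proof (rule reduction_cost[OF p A Z own, of 0])
  have e: "\<not> newe R A g u y" if "u \<in> P - A" "y \<in> Q - g ` A" for u y
    using free that unfolding newe_def by blast
  have nx0: "nx Q R A g v = 0" if "v \<in> P - A" for v
  proof -
    have "{y \<in> Q - g ` A. newe R A g v y} = {}" using e[OF that] by blast
    then show ?thesis unfolding nx_def by simp
  qed
  have ny0: "ny P R A g y = 0" if "y \<in> Q - g ` A" for y
  proof -
    have "{u \<in> P - A. newe R A g u y} = {}" using e[OF _ that] by blast
    then show ?thesis unfolding ny_def by simp
  qed
  show "\<And>v. v \<in> P - A \<Longrightarrow> nx Q R A g v \<le> 0" "\<And>y. y \<in> Q - g ` A \<Longrightarrow> ny P R A g y \<le> 0"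
    using nx0 ny0 by auto
  have "(\<Sum>u\<in>P - A. nx Q R A g u) = 0" using nx0 by simp
  then show "sd R Z + 2 * (\<Sum>u\<in>P - A. nx Q R A g u) + 2 * 0 + 6 * card A \<le> 2 * (\<Sum>z\<in>Z. dg R z (P \<union> Q))"
    using F by simp
  show "\<And>v. v \<in> P - A \<Longrightarrow> dg R v Q + 0 + card A + 1 \<le> n"
    using crossP_small s by fastforce
  show "\<And>y. y \<in> Q - g ` A \<Longrightarrow> dg R y P + 0 + card A + 1 \<le> n"
    using crossQ_small s by fastforce
qed

text \<open>The star at \<open>y\<close> is filled: \<open>z\<close> goes to its leaf
  \<open>w\<close>, the non-neighbour \<open>s\<close> of \<open>z\<close> to the centre
  \<open>y\<close>, and pendant neighbours of \<open>z\<close> to the remaining neighbours of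
  \<open>y\<close>. No edge is created, because all neighbours of \<open>w\<close> and of
  \<open>y\<close> are used as images, and the pendant vertices have the placed \<open>z\<close> as
  only neighbour. The edges at \<open>z\<close> alone pay for all pairs.\<close>

lemma tree_step:
  assumes z: "z \<in> P" "49 * n \<le> 50 * dg R z P"
    and w: "w \<in> Q" "nb R w Q = {y}" "\<not> R z w"
    and s: "s \<in> P" "s \<noteq> z" "\<not> R z s" "\<not> R s y"
    and av: "\<And>q. q \<in> nb R y Q - {w} \<Longrightarrow> dg R y Q \<le> card {x \<in> P. nb R x P = {z} \<and> \<not> R x q}"
    and sz: "100 * dg R y Q \<le> n"
    and hP: "\<And>v. v \<in> P \<Longrightarrow> v \<noteq> z \<Longrightarrow> dg R v P + dg R y Q + 3 \<le> n"
    and hQ: "\<And>q. q \<in> Q - insert y (nb R y Q) \<Longrightarrow> dg R q (Q - insert y (nb R y Q)) + dg R y Q + 3 \<le> n"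
  shows False
proof -
  let ?K = "nb R y Q - {w}" and ?F = "\<lambda>q. {x \<in> P. nb R x P = {z} \<and> \<not> R x q}"
  have y: "y \<in> Q" "R w y" using w(2) unfolding nb_def by auto
  have wy: "w \<in> nb R y Q" using w(1) y sym unfolding nb_def by blast
  have fK: "finite ?K" "finite (nb R y Q)" unfolding nb_def by auto
  have cK: "card ?K + 1 = dg R y Q" using wy fK unfolding dg_def by (metis Suc_eq_plus1 card_Suc_Diff1)
  have "\<exists>x. inj_on x ?K \<and> (\<forall>q\<in>?K. x q \<in> ?F q)"
    by (rule greedy_reps) (use fK cK av in fastforce)+
  then obtain x where x: "inj_on x ?K" "\<And>q. q \<in> ?K \<Longrightarrow> x q \<in> P" "\<And>q. q \<in> ?K \<Longrightarrow> nb R (x q) P = {z}"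
    "\<And>q. q \<in> ?K \<Longrightarrow> \<not> R (x q) q" by auto
  have Rxz: "R (x q) z" if "q \<in> ?K" for q using x(3)[OF that] unfolding nb_def by auto
  have xz: "x q \<noteq> z" if "q \<in> ?K" for q using Rxz[OF that] by auto
  have xs: "x q \<noteq> s" if "q \<in> ?K" for q using Rxz[OF that] s(3) sym by auto
  have xonly: "u = z" if "q \<in> ?K" "R (x q) u" "u \<in> P" for q u
    using x(3)[OF that(1)] that unfolding nb_def by blast
  define A where "A = insert z (insert s (x ` ?K))"
  define g where "g v = (if v = z then w else if v = s then y else inv_into ?K x v)" for v
  have gx: "g (x q) = q" if "q \<in> ?K" for q
    using xz[OF that] xs[OF that] inv_into_f_f[OF x(1) that] unfolding g_def by simp
  have gz: "g z = w" "g s = y" using s(2) unfolding g_def by auto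
  have gA: "g ` A = insert y (nb R y Q)"
  proof -
    have "g ` x ` ?K = ?K" using gx by force
    then show ?thesis unfolding A_def using gz wy by auto
  qed
  have yK: "y \<notin> ?K" "y \<noteq> w" using y(2) unfolding nb_def by auto
  have cA: "card A = dg R y Q + 1"
  proof -
    have "card (x ` ?K) = card ?K" using x(1) by (rule card_image)
    moreover have "s \<notin> x ` ?K" "z \<notin> insert s (x ` ?K)" using xs xz s(2) by blast+
    ultimately show ?thesis unfolding A_def using fK cK by simp
  qed
  have cg: "card (g ` A) = card A" unfolding gA cA using fK by (simp add: dg_def nb_def)
  have fA: "finite A" unfolding A_def using fK by simp
  have inj: "inj_on g A" using cg fA by (simp add: eq_card_imp_inj_on)
  have zw: "\<not> R w q" if "q \<in> ?K" for q
  proof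
    assume "R w q"
    then have "q \<in> nb R w Q" using that unfolding nb_def by simp
    then show False using w(2) that yK(1) by simp
  qed
  have p: "ppk R P Q A g"
    unfolding ppk_def
  proof (intro conjI ballI impI)
    show "A \<subseteq> P" unfolding A_def using z s x(2) by blast
    show "g ` A \<subseteq> Q" unfolding gA using y unfolding nb_def by blast
    show "inj_on g A" by (rule inj)
    fix a assume a: "a \<in> A"
    have "a = z \<or> a = s \<or> (\<exists>q\<in>?K. a = x q)" using a unfolding A_def by blast
    then show "\<not> R a (g a)" by (elim disjE bexE) (simp_all only: gz gx w(3) s(4) x(4), auto)
    fix b assume b: "b \<in> A" "R a b"
    have aP: "a \<in> P" "b \<in> P" using a b(1) \<open>A \<subseteq> P\<close> by auto
    consider "a = z" "b \<in> x ` ?K" | "b = z" "a \<in> x ` ?K"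
    proof -
      have "a = z \<or> b = z"
      proof (cases "a \<in> x ` ?K \<or> b \<in> x ` ?K")
        case True then show ?thesis using xonly aP b(2) sym by blast
      next
        case False then show ?thesis using a b unfolding A_def by auto
      qed
      then show ?thesis using a b s(3) sym that unfolding A_def by auto
    qed
    then show "\<not> R (g a) (g b)"
    proof cases
      case 1
      then obtain q where "q \<in> ?K" "b = x q" by blast
      then show ?thesis using 1 gz gx zw by simp
    next
      case 2
      then obtain q where q: "q \<in> ?K" "a = x q" by blast
      then have "\<not> R q w" using zw sym by blast
      then show ?thesis using 2 gz gx q by simp
    qed
  qed
  show False
  proof (rule reduction_free[OF p, of "{z}"])
    show "A \<noteq> {}" "{z} \<subseteq> A \<union> g ` A" unfolding A_def by auto
    show "50 * card A + 50 \<le> n" using cA sz n_big by linarith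
    show "sd R {z} + 6 * card A \<le> 2 * (\<Sum>z\<in>{z}. dg R z (P \<union> Q))"
    proof -
      have "sd R {z} = 0" unfolding sd_def dg_def nb_def by auto
      then show ?thesis using cA sz z(2) n_big by (simp add: deg_split)
    qed
  next
    fix v assume v: "v \<in> P - A"
    then have "v \<noteq> z" unfolding A_def by auto
    moreover have "dg R v (P - A) \<le> dg R v P" by (auto intro!: dg_mono)
    ultimately show "dg R v (P - A) + 2 \<le> n - card A" using hP[of v] v cA by simp
  next
    fix q assume q: "q \<in> Q - g ` A"
    then show "dg R q (Q - g ` A) + 2 \<le> n - card A" using hQ[of q] cA unfolding gA by simp
  next
    fix a u q assume h: "a \<in> A" "u \<in> P - A" "q \<in> Q - g ` A" "R a u" "R (g a) q"
    show False
    proof (cases "a = z \<or> a = s")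
      case True
      then have "q \<in> insert y (nb R y Q)" using h gz w(2) unfolding nb_def by auto
      then show False using h(3) unfolding gA by blast
    next
      case False
      then obtain r where "r \<in> ?K" "a = x r" using h(1) unfolding A_def by blast
      then have "u = z" using xonly h by blast
      then show False using h(2) unfolding A_def by blast
    qed
  qed
qed


section \<open>Leaves and stars opposite a vertex of almost full own degree\<close>

definition outN :: "'a \<Rightarrow> 'a set" where "outN z = P - insert z (nb R z P)"

lemma card_outN: assumes "z \<in> P" shows "card (outN z) + dg R z P + 1 = n"
proof -
  have "card (insert z (nb R z P)) = dg R z P + 1" unfolding dg_def nb_def by simp
  moreover have "insert z (nb R z P) \<subseteq> P" using assms unfolding nb_def by auto
  moreover have "finite (insert z (nb R z P))" unfolding nb_def by simp
  ultimately show ?thesis unfolding outN_def using ownP[OF assms] by (simp add: card_Diff_subset)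
qed

lemma outN_own_sum: assumes "z \<in> P" shows "(\<Sum>s\<in>outN z. dg R s P) + 2 * dg R z P \<le> s1"
proof -
  have "(\<Sum>u\<in>nb R z P. 1) \<le> (\<Sum>u\<in>nb R z P. dg R u P)"
  proof (rule sum_mono)
    fix u assume "u \<in> nb R z P"
    then show "1 \<le> dg R u P" using assms dg_pos_iff[OF finP, of u] sym unfolding nb_def by (auto simp: Suc_le_eq)
  qed
  then have "dg R z P \<le> (\<Sum>u\<in>nb R z P. dg R u P)" unfolding dg_def by simp
  moreover have "(\<Sum>u\<in>outN z. dg R u P) + (\<Sum>u\<in>insert z (nb R z P). dg R u P) = s1"
    unfolding s1_def outN_def using assms by (subst sum.subset_diff[of "insert z (nb R z P)" P]) (auto simp: nb_def)
  moreover have "(\<Sum>u\<in>insert z (nb R z P). dg R u P) = dg R z P + (\<Sum>u\<in>nb R z P. dg R u P)"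
    unfolding nb_def by (subst sum.insert) auto
  ultimately show ?thesis by linarith
qed

text \<open>At most \<open>s1 - 2 * dg R z P\<close> neighbours of \<open>z\<close> have a second
  own neighbour, and at most \<open>e3 + 1 - dg R z Q\<close> are joined to \<open>q\<close>; the
  others are counted on the right.\<close>

lemma pendant_count:
  assumes z: "z \<in> P" and q: "q \<in> Q"
  shows "3 * dg R z P + dg R z Q \<le> card {x \<in> P. nb R x P = {z} \<and> \<not> R x q} + s1 + e3 + 1"
proof -
  let ?N = "nb R z P" and ?X = "{x \<in> nb R z P. dg R x P = 1}" and ?Y = "{x \<in> nb R z P. dg R x P \<noteq> 1}"
  have pos: "1 \<le> dg R x P" if "x \<in> ?N" for x
    using that z dg_pos_iff[OF finP, of x] sym unfolding nb_def by (auto simp: Suc_le_eq)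
  have f: "finite ?N" unfolding nb_def by simp
  have "card ?N + card ?Y = (\<Sum>x\<in>?N. 1 + (if dg R x P \<noteq> 1 then 1 else 0))"
    using f by (simp only: sum.distrib) (simp add: sum.If_cases Int_def)
  also have "\<dots> \<le> (\<Sum>x\<in>?N. dg R x P)"
  proof (rule sum_mono)
    fix x assume "x \<in> ?N"
    then show "1 + (if dg R x P \<noteq> 1 then 1 else 0) \<le> dg R x P" using pos[of x] by auto
  qed
  finally have a: "dg R z P + card ?Y \<le> (\<Sum>x\<in>?N. dg R x P)" unfolding dg_def[of R z P] .
  have "dg R z P + (\<Sum>x\<in>?N. dg R x P) = (\<Sum>x\<in>insert z ?N. dg R x P)"
    unfolding nb_def by (subst sum.insert) auto
  also have "\<dots> \<le> s1" unfolding s1_def using z by (intro sum_mono2) (auto simp: nb_def)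
  finally have b: "dg R z P + (\<Sum>x\<in>?N. dg R x P) \<le> s1" .
  have "card ?N = card (?X \<union> ?Y)" by (rule arg_cong[where f = card]) auto
  then have c: "dg R z P \<le> card ?X + card ?Y" unfolding dg_def[of R z P] using card_Un_le[of ?X ?Y] by linarith
  have "?X \<subseteq> {x \<in> P. nb R x P = {z} \<and> \<not> R x q} \<union> nb R q P"
  proof
    fix x assume x: "x \<in> ?X"
    then have "z \<in> nb R x P" "x \<in> P" using z sym unfolding nb_def by auto
    then have "nb R x P = {z}" using x unfolding dg_def by (auto simp: card_1_singleton_iff)
    then show "x \<in> {x \<in> P. nb R x P = {z} \<and> \<not> R x q} \<union> nb R q P"
      using \<open>x \<in> P\<close> sym unfolding nb_def by auto
  qed
  then have "card ?X \<le> card ({x \<in> P. nb R x P = {z} \<and> \<not> R x q} \<union> nb R q P)"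
    by (intro card_mono) (auto simp: nb_def)
  also have "\<dots> \<le> card {x \<in> P. nb R x P = {z} \<and> \<not> R x q} + dg R q P"
    unfolding dg_def by (rule card_Un_le)
  finally show ?thesis using a b c crossQ_le_rest[OF z q] by linarith
qed

text \<open>Every vertex of \<open>Q\<close> that is not the centre of an unblocked pendant star accounts for one edge.
  An unblocked one could be used together with \<open>z\<close>, unless there are only few of them.\<close>

lemma near_own:
  assumes z: "z \<in> P" "49 * n \<le> 50 * dg R z P"
    and o1: "\<And>v. v \<in> P \<Longrightarrow> v \<noteq> z \<Longrightarrow> dg R v P + 4 \<le> n" and o2: "\<And>q. q \<in> Q \<Longrightarrow> dg R q Q + 4 \<le> n"
  shows "dg R z P + 209000 \<le> n" "(\<Sum>s\<in>outN z. dg R s P) + 4 * dg R z P \<le> 4 * n"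
    "(\<Sum>s\<in>outN z. dg R s Q) + 2 * dg R z P \<le> 2 * n"
proof -
  define d where "d = dg R z P"
  define cz where "cz = dg R z Q"
  define c2 where "c2 = (\<Sum>v\<in>P - {z}. dg R v Q)"
  have e3c: "e3 = cz + c2" unfolding e3_def cz_def c2_def using z sum.remove[OF finP] by metis
  have Fz: "s1 + s2 + 2 * cz + 2 * c2 + 2 * d + 836558 \<le> 6 * n" using Feq DP[OF z(1)] e3c unfolding d_def by linarith
  have dn: "49 * n \<le> 50 * d" using z(2) unfolding d_def .
  have s1d: "2 * d \<le> s1" using own_le_half[OF z(1)] unfolding d_def .
  have own_other: "2 * d + 2 * dg R v P \<le> s1 + 2" if "v \<in> P" "v \<noteq> z" for v
    using own_two[OF z(1) that(1)] that(2) unfolding d_def by auto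
  define N where "N = nb R z Q"
  have fN: "finite N" "card N = cz" unfolding N_def cz_def dg_def nb_def by auto
  define S where "S = outN z"
  have cS: "card S + d + 1 = n" unfolding S_def d_def using card_outN[OF z(1)] .
  have Sne: "1 \<le> card S" using cS ownP[OF z(1)] unfolding d_def by linarith
  have fS: "finite S" unfolding S_def outN_def by simp
  have Sin: "s \<in> P \<and> s \<noteq> z \<and> \<not> R z s" if "s \<in> S" for s using that unfolding S_def outN_def nb_def by auto
  \<comment> \<open>Star centres in \<open>sg\<close> are blocked: they are joined to every
    non-neighbour of \<open>z\<close>, so no vertex \<open>s\<close> for \<open>tree_step\<close>
    exists.\<close>
  define sg where "sg = {y \<in> Q. \<forall>s\<in>S. R s y}"
  have fsg: "finite sg" unfolding sg_def by simp
  have "(\<Sum>s\<in>S. card sg) \<le> (\<Sum>s\<in>S. dg R s Q)"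
    unfolding dg_def nb_def by (intro sum_mono card_mono) (auto simp: sg_def)
  moreover have SQ: "(\<Sum>s\<in>S. dg R s Q) \<le> c2" unfolding c2_def using Sin by (intro sum_mono2) auto
  ultimately have sgc: "card S * card sg \<le> c2" by simp
  have sg1: "card sg \<le> c2" using sgc Sne by (metis le_trans mult_le_mono1 nat_mult_1)
  \<comment> \<open>Otherwise \<open>z\<close> could be placed on the isolated vertex
    \<open>w\<close> alone, without any new edge.\<close>
  have Q0N: "w \<in> N" if w: "w \<in> Q" "dg R w Q = 0" for w
  proof (rule ccontr)
    assume "w \<notin> N"
    then have zw: "\<not> R z w" using w unfolding N_def nb_def by auto
    let ?g = "\<lambda>_::'a. w"
    show False
    proof (rule reduction_free[of "{z}" ?g "{z}"])
      show "ppk R P Q {z} ?g" unfolding ppk_def using z w zw by auto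
      show "sd R {z} + 6 * card {z} \<le> 2 * (\<Sum>z\<in>{z}. dg R z (P \<union> Q))"
      proof -
        have "sd R {z} = 0" unfolding sd_def dg_def nb_def by auto
        then show ?thesis using z(2) n_big by (simp add: deg_split)
      qed
    next
      fix v assume v: "v \<in> P - {z}"
      then show "dg R v (P - {z}) + 2 \<le> n - card {z}" using o1[of v] dgmP[of v z] by simp
    next
      fix q assume q: "q \<in> Q - ?g ` {z}"
      then show "dg R q (Q - ?g ` {z}) + 2 \<le> n - card {z}" using o2[of q] dgmQ[of q w] by simp
    next
      fix a u q assume "q \<in> Q - ?g ` {z}" "R (?g a) q"
      then show False using w(2) dg_eq_0_iff[OF finQ] by blast
    qed (use n_big in auto)
  qed
  define L where "L = {w \<in> Q. dg R w Q = 1}"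
  define h where "h w = (THE y. nb R w Q = {y})" for w
  have h: "nb R w Q = {h w}" if "w \<in> L" for w
  proof -
    have "card (nb R w Q) = 1" using that unfolding L_def dg_def by simp
    then obtain y where "nb R w Q = {y}" by (rule card_1_singletonE)
    then show ?thesis unfolding h_def by (metis (mono_tags, lifting) singleton_inject the_equality)
  qed
  have hQ: "h w \<in> Q" "R w (h w)" "R (h w) w" if "w \<in> L" for w
    using h[OF that] sym unfolding nb_def by blast+
  have hmem: "w \<in> nb R (h w) Q" if "w \<in> L" for w using hQ(3)[OF that] that unfolding nb_def L_def by simp
  have honly: "u = h w" if "w \<in> L" "R w u" "u \<in> Q" for u w
    using h[OF that(1)] that(2,3) unfolding nb_def by auto
  \<comment> \<open>\<open>Q\<close> is split into isolated vertices, leaves of single-edge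
    components (\<open>LL\<close>), leaves at larger centres (\<open>L1\<close>), these centres
    (\<open>Y\<close>), and other vertices of degree at least 2 (\<open>Q2\<close>).\<close>
  define LL where "LL = {w \<in> L. dg R (h w) Q = 1}"
  define L1 where "L1 = {w \<in> L. dg R (h w) Q \<noteq> 1}"
  define Q0 where "Q0 = {w \<in> Q. dg R w Q = 0}"
  define T where "T = {w \<in> Q. 2 \<le> dg R w Q}"
  define Y where "Y = h ` L1"
  define Q2 where "Q2 = T - Y"
  have LQ: "L \<subseteq> Q" "LL \<subseteq> L" "L1 \<subseteq> L" unfolding L_def LL_def L1_def by auto
  have fin: "finite L" "finite LL" "finite L1" "finite Q0" "finite T" "finite Y" "finite Q2"
    unfolding Q2_def Y_def L_def LL_def L1_def Q0_def T_def by auto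
  have YT: "Y \<subseteq> T"
  proof
    fix y assume "y \<in> Y"
    then obtain w where w: "w \<in> L1" "y = h w" unfolding Y_def by blast
    have wL: "w \<in> L" using w LQ by blast
    have "0 < dg R y Q" using dg_pos_iff[OF finQ, of y] hQ(3)[OF wL] wL LQ w(2) by blast
    moreover have "dg R y Q \<noteq> 1" using w unfolding L1_def by blast
    ultimately show "y \<in> T" using w(2) hQ(1)[OF wL] unfolding T_def by simp
  qed
  have Qp: "Q = Q0 \<union> LL \<union> L1 \<union> Y \<union> Q2" and dis: "Q0 \<inter> L = {}" "LL \<inter> L1 = {}" "T \<inter> L = {}" "T \<inter> Q0 = {}"
    using YT unfolding Q0_def LL_def L1_def L_def T_def Q2_def by auto
  have sumQ: "sum f Q = sum f Q0 + sum f LL + sum f L1 + sum f Y + sum f Q2" for f :: "'a \<Rightarrow> nat"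
  proof -
    have "sum f (Q0 \<union> LL \<union> L1 \<union> Y \<union> Q2) = sum f (Q0 \<union> LL \<union> L1 \<union> Y) + sum f Q2"
      using fin YT dis LQ by (intro sum.union_disjoint) (auto simp: Q2_def)
    also have "sum f (Q0 \<union> LL \<union> L1 \<union> Y) = sum f (Q0 \<union> LL \<union> L1) + sum f Y"
      using fin YT dis LQ by (intro sum.union_disjoint) auto
    also have "sum f (Q0 \<union> LL \<union> L1) = sum f (Q0 \<union> LL) + sum f L1"
      using fin dis LQ by (intro sum.union_disjoint) auto
    also have "sum f (Q0 \<union> LL) = sum f Q0 + sum f LL"
      using fin dis LQ by (intro sum.union_disjoint) auto
    finally show ?thesis using Qp by simp
  qed
  have cn: "n = card Q0 + card LL + card L1 + card Y + card Q2"
    using sumQ[of "\<lambda>_. 1"] cardQ by simp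
  have sL: "(\<Sum>w\<in>LL. dg R w Q) = card LL" "(\<Sum>w\<in>L1. dg R w Q) = card L1"
    unfolding LL_def L1_def L_def by auto
  have sQ2: "2 * card Q2 \<le> (\<Sum>w\<in>Q2. dg R w Q)"
    using sum_mono[of Q2 "\<lambda>_. 2" "\<lambda>w. dg R w Q"] unfolding Q2_def T_def by auto
  have sY2: "2 * card Y \<le> (\<Sum>w\<in>Y. dg R w Q)"
  proof -
    have "(\<Sum>w\<in>Y. 2) \<le> (\<Sum>w\<in>Y. dg R w Q)" using YT unfolding T_def by (intro sum_mono) blast
    then show ?thesis by simp
  qed
  have sY1: "card L1 \<le> (\<Sum>w\<in>Y. dg R w Q)"
  proof -
    have "L1 \<subseteq> (\<Union>y\<in>Y. nb R y Q)"
    proof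
      fix w assume "w \<in> L1"
      then have "h w \<in> Y" "w \<in> nb R (h w) Q" using hmem LQ unfolding Y_def by auto
      then show "w \<in> (\<Union>y\<in>Y. nb R y Q)" by blast
    qed
    then have "card L1 \<le> card (\<Union>y\<in>Y. nb R y Q)" using fin by (intro card_mono) (auto simp: nb_def)
    also have "\<dots> \<le> (\<Sum>w\<in>Y. dg R w Q)" unfolding dg_def using fin by (intro card_UN_le)
    finally show ?thesis .
  qed
  have A1: "card LL + 2 * card L1 + 2 * card Q2 \<le> s2" and A2: "card LL + card L1 + 2 * card Y + 2 * card Q2 \<le> s2"
    using sumQ[of "\<lambda>w. dg R w Q"] sL sQ2 sY1 sY2 unfolding s2_def by linarith+
  have tree: "False" if w: "w \<in> L" "w \<notin> N" "h w \<notin> sg" "100 * dg R (h w) Q \<le> n"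
      and av: "\<And>q. q \<in> nb R (h w) Q - {w} \<Longrightarrow> dg R (h w) Q \<le> card {x \<in> P. nb R x P = {z} \<and> \<not> R x q}"
      and hP: "\<And>v. v \<in> P \<Longrightarrow> v \<noteq> z \<Longrightarrow> dg R v P + dg R (h w) Q + 3 \<le> n"
      and hQ': "\<And>q. q \<in> Q - insert (h w) (nb R (h w) Q) \<Longrightarrow> dg R q (Q - insert (h w) (nb R (h w) Q)) + dg R (h w) Q + 3 \<le> n"
    for w
  proof -
    obtain s where s: "s \<in> S" "\<not> R s (h w)" using w(3) hQ(1)[OF w(1)] unfolding sg_def by blast
    have "\<not> R z w" using w LQ unfolding N_def nb_def by auto
    have wQ: "w \<in> Q" using w(1) LQ by blast
    show False
      by (rule tree_step[OF z wQ h[OF w(1)] \<open>\<not> R z w\<close> _ _ _ s(2)])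
        (use Sin[OF s(1)] w(4) av hP hQ' in auto)
  qed
  have LLsg: "h w \<in> LL \<inter> sg" if w: "w \<in> LL" "w \<notin> N" for w
  proof -
    have wL: "w \<in> L" and o: "dg R (h w) Q = 1" using w unfolding LL_def by auto
    have hL: "h w \<in> L" using o hQ[OF wL] unfolding L_def by auto
    have "w \<in> nb R (h w) Q" using hQ[OF wL] wL LQ unfolding nb_def by auto
    then have hh: "nb R (h w) Q = {w}" "h (h w) = w" using h[OF hL] by auto
    have "h w \<in> LL" unfolding LL_def using hL hh wL unfolding L_def by auto
    moreover have "h w \<in> sg"
    proof (rule ccontr)
      assume ns: "h w \<notin> sg"
      show False
      proof (rule tree[OF wL w(2) ns])
        show "100 * dg R (h w) Q \<le> n" using o n_big by simp
        show "dg R (h w) Q \<le> card {x \<in> P. nb R x P = {z} \<and> \<not> R x q}" if "q \<in> nb R (h w) Q - {w}" for q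
          using that hh by simp
        show "dg R v P + dg R (h w) Q + 3 \<le> n" if "v \<in> P" "v \<noteq> z" for v using o1[OF that] o by simp
        fix q assume q: "q \<in> Q - insert (h w) (nb R (h w) Q)"
        have "dg R q (Q - insert (h w) (nb R (h w) Q)) \<le> dg R q Q" by (auto intro!: dg_mono)
        then show "dg R q (Q - insert (h w) (nb R (h w) Q)) + dg R (h w) Q + 3 \<le> n" using o2[of q] q o by simp
      qed
    qed
    ultimately show ?thesis by blast
  qed
  have hhL: "h (h w) = w" if "w \<in> LL" for w
  proof -
    have wL: "w \<in> L" and o: "dg R (h w) Q = 1" using that unfolding LL_def by auto
    have hL: "h w \<in> L" using o hQ[OF wL] unfolding L_def by auto
    have "w \<in> nb R (h w) Q" using hQ[OF wL] wL LQ unfolding nb_def by auto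
    then show ?thesis using h[OF hL] by auto
  qed
  have B: "card LL \<le> card (LL \<inter> N) + card (LL \<inter> sg)"
  proof -
    have "card (LL - N) = card (h ` (LL - N))" using hhL by (intro card_image[symmetric] inj_on_inverseI[of _ h]) auto
    also have "\<dots> \<le> card (LL \<inter> sg)" using LLsg fin by (intro card_mono) auto
    finally have "card (LL - N) \<le> card (LL \<inter> sg)" .
    moreover have "LL = (LL \<inter> N) \<union> (LL - N)" by blast
    ultimately show ?thesis using card_Un_le[of "LL \<inter> N" "LL - N"] by simp
  qed
  \<comment> \<open>The centres at which \<open>tree_step\<close> is not obstructed: not blocked,
    and with a leaf that is not joined to \<open>z\<close>.\<close>
  define Yg where "Yg = {y \<in> Y. y \<notin> sg \<and> (\<exists>w\<in>L1. h w = y \<and> w \<notin> N)}"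
  have C: "card Y \<le> card Yg + card (Y \<inter> sg) + card (L1 \<inter> N)"
  proof -
    have "Y \<subseteq> Yg \<union> (Y \<inter> sg) \<union> h ` (L1 \<inter> N)" unfolding Yg_def Y_def by blast
    then have "card Y \<le> card (Yg \<union> (Y \<inter> sg) \<union> h ` (L1 \<inter> N))"
      using fin by (intro card_mono) (auto simp: Yg_def)
    also have "\<dots> \<le> card Yg + card (Y \<inter> sg) + card (h ` (L1 \<inter> N))"
      by (meson add_mono card_Un_le le_trans order_refl)
    finally show ?thesis using card_image_le[of "L1 \<inter> N" h] fin by simp
  qed
  have E: "card Q0 + card (LL \<inter> N) + card (L1 \<inter> N) \<le> cz"
  proof -
    have "card Q0 + card (LL \<inter> N) + card (L1 \<inter> N) = card (Q0 \<union> (LL \<inter> N) \<union> (L1 \<inter> N))"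
      using fin dis LQ by (subst card_Un_disjoint; (subst card_Un_disjoint)?) auto
    also have "\<dots> \<le> card N" using fN Q0N unfolding Q0_def by (intro card_mono) auto
    finally show ?thesis using fN by simp
  qed
  have G: "card (LL \<inter> sg) + card (Y \<inter> sg) \<le> card sg"
  proof -
    have "card (LL \<inter> sg) + card (Y \<inter> sg) = card ((LL \<inter> sg) \<union> (Y \<inter> sg))"
      using fin dis LQ YT by (subst card_Un_disjoint) auto
    also have "\<dots> \<le> card sg" using fsg by (intro card_mono) auto
    finally show ?thesis .
  qed
  \<comment> \<open>A first rough bound, from \<open>A1 + 2 * A2\<close>, that does not yet use the
    larger stars. It already yields \<open>n/10\<close> admissible pendant neighbours of
    \<open>z\<close> and keeps all other own degrees of \<open>P\<close> below \<open>2n/5\<close>,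
    as \<open>tree_step\<close> requires.\<close>
  have K: "4 * n \<le> 3 * s2 + 4 * cz + c2" using cn A1 A2 B E G sg1 by linarith
  have avail: "n \<le> 10 * card {x \<in> P. nb R x P = {z} \<and> \<not> R x q}" if "q \<in> Q" for q
    using pendant_count[OF z(1) that] K Fz dn e3c n_big unfolding d_def[symmetric] cz_def[symmetric] by linarith
  have ownP': "5 * dg R v P \<le> 2 * n" if "v \<in> P" "v \<noteq> z" for v
    using own_other[OF that] K Fz dn n_big by linarith
  \<comment> \<open>Because \<open>s2\<close> is below \<open>2.1 n\<close>, the smallest of 210
    usable centres has degree at most \<open>n/100\<close>, small enough for
    \<open>tree_step\<close>.\<close>
  have Yg: "card Yg < 210"
  proof (rule ccontr)
    assume many: "\<not> card Yg < 210"
    have fYg: "finite Yg" unfolding Yg_def using fin by simp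
    have ne: "Yg \<noteq> {}" using many by auto
    obtain y where y: "y \<in> Yg" "\<And>q. q \<in> Yg \<Longrightarrow> dg R y Q \<le> dg R q Q"
      using ex_min_if_finite[of "(\<lambda>q. dg R q Q) ` Yg"] fYg ne
      by (metis (mono_tags, lifting) arg_min_if_finite(1) arg_min_least)
    have "210 * dg R y Q \<le> card Yg * dg R y Q" using many by (intro mult_right_mono) auto
    also have "\<dots> = (\<Sum>q\<in>Yg. dg R y Q)" by simp
    also have "\<dots> \<le> (\<Sum>q\<in>Yg. dg R q Q)" using y(2) by (intro sum_mono)
    also have "\<dots> \<le> s2" unfolding s2_def using YT unfolding Yg_def T_def by (intro sum_mono2) auto
    finally have ysm: "100 * dg R y Q \<le> n" using Fz s1d dn n_big by linarith
    obtain w where w: "w \<in> L1" "h w = y" "w \<notin> N" using y(1) unfolding Yg_def by blast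
    have wL: "w \<in> L" using w LQ by blast
    show False
    proof (rule tree[OF wL w(3)]; (unfold w(2))?)
      show "y \<notin> sg" using y(1) unfolding Yg_def by blast
      show "100 * dg R y Q \<le> n" by (rule ysm)
      show "dg R y Q \<le> card {x \<in> P. nb R x P = {z} \<and> \<not> R x q}" if "q \<in> nb R y Q - {w}" for q
        using avail[of q] that ysm unfolding nb_def by auto
      show "dg R v P + dg R y Q + 3 \<le> n" if "v \<in> P" "v \<noteq> z" for v using ownP'[OF that] ysm n_big by linarith
      fix q assume q: "q \<in> Q - insert y (nb R y Q)"
      \<comment> \<open>Leaves of further usable centres are not joined to \<open>q\<close>; three
        of them keep the own degree of \<open>q\<close> admissible in the rest.\<close>
      have "\<forall>u\<in>Yg. \<exists>w\<in>L1. h w = u" unfolding Yg_def by blast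
      then obtain l where l: "\<And>u. u \<in> Yg \<Longrightarrow> l u \<in> L1 \<and> h (l u) = u" by metis
      let ?W = "l ` (Yg - {y, q})" and ?B = "Q - insert y (nb R y Q)"
      have "inj_on l (Yg - {y, q})" using l by (intro inj_on_inverseI[of _ h]) auto
      then have cW: "card ?W = card (Yg - {y, q})" by (rule card_image)
      have "card Yg \<le> card (Yg - {y, q}) + card {y, q}"
        by (metis add.commute card_Un_le Un_Diff_cancel card_mono fYg finite.emptyI finite_Diff finite_Un finite_insert le_trans Un_upper2)
      moreover have "card {y, q} \<le> 2" by (simp add: card_insert_if)
      ultimately have cW2: "3 \<le> card ?W" using cW many by linarith
      have WB: "?W \<subseteq> ?B"
      proof
        fix x assume "x \<in> ?W"
        then obtain u where u: "u \<in> Yg" "u \<noteq> y" "x = l u" by blast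
        then have x: "x \<in> L" "h x = u" using l LQ by auto
        have "x \<noteq> y" using x(1) y(1) YT unfolding Yg_def L_def T_def by auto
        moreover have "\<not> R y x"
        proof
          assume "R y x"
          moreover have "y \<in> Q" using y(1) YT unfolding Yg_def T_def by auto
          ultimately show False using honly[OF x(1) sym] x(2) u(2) by blast
        qed
        ultimately show "x \<in> ?B" using x LQ unfolding nb_def by auto
      qed
      have "nb R q ?B \<subseteq> ?B - ?W"
      proof
        fix x assume x: "x \<in> nb R q ?B"
        have "x \<notin> ?W"
        proof
          assume "x \<in> ?W"
          then obtain u where u: "u \<in> Yg" "u \<noteq> q" "x = l u" by blast
          then have xl: "x \<in> L" "h x = u" using l LQ by auto
          have "R q x" "q \<in> Q" using x q unfolding nb_def by auto
          then show False using honly[OF xl(1) sym] xl(2) u(2) by blast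
        qed
        then show "x \<in> ?B - ?W" using x unfolding nb_def by blast
      qed
      then have "dg R q ?B \<le> card (?B - ?W)" unfolding dg_def by (intro card_mono) auto
      also have "\<dots> = card ?B - card ?W" using WB by (intro card_Diff_subset) (use fYg in auto)
      finally have "dg R q ?B \<le> card ?B - card ?W" .
      moreover have "card ?B + (dg R y Q + 1) = n"
      proof -
        have "card (insert y (nb R y Q)) = dg R y Q + 1" unfolding dg_def nb_def by simp
        moreover have "insert y (nb R y Q) \<subseteq> Q" using y(1) YT unfolding nb_def Yg_def T_def by auto
        moreover from this have "card (insert y (nb R y Q)) \<le> n" using cardQ card_mono finQ by metis
        moreover have "card ?B = card Q - card (insert y (nb R y Q))"
          using calculation(2) by (intro card_Diff_subset) (auto intro: finite_subset[OF _ finQ])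
        ultimately show ?thesis using cardQ by linarith
      qed
      moreover have "card ?W \<le> card ?B" using WB by (intro card_mono) auto
      ultimately show "dg R q ?B + dg R y Q + 3 \<le> n" using cW2 by linarith
    qed
  qed
  have star: "2 * n \<le> s2 + 2 * cz + 2 * card sg + 418"
    using cn A1 B C E G Yg by linarith
  have fin1: "s1 + 2 * c2 + 836140 + 2 * d \<le> 2 * card sg + 4 * n"
    using Fz star by linarith
  \<comment> \<open>Each blocked centre costs \<open>card S\<close> cross edges, which appear
    doubled in \<open>fin1\<close>. Two of them already cost \<open>4 * card S\<close>, the whole
    room between \<open>4 * dg R z P\<close> and \<open>4 * n\<close> up to a small
    constant.\<close>
  have sgle: "card sg \<le> 1"
  proof (rule ccontr)
    assume "\<not> card sg \<le> 1"
    then obtain m where m: "card sg = Suc (Suc m)" by (metis One_nat_def Suc_leI Suc_le_D leI le_SucE not_less_eq_eq numeral_2_eq_2)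
    have "m * card S + 2 * card S \<le> c2" using sgc m by (simp add: algebra_simps)
    moreover have "m \<le> m * card S" using Sne by simp
    ultimately show False using fin1 m cS s1d by linarith
  qed
  show "dg R z P + 209000 \<le> n" using fin1 sgle sg1 s1d unfolding d_def[symmetric] by linarith
  show "(\<Sum>s\<in>outN z. dg R s P) + 4 * dg R z P \<le> 4 * n"
    using outN_own_sum[OF z(1)] fin1 sgle unfolding d_def[symmetric] by linarith
  show "(\<Sum>s\<in>outN z. dg R s Q) + 2 * dg R z P \<le> 2 * n"
    using SQ fin1 sgle s1d unfolding d_def[symmetric] S_def by linarith
qed

end

section \<open>Placing one vertex together with the neighbours of its image\<close>

lemma finite_argmax:
  fixes f :: "'a \<Rightarrow> nat"
  assumes "finite S" "S \<noteq> {}" shows "\<exists>a\<in>S. \<forall>v\<in>S. f v \<le> f a"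
proof -
  have "Max (f ` S) \<in> f ` S" using assms by simp
  then obtain a where "a \<in> S" "f a = Max (f ` S)" by auto
  then show ?thesis using assms by (metis Max_ge finite_imageI imageI)
qed

text \<open>Greedy again: every chosen representative excludes at most \<open>c\<close> candidates.
  With closed neighbourhoods for \<open>C\<close> the representatives form an independent
  set.\<close>

lemma greedy_reps_apart:
  assumes K: "finite K" and c: "0 < c" and F: "\<And>q. q \<in> K \<Longrightarrow> card K * c \<le> card (F q)"
    and C: "\<And>q x. q \<in> K \<Longrightarrow> x \<in> F q \<Longrightarrow> finite (C x) \<and> card (C x) \<le> c"
    and Cs: "\<And>q r x y. q \<in> K \<Longrightarrow> r \<in> K \<Longrightarrow> x \<in> F q \<Longrightarrow> y \<in> F r \<Longrightarrow> x \<in> C y \<Longrightarrow> y \<in> C x"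
  shows "\<exists>x. (\<forall>q\<in>K. x q \<in> F q) \<and> (\<forall>q\<in>K. \<forall>r\<in>K. q \<noteq> r \<longrightarrow> x q \<notin> C (x r))"
proof -
  have "\<exists>x. (\<forall>q\<in>L. x q \<in> F q) \<and> (\<forall>q\<in>L. \<forall>r\<in>L. q \<noteq> r \<longrightarrow> x q \<notin> C (x r))" if "L \<subseteq> K" for L
    using finite_subset[OF that K] that
  proof (induction L rule: finite_induct)
    case empty then show ?case by simp
  next
    case (insert q L)
    then obtain x where x: "\<forall>q\<in>L. x q \<in> F q" "\<forall>q\<in>L. \<forall>r\<in>L. q \<noteq> r \<longrightarrow> x q \<notin> C (x r)" by auto
    have xC: "finite (C (x r))" "card (C (x r)) \<le> c" if "r \<in> L" for r
      using C[of r "x r"] x(1) that insert.prems by auto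
    have "\<exists>p\<in>F q. p \<notin> (\<Union>r\<in>L. C (x r))"
    proof (rule pickout)
      show "finite (\<Union>r\<in>L. C (x r))" using insert.hyps xC by blast
      have "card (\<Union>r\<in>L. C (x r)) \<le> (\<Sum>r\<in>L. card (C (x r)))" using insert.hyps by (intro card_UN_le)
      also have "\<dots> \<le> (\<Sum>r\<in>L. c)" using xC by (intro sum_mono)
      also have "\<dots> < card (insert q L) * c" using insert.hyps c by simp
      also have "\<dots> \<le> card K * c" using insert.prems K by (intro mult_right_mono card_mono) auto
      also have "\<dots> \<le> card (F q)" using F[of q] insert.prems by simp
      finally show "card (\<Union>r\<in>L. C (x r)) < card (F q)" .
    qed
    then obtain p where p: "p \<in> F q" "\<And>r. r \<in> L \<Longrightarrow> p \<notin> C (x r)" by blast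
    have pr: "x r \<notin> C p" if "r \<in> L" for r
      using p(2)[OF that] Cs[of r q "x r" p] that insert.prems x(1) p(1) by blast
    have "(\<forall>r\<in>insert q L. (x(q := p)) r \<in> F r)" using x(1) p(1) by simp
    moreover have "\<forall>r\<in>insert q L. \<forall>t\<in>insert q L. r \<noteq> t \<longrightarrow> (x(q := p)) r \<notin> C ((x(q := p)) t)"
      using x(2) p(2) pr insert.hyps(2) by auto
    ultimately show ?case by blast
  qed
  then show ?thesis by blast
qed

context mincx
begin

text \<open>For a vertex of maximal own degree over both sides the premises of
  \<open>near_own\<close> come for free: a second vertex of nearly full own degree would bring the
  edges and \<open>D\<close> to about \<open>6n\<close> in doubled count, and the deviation is far
  below the additive constant.\<close>

lemma own1000_max:
  assumes z: "z \<in> P" and m: "\<And>v. v \<in> P \<Longrightarrow> dg R v P \<le> dg R z P" "\<And>q. q \<in> Q \<Longrightarrow> dg R q Q \<le> dg R z P"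
  shows "dg R z P + 1000 \<le> n"
proof (rule ccontr)
  assume h: "\<not> ?thesis"
  have o1: "dg R v P + 4 \<le> n" if "v \<in> P" "v \<noteq> z" for v
    using own_two[OF z that(1)] that(2) m(1)[OF that(1)] DP[OF z] Feq h n_big by fastforce
  have o2: "dg R q Q + 4 \<le> n" if "q \<in> Q" for q
    using own_le_half[OF z] own_le_halfQ[OF that] m(2)[OF that] DP[OF z] Feq h n_big by linarith
  have "49 * n \<le> 50 * dg R z P" using h n_big by linarith
  then show False using near_own(1)[OF z _ o1 o2] h by linarith
qed

lemma own1000: "v \<in> P \<Longrightarrow> dg R v P + 1000 \<le> n" and own1000Q: "q \<in> Q \<Longrightarrow> dg R q Q + 1000 \<le> n"
proof -
  interpret S: mincx Q P R D by (rule swap)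
  have ne: "P \<noteq> {}" "Q \<noteq> {}" using n_big cardQ by auto
  obtain a where a: "a \<in> P" "\<And>v. v \<in> P \<Longrightarrow> dg R v P \<le> dg R a P"
    using finite_argmax[OF finP ne(1), of "\<lambda>v. dg R v P"] by blast
  obtain b where b: "b \<in> Q" "\<And>v. v \<in> Q \<Longrightarrow> dg R v Q \<le> dg R b Q"
    using finite_argmax[OF finQ ne(2), of "\<lambda>v. dg R v Q"] by blast
  have "dg R a P + 1000 \<le> n \<and> dg R b Q + 1000 \<le> n"
  proof (cases "dg R b Q \<le> dg R a P")
    case True
    then have "dg R a P + 1000 \<le> n" using own1000_max[OF a] b(2) le_trans by blast
    then show ?thesis using True by linarith
  next
    case False
    then have "dg R b Q + 1000 \<le> card Q" using S.own1000_max[OF b] a(2) by (meson le_trans nat_le_linear)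
    then show ?thesis using False cardQ by linarith
  qed
  then show "v \<in> P \<Longrightarrow> dg R v P + 1000 \<le> n" "q \<in> Q \<Longrightarrow> dg R q Q + 1000 \<le> n"
    using a(2) b(2) by (meson add_le_mono1 le_trans)+
qed

lemma near_own':
  assumes "z \<in> P" "49 * n \<le> 50 * dg R z P"
  shows "dg R z P + 209000 \<le> n" "(\<Sum>s\<in>outN z. dg R s P) + 4 * dg R z P \<le> 4 * n"
    "(\<Sum>s\<in>outN z. dg R s Q) + 2 * dg R z P \<le> 2 * n"
proof -
  have o1: "dg R v P + 4 \<le> n" if "v \<in> P" "v \<noteq> z" for v using own1000[OF that(1)] by linarith
  have o2: "dg R q Q + 4 \<le> n" if "q \<in> Q" for q using own1000Q[OF that] by linarith
  show "dg R z P + 209000 \<le> n" "(\<Sum>s\<in>outN z. dg R s P) + 4 * dg R z P \<le> 4 * n"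
    "(\<Sum>s\<in>outN z. dg R s Q) + 2 * dg R z P \<le> 2 * n"
    using near_own[OF assms o1 o2] by blast+
qed

text \<open>The vertex \<open>v\<close> goes to \<open>w\<close>, and independent non-neighbours of
  \<open>v\<close> of degree at most \<open>L\<close> go to the neighbours of \<open>w\<close>. Each
  of these creates at most \<open>L * l\<close> edges, whereas \<open>v\<close> creates none because
  all neighbours of its image are used. The edges at \<open>v\<close> pay.\<close>

lemma place_light:
  assumes v: "v \<in> P" and w: "w \<in> Q" and vw: "\<not> R v w"
    and SL: "SL \<subseteq> outN v" "\<And>s. s \<in> SL \<Longrightarrow> dg R s P \<le> L"
    and y: "\<And>y. y \<in> nb R w Q \<Longrightarrow> dg R y Q \<le> l"
      "\<And>y. y \<in> nb R w Q \<Longrightarrow> dg R w Q * (L + 1) \<le> card {s \<in> SL. \<not> R s y}"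
    and i: "dg R w Q * l \<le> \<iota>" "dg R w Q * L \<le> \<iota>" 
    and c: "\<And>u. u \<in> P \<Longrightarrow> u \<noteq> v \<Longrightarrow> dg R u Q + \<iota> + dg R w Q + 2 \<le> n"
      "\<And>q. q \<in> Q \<Longrightarrow> dg R q P + \<iota> + dg R w Q + 2 \<le> n"
    and w1000: "dg R w Q \<le> 900"
    and cost: "dg R w Q * (L * l) + \<iota> + 3 * dg R w Q + 3 \<le> dg R v (P \<union> Q)"
  shows False
proof -
  let ?K = "nb R w Q" and ?C = "\<lambda>x. insert x (nb R x P)"
  have fK: "finite ?K" "card ?K = dg R w Q" unfolding nb_def dg_def by auto
  have SLP: "s \<in> P \<and> s \<noteq> v \<and> \<not> R v s" if "s \<in> SL" for s using SL(1) that unfolding outN_def nb_def by auto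
  have fSL: "finite SL" using SLP finP by (meson finite_subset subsetI)
  have "\<exists>x. (\<forall>q\<in>?K. x q \<in> {s \<in> SL. \<not> R s q}) \<and> (\<forall>q\<in>?K. \<forall>r\<in>?K. q \<noteq> r \<longrightarrow> x q \<notin> ?C (x r))"
  proof (rule greedy_reps_apart[where c = "L + 1"])
    fix q a assume "q \<in> ?K" "a \<in> {s \<in> SL. \<not> R s q}"
    then have "dg R a P \<le> L" using SL(2) by blast
    moreover have "card (?C a) \<le> dg R a P + 1" unfolding dg_def nb_def by (simp add: card_insert_if)
    ultimately have "card (?C a) \<le> L + 1" by linarith
    then show "finite (?C a) \<and> card (?C a) \<le> L + 1" unfolding nb_def by simp
  next
    fix q r a b assume "a \<in> {s \<in> SL. \<not> R s q}" "b \<in> {s \<in> SL. \<not> R s r}" "a \<in> ?C b"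
    then show "b \<in> ?C a" using SLP sym unfolding nb_def by auto
  qed (use fK y(2) in auto)
  then obtain x where x0: "\<And>q. q \<in> ?K \<Longrightarrow> x q \<in> SL" "\<And>q. q \<in> ?K \<Longrightarrow> \<not> R (x q) q"
    "\<And>q r. q \<in> ?K \<Longrightarrow> r \<in> ?K \<Longrightarrow> q \<noteq> r \<Longrightarrow> x q \<notin> ?C (x r)" by blast
  have x1: "x q \<in> P" "x q \<noteq> v" "\<not> R v (x q)" if "q \<in> ?K" for q using SLP[OF x0(1)[OF that]] by auto
  have xne: "x q \<noteq> x r" "\<not> R (x r) (x q)" if "q \<in> ?K" "r \<in> ?K" "q \<noteq> r" for q r
    using x0(3)[OF that] x1(1)[OF that(1)] unfolding nb_def by auto
  have xinj: "inj_on x ?K" using xne(1) by (meson inj_onI)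
  define A where "A = insert v (x ` ?K)"
  define g where "g u = (if u = v then w else inv_into ?K x u)" for u
  have gx: "g (x q) = q" if "q \<in> ?K" for q
    using x1(2)[OF that] inv_into_f_f[OF xinj that] unfolding g_def by simp
  have gv: "g v = w" unfolding g_def by simp
  have gxi: "g ` x ` ?K = ?K" using gx by force
  have gA: "g ` A = insert w ?K" unfolding A_def using gv gxi by simp
  have cA: "card A = dg R w Q + 1"
  proof -
    have "card (x ` ?K) = card ?K" using xinj by (rule card_image)
    moreover have "v \<notin> x ` ?K" using x1(2) by blast
    ultimately show ?thesis unfolding A_def using fK by simp
  qed
  have wK: "w \<notin> ?K" unfolding nb_def by simp
  have fA: "finite A" unfolding A_def using fK by simp
  have "card (g ` A) = card A" unfolding gA cA using fK wK by simp
  then have inj: "inj_on g A" using fA by (simp add: eq_card_imp_inj_on)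
  have KQ: "?K \<subseteq> Q" unfolding nb_def by auto
  have p: "ppk R P Q A g"
    unfolding ppk_def
  proof (intro conjI ballI impI)
    show "A \<subseteq> P" unfolding A_def using v x1 by blast
    show "g ` A \<subseteq> Q" unfolding gA using w KQ by blast
    show "inj_on g A" by (rule inj)
    fix a assume a: "a \<in> A"
    have a': "a = v \<or> (\<exists>q\<in>?K. a = x q)" using a unfolding A_def by blast
    then show "\<not> R a (g a)" by (elim disjE bexE) (simp_all add: gv gx vw x0(2))
    fix b assume b: "b \<in> A" "R a b"
    have b': "b = v \<or> (\<exists>q\<in>?K. b = x q)" using b unfolding A_def by blast
    have False using a' b' b(2) x1(3) xne(2) sym irr by metis
    then show "\<not> R (g a) (g b)" ..
  qed
  have new: "\<exists>q\<in>?K. R (x q) u \<and> R q t" if "newe R A g u t" "t \<in> Q - g ` A" for u t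
  proof -
    obtain a where a: "a \<in> A" "R a u" "R (g a) t" using \<open>newe R A g u t\<close> unfolding newe_def by blast
    have "a \<noteq> v"
    proof
      assume "a = v"
      then have "t \<in> ?K" using a gv that(2) unfolding nb_def by auto
      then show False using that(2) gA by blast
    qed
    then obtain q where "q \<in> ?K" "a = x q" using a(1) unfolding A_def by blast
    then show ?thesis using a gx by auto
  qed
  have nx: "nx Q R A g u \<le> (\<Sum>q\<in>?K. if R (x q) u then dg R q Q else 0)" for u
  proof -
    have "{t \<in> Q - g ` A. newe R A g u t} \<subseteq> (\<Union>q\<in>?K. if R (x q) u then nb R q Q else {})"
      using new unfolding nb_def by fastforce
    then have "nx Q R A g u \<le> card (\<Union>q\<in>?K. if R (x q) u then nb R q Q else {})"
      unfolding nx_def using fK by (intro card_mono) (auto simp: nb_def)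
    also have "\<dots> \<le> (\<Sum>q\<in>?K. card (if R (x q) u then nb R q Q else {}))" using fK by (intro card_UN_le) auto
    also have "\<dots> = (\<Sum>q\<in>?K. if R (x q) u then dg R q Q else 0)" unfolding dg_def by (intro sum.cong) auto
    finally show ?thesis .
  qed
  have ny: "ny P R A g t \<le> (\<Sum>q\<in>?K. dg R (x q) P)" if "t \<in> Q - g ` A" for t
  proof -
    have "{u \<in> P - A. newe R A g u t} \<subseteq> (\<Union>q\<in>?K. nb R (x q) P)"
      using new that unfolding nb_def by fastforce
    then have "ny P R A g t \<le> card (\<Union>q\<in>?K. nb R (x q) P)"
      unfolding ny_def using fK by (intro card_mono) (auto simp: nb_def)
    also have "\<dots> \<le> (\<Sum>q\<in>?K. card (nb R (x q) P))" using fK by (intro card_UN_le) auto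
    finally show ?thesis unfolding dg_def .
  qed
  show False
  proof (rule reduction_cost[OF p, of "{v}" \<iota>])
    show "A \<noteq> {}" "{v} \<subseteq> A \<union> g ` A" unfolding A_def by auto
    show "dg R u Q + \<iota> + card A + 1 \<le> n" if "u \<in> P - A" for u
      using c(1)[of u] that cA unfolding A_def by simp
    show "dg R q P + \<iota> + card A + 1 \<le> n" if "q \<in> Q - g ` A" for q
      using c(2)[of q] that cA by simp
  next
    fix u assume u: "u \<in> P - A"
    have "dg R u (P - A) \<le> dg R u P" by (auto intro!: dg_mono)
    then show "dg R u (P - A) + 2 \<le> n - card A" using own1000[of u] u cA w1000 by simp
    have "(\<Sum>q\<in>?K. if R (x q) u then dg R q Q else 0) \<le> (\<Sum>q\<in>?K. l)"
      using y(1) by (intro sum_mono) auto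
    then show "nx Q R A g u \<le> \<iota>" using nx[of u] i(1) fK by simp
  next
    fix t assume t: "t \<in> Q - g ` A"
    have "dg R t (Q - g ` A) \<le> dg R t Q" by (auto intro!: dg_mono)
    then show "dg R t (Q - g ` A) + 2 \<le> n - card A" using own1000Q[of t] t cA w1000 by simp
    have "(\<Sum>q\<in>?K. dg R (x q) P) \<le> (\<Sum>q\<in>?K. L)" using SL(2) x0(1) by (intro sum_mono) auto
    then show "ny P R A g t \<le> \<iota>" using ny[OF t] i(2) fK by simp
  next
    have "(\<Sum>u\<in>P - A. nx Q R A g u) \<le> (\<Sum>u\<in>P. nx Q R A g u)" by (intro sum_mono2) auto
    also have "\<dots> \<le> (\<Sum>u\<in>P. \<Sum>q\<in>?K. if R (x q) u then dg R q Q else 0)" using nx by (intro sum_mono)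
    also have "\<dots> = (\<Sum>q\<in>?K. \<Sum>u\<in>P. if R (x q) u then dg R q Q else 0)" by (rule sum.swap)
    also have "\<dots> = (\<Sum>q\<in>?K. dg R (x q) P * dg R q Q)"
    proof (rule sum.cong)
      fix q assume "q \<in> ?K"
      have "P \<inter> {u. R (x q) u} = nb R (x q) P" unfolding nb_def by auto
      then show "(\<Sum>u\<in>P. if R (x q) u then dg R q Q else 0) = dg R (x q) P * dg R q Q"
        by (simp add: sum.If_cases dg_def)
    qed simp
    also have "\<dots> \<le> (\<Sum>q\<in>?K. L * l)" using SL(2) x0(1) y(1) by (intro sum_mono mult_mono) auto
    finally have "(\<Sum>u\<in>P - A. nx Q R A g u) \<le> dg R w Q * (L * l)" using fK by simp
    moreover have "sd R {v} = 0" unfolding sd_def dg_def nb_def by auto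
    ultimately show "sd R {v} + 2 * (\<Sum>u\<in>P - A. nx Q R A g u) + 2 * \<iota> + 6 * card A \<le> 2 * (\<Sum>z\<in>{v}. dg R z (P \<union> Q))"
      using cost cA by simp
  qed
qed

end

section \<open>Placing a vertex of large degree\<close>

text \<open>Markov's inequality for the complement, multiplied by \<open>L + 1\<close> to stay in
  the natural numbers.\<close>

lemma card_low:
  fixes f :: "'a \<Rightarrow> nat"
  assumes "finite S"
  shows "(L + 1) * card S \<le> (L + 1) * card {s \<in> S. f s \<le> L} + sum f S"
proof -
  have "card S \<le> card ({s \<in> S. f s \<le> L} \<union> {s \<in> S. L + 1 \<le> f s})" using assms by (intro card_mono) auto
  then have "card S \<le> card {s \<in> S. f s \<le> L} + card {s \<in> S. L + 1 \<le> f s}"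
    using card_Un_le[of "{s \<in> S. f s \<le> L}" "{s \<in> S. L + 1 \<le> f s}"] by linarith
  then have "(L + 1) * card S \<le> (L + 1) * (card {s \<in> S. f s \<le> L} + card {s \<in> S. L + 1 \<le> f s})"
    by (rule mult_le_mono2)
  then show ?thesis using card_ge_le_sum[OF assms, of "L + 1" f] by (simp add: algebra_simps)
qed

lemma card_nonnb:
  assumes "finite S" shows "card S \<le> card {s \<in> S. \<not> R s y} + card {s \<in> S. R s y}"
proof -
  have "S = {s \<in> S. \<not> R s y} \<union> {s \<in> S. R s y}" by blast
  then show ?thesis using card_Un_le[of "{s \<in> S. \<not> R s y}" "{s \<in> S. R s y}"] by simp
qed

context mincx
begin

lemma deg_own: "dg R v P \<le> dg R v (P \<union> Q)" and deg_cross: "dg R v Q \<le> dg R v (P \<union> Q)"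
  using deg_split by auto

lemma card_nonnb_le:
  assumes "S \<subseteq> P" shows "card S \<le> card {s \<in> S. \<not> R s y} + dg R y P"
proof -
  have f: "finite S" using assms finP finite_subset by blast
  have "card {s \<in> S. R s y} \<le> dg R y P"
    unfolding dg_def nb_def using assms sym by (intro card_mono) auto
  then show ?thesis using card_nonnb[OF f, of R y] by linarith
qed

text \<open>By \<open>near_own'\<close> the non-neighbours of a vertex of almost full own degree
  have average own degree about 4. The cutoff 16 keeps about \<open>13/17\<close> of them, and
  \<open>3 * 13 > 2 * 17\<close> is what bounds the number of exceptional vertices by two.\<close>

definition SLn where "SLn v = {s \<in> outN v. dg R s P \<le> 16}"

text \<open>The exceptional vertices, which leave too few candidates to be placed on them. Room for
  200 covers both uses: \<open>3 * 17\<close> and \<open>7 * 16 + 7\<close> candidates.\<close>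

definition Bad where
  "Bad v = (if 49 * n \<le> 50 * dg R v P then {y \<in> Q. card {s \<in> SLn v. \<not> R s y} < 200} else {})"

lemma outN_sub: "outN v \<subseteq> P" unfolding outN_def by blast
lemma SLn_sub: "SLn v \<subseteq> outN v" "finite (SLn v)" "SLn v \<subseteq> P"
  using outN_sub[of v] finite_subset[OF _ finP, of "{s \<in> outN v. dg R s P \<le> 16}"] unfolding SLn_def by auto
lemma fin_outN[simp]: "finite (outN v)" using outN_sub finP finite_subset by blast

lemma SLn_card:
  assumes v: "v \<in> P" "49 * n \<le> 50 * dg R v P" shows "13 * n \<le> 17 * card (SLn v) + 13 * dg R v P + 17"
  using card_low[OF fin_outN, of 16 v "\<lambda>s. dg R s P"] near_own'(2)[OF v] card_outN[OF v(1)]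
  unfolding SLn_def by simp

text \<open>Exceptional vertices have large cross degree, so they may later be added to the heavy
  ones.\<close>

lemma Bad_deg:
  assumes v: "v \<in> P" and y: "y \<in> Bad v" shows "1000 \<le> dg R y P" "y \<in> Q"
proof -
  have h: "49 * n \<le> 50 * dg R v P" and c: "card {s \<in> SLn v. \<not> R s y} < 200" and yQ: "y \<in> Q"
    using y unfolding Bad_def by (auto split: if_splits)
  show "1000 \<le> dg R y P" using SLn_card[OF v h] near_own'(1)[OF v h] card_nonnb_le[OF SLn_sub(3), of v y] c by linarith
  show "y \<in> Q" by (rule yQ)
qed

text \<open>Three exceptional vertices would send nearly \<open>3 * card (SLn v)\<close> cross edges
  to the non-neighbours of \<open>v\<close>, which have at most
  \<open>2n - 2 * dg R v P\<close>.\<close>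

lemma Bad_card: assumes v: "v \<in> P" shows "finite (Bad v)" "card (Bad v) \<le> 2"
proof -
  show f: "finite (Bad v)" unfolding Bad_def by simp
  show "card (Bad v) \<le> 2"
  proof (cases "49 * n \<le> 50 * dg R v P")
    case h: True
    show ?thesis
    proof (rule ccontr)
      assume "\<not> ?thesis"
      then obtain B where B: "B \<subseteq> Bad v" "card B = 3" using obtain_subset_with_card_n[of 3 "Bad v"] by auto
      have fB: "finite B" using B f finite_subset by blast
      have B1: "card (SLn v) \<le> 199 + dg R y (SLn v)" if "y \<in> B" for y
      proof -
        have "card {s \<in> SLn v. \<not> R s y} < 200" using that B(1) h unfolding Bad_def by auto
        moreover have "{s \<in> SLn v. R s y} = nb R y (SLn v)" unfolding nb_def using symiff by blast
        ultimately show ?thesis using card_nonnb[OF SLn_sub(2), of v R y] unfolding dg_def by simp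
      qed
      have "3 * card (SLn v) = (\<Sum>y\<in>B. card (SLn v))" using B by simp
      also have "\<dots> \<le> (\<Sum>y\<in>B. 199 + dg R y (SLn v))" using B1 by (intro sum_mono)
      also have "\<dots> = 597 + (\<Sum>y\<in>B. dg R y (SLn v))" using B by (simp add: sum.distrib)
      also have "(\<Sum>y\<in>B. dg R y (SLn v)) = (\<Sum>s\<in>SLn v. dg R s B)"
        by (rule dg_sum_swap) (use fB SLn_sub symiff in auto)
      also have "\<dots> \<le> (\<Sum>s\<in>SLn v. dg R s Q)" using B(1) unfolding Bad_def
        by (intro sum_mono dg_mono) (auto split: if_splits)
      also have "\<dots> \<le> (\<Sum>s\<in>outN v. dg R s Q)" using SLn_sub by (intro sum_mono2) auto
      finally have "3 * card (SLn v) \<le> 597 + (\<Sum>s\<in>outN v. dg R s Q)" by simp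
      then show False using SLn_card[OF v h] near_own'(1,3)[OF v h] by linarith
    qed
  qed (simp add: Bad_def)
qed

lemma SLn_room: "49 * n \<le> 50 * dg R v P \<Longrightarrow> y \<in> Q \<Longrightarrow> y \<notin> Bad v \<Longrightarrow> 200 \<le> card {s \<in> SLn v. \<not> R s y}"
  unfolding Bad_def by auto

lemma own_sum_outN:
  assumes v: "v \<in> P" shows "(\<Sum>s\<in>outN v. dg R s P) + s2 + 2 * e3 + 2 * dg R v P + 2 * D + 836558 \<le> 6 * n"
  using outN_own_sum[OF v] Feq by linarith

text \<open>\<open>place_light\<close> costs about \<open>3 * (L + 1) * l\<close>. The larger the
  own degree of \<open>v\<close>, the fewer non-neighbours it has and the larger \<open>L\<close>
  must be, but the more its edges pay: \<open>L = 8\<close> for own degree up to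
  \<open>n/10\<close>, \<open>L = 125\<close> in the middle range. For almost full own degree the
  stronger bound of \<open>near_own'\<close> allows \<open>L = 16\<close>.\<close>

lemma mega_dense_light:
  assumes v: "v \<in> P" "n \<le> 600 * dg R v (P \<union> Q)" and w: "w \<in> Q" "\<not> R v w" "dg R w Q \<le> 3"
    and y: "\<And>y. y \<in> nb R w Q \<Longrightarrow> 27000 * dg R y (P \<union> Q) < n \<and> y \<notin> Bad v"
  shows False
proof -
  define l where "l = n div 27000"
  have l: "27000 * l \<le> n" unfolding l_def by simp
  have yl: "dg R y Q \<le> l" "27000 * dg R y P < n" if "y \<in> nb R w Q" for y
  proof -
    have "27000 * dg R y Q \<le> n" using y[OF that] deg_cross[of y] by linarith
    then have "27000 * dg R y Q div 27000 \<le> n div 27000" by (rule div_le_mono)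
    then show "dg R y Q \<le> l" unfolding l_def by simp
    show "27000 * dg R y P < n" using y[OF that] deg_own[of y] by linarith
  qed
  have main: False if SL: "SL \<subseteq> outN v" "\<And>s. s \<in> SL \<Longrightarrow> dg R s P \<le> L" and L: "L \<le> 125"
      and room: "\<And>y. y \<in> nb R w Q \<Longrightarrow> 3 * (L + 1) \<le> card {s \<in> SL. \<not> R s y}"
      and cost: "3 * (L * l) + 3 * l + 3 * L + 12 \<le> dg R v (P \<union> Q)" for SL L
  proof (rule place_light[OF v(1) w(1,2) SL, of l "3 * l + 3 * L"])
    have m: "dg R w Q * x \<le> 3 * x" for x using w(3) by simp
    show "dg R w Q * (L + 1) \<le> card {s \<in> SL. \<not> R s y}" if "y \<in> nb R w Q" for y
      using m[of "L + 1"] room[OF that] by linarith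
    show "dg R w Q * l \<le> 3 * l + 3 * L" "dg R w Q * L \<le> 3 * l + 3 * L" using m[of l] m[of L] by linarith+
    show "dg R w Q * (L * l) + (3 * l + 3 * L) + 3 * dg R w Q + 3 \<le> dg R v (P \<union> Q)"
      using m[of "L * l"] cost w(3) by linarith
    fix u assume "u \<in> P" "u \<noteq> v"
    then show "dg R u Q + (3 * l + 3 * L) + dg R w Q + 2 \<le> n" using crossP_small[of u] l L w(3) n_big by linarith
  next
    fix u assume "u \<in> Q"
    then show "dg R u P + (3 * l + 3 * L) + dg R w Q + 2 \<le> n" using crossQ_small[of u] l w(3) L n_big by linarith
  qed (use yl w in auto)
  define S where "S = outN v"
  have Sf: "finite S" "S \<subseteq> P" unfolding S_def using outN_sub by auto
  have cS: "card S + dg R v P + 1 = n" unfolding S_def using card_outN[OF v(1)] .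
  have X: "(\<Sum>s\<in>S. dg R s P) + 4 * dg R v P + 836558 \<le> 6 * n"
    using own_sum_outN[OF v(1)] DP[OF v(1)] unfolding S_def by linarith
  have room: "3 * (L + 1) \<le> card {s \<in> {s \<in> S. dg R s P \<le> L}. \<not> R s y}"
    if "27000 * (3 * (L + 1)) + n \<le> 27000 * card {s \<in> S. dg R s P \<le> L}" "y \<in> nb R w Q" for L y
    using card_nonnb_le[of "{s \<in> S. dg R s P \<le> L}" y] Sf(2) yl(2)[OF that(2)] that(1) by fastforce
  consider "49 * n \<le> 50 * dg R v P" | "10 * dg R v P \<le> n" | "50 * dg R v P < 49 * n" "n < 10 * dg R v P" by linarith
  then show False
  proof cases
    case 1
    have d: "49 * n \<le> 50 * dg R v (P \<union> Q)" using 1 deg_own[of v] by linarith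
    show False
    proof (rule main[of "SLn v" 16])
      show "SLn v \<subseteq> outN v" by (rule SLn_sub)
      show "3 * (16 + 1) \<le> card {s \<in> SLn v. \<not> R s y}" if "y \<in> nb R w Q" for y
        using SLn_room[OF 1, of y] y[OF that] that unfolding nb_def by auto
      show "3 * (16 * l) + 3 * l + 3 * 16 + 12 \<le> dg R v (P \<union> Q)" using l d n_big by linarith
    qed (auto simp: SLn_def)
  next
    case 2
    have "9 * card S \<le> 9 * card {s \<in> S. dg R s P \<le> 8} + (\<Sum>s\<in>S. dg R s P)"
      using card_low[OF Sf(1), of 8 "\<lambda>s. dg R s P"] by simp
    then have r: "27000 * (3 * (8 + 1)) + n \<le> 27000 * card {s \<in> S. dg R s P \<le> 8}"
    proof -
      have "9 * n \<le> 9 * card {s \<in> S. dg R s P \<le> 8} + (\<Sum>s\<in>S. dg R s P) + 9 * dg R v P + 9"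
        using \<open>9 * card S \<le> _\<close> cS by linarith
      then have "3 * n \<le> 9 * card {s \<in> S. dg R s P \<le> 8} + 5 * dg R v P" using X by linarith
      then have "5 * n \<le> 18 * card {s \<in> S. dg R s P \<le> 8}" using 2 by linarith
      then show ?thesis using n_big by simp
    qed
    show False
    proof (rule main[of "{s \<in> S. dg R s P \<le> 8}" 8])
      show "3 * (8 * l) + 3 * l + 3 * 8 + 12 \<le> dg R v (P \<union> Q)" using l v(2) n_big by linarith
    qed (use room[OF r] in \<open>auto simp: S_def\<close>)
  next
    case 3
    have "126 * card S \<le> 126 * card {s \<in> S. dg R s P \<le> 125} + (\<Sum>s\<in>S. dg R s P)"
      using card_low[OF Sf(1), of 125 "\<lambda>s. dg R s P"] by simp
    then have r: "27000 * (3 * (125 + 1)) + n \<le> 27000 * card {s \<in> S. dg R s P \<le> 125}"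
    proof -
      have "126 * n \<le> 126 * card {s \<in> S. dg R s P \<le> 125} + (\<Sum>s\<in>S. dg R s P) + 126 * dg R v P + 126"
        using \<open>126 * card S \<le> _\<close> cS by linarith
      then have "120 * n + 836432 \<le> 126 * card {s \<in> S. dg R s P \<le> 125} + 122 * dg R v P" using X by linarith
      then have "22 * n + 41821600 \<le> 6300 * card {s \<in> S. dg R s P \<le> 125}" using 3 by linarith
      then show ?thesis using n_big by simp
    qed
    have d: "n < 10 * dg R v (P \<union> Q)" using 3 deg_own[of v] by linarith
    show False
    proof (rule main[of "{s \<in> S. dg R s P \<le> 125}" 125])
      show "3 * (125 * l) + 3 * l + 3 * 125 + 12 \<le> dg R v (P \<union> Q)" using l d n_big by linarith
    qed (use room[OF r] in \<open>auto simp: S_def\<close>)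
  qed
qed

end

text \<open>By the inequality of the means, \<open>c * L\<close> is at most
  \<open>2 * X * s / (p * q)\<close>, hence at most \<open>(X + s)^2 / (2 * p * q)\<close>. The two
  bounds for \<open>X + s\<close> are used according to which of \<open>p\<close> and
  \<open>q\<close> is larger, and \<open>k\<close> bounds their ratio. Only the product of
  \<open>c\<close> and \<open>L\<close> matters for the cost of a placement, so \<open>c\<close> and
  \<open>L\<close> need not be small separately.\<close>

lemma prod_bound:
  fixes c L p q s X k :: nat
  assumes c: "c * p \<le> s" and L: "L * q \<le> 2 * X" and 1: "X + s \<le> 4 * q + 2 * p" and 2: "X + s \<le> 2 * q + 4 * p"
    and pos: "0 < p" "0 < q" and k: "p \<le> k * q" "q \<le> k * p"
  shows "c * L \<le> 16 + 2 * k" "c \<le> 2 * k + 4"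
proof -
  have amgm: "4 * (s * X) \<le> (X + s)\<^sup>2"
  proof -
    have "0 \<le> (int X - int s)\<^sup>2" by simp
    then have "int (4 * (s * X)) \<le> int ((X + s)\<^sup>2)" by (simp add: power2_eq_square algebra_simps)
    then show ?thesis by linarith
  qed
  have "(c * p) * (L * q) \<le> s * (2 * X)" using c L by (rule mult_le_mono)
  then have a: "2 * (c * L * (p * q)) \<le> (X + s)\<^sup>2" using amgm by (simp add: algebra_simps)
  have pp: "p * p \<le> k * (p * q)" using mult_le_mono2[OF k(1), of p] by (simp add: algebra_simps)
  have qq: "q * q \<le> k * (p * q)" using mult_le_mono2[OF k(2), of q] by (simp add: algebra_simps)
  have "(X + s)\<^sup>2 \<le> (32 + 4 * k) * (p * q)"
  proof (cases "q \<le> p")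
    case True
    have "(X + s)\<^sup>2 \<le> (4 * q + 2 * p)\<^sup>2" using 1 by (intro power_mono) auto
    also have "\<dots> = 16 * (q * q) + 16 * (p * q) + 4 * (p * p)" by (simp add: power2_eq_square algebra_simps)
    also have "\<dots> \<le> 16 * (p * q) + 16 * (p * q) + 4 * (k * (p * q))"
      using mult_le_mono1[OF True, of q] pp by linarith
    finally show ?thesis by (simp add: algebra_simps)
  next
    case False
    have "(X + s)\<^sup>2 \<le> (2 * q + 4 * p)\<^sup>2" using 2 by (intro power_mono) auto
    also have "\<dots> = 4 * (q * q) + 16 * (p * q) + 16 * (p * p)" by (simp add: power2_eq_square algebra_simps)
    also have "\<dots> \<le> 4 * (k * (p * q)) + 16 * (p * q) + 16 * (p * q)"
      using mult_le_mono2[of p q p] False qq by linarith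
    finally show ?thesis by (simp add: algebra_simps)
  qed
  with a have "(2 * (c * L)) * (p * q) \<le> (32 + 4 * k) * (p * q)" by (simp add: algebra_simps)
  then show "c * L \<le> 16 + 2 * k" using pos by auto
  have "c * p \<le> (2 * k + 4) * p" using c 2 k(2) by (simp add: algebra_simps)
  then show "c \<le> 2 * k + 4" using pos(1) by simp
qed

lemma finite_argmin:
  fixes f :: "'a \<Rightarrow> nat"
  assumes "finite S" "S \<noteq> {}" shows "\<exists>a\<in>S. \<forall>v\<in>S. f a \<le> f v"
proof -
  have "Min (f ` S) \<in> f ` S" using assms by simp
  then obtain a where "a \<in> S" "f a = Min (f ` S)" by auto
  then show ?thesis using assms by (metis Min_le finite_imageI imageI)
qed

context mincx
begin

text \<open>\<open>v\<close> is placed on a non-neighbour \<open>w\<close> of least own degree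
  \<open>c\<close>. This costs about \<open>(c * L + c) * l\<close> edges, where degree at most
  \<open>L\<close> is common among the non-neighbours of \<open>v\<close>. Both \<open>c\<close> and
  \<open>L\<close> are controlled by averages, and a large average on one side leaves few edges for
  the other.\<close>

lemma mega_lonely:
  assumes v: "v \<in> P" "n \<le> 10 * dg R v (P \<union> Q)" and light: "\<And>y. y \<in> Q \<Longrightarrow> 600 * dg R y (P \<union> Q) < n"
  shows False
proof -
  define l where "l = n div 600"
  have l: "600 * l \<le> n" unfolding l_def by simp
  have yl: "dg R y Q \<le> l" "600 * dg R y P < n" if "y \<in> Q" for y
  proof -
    have "600 * dg R y Q \<le> n" using light[OF that] deg_cross[of y] by linarith
    then have "600 * dg R y Q div 600 \<le> n div 600" by (rule div_le_mono)
    then show "dg R y Q \<le> l" unfolding l_def by simp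
    show "600 * dg R y P < n" using light[OF that] deg_own[of y] by linarith
  qed
  define W where "W = Q - nb R v Q"
  have fW: "finite W" unfolding W_def by simp
  have cW: "card W + dg R v Q = n"
  proof -
    have "nb R v Q \<subseteq> Q" unfolding nb_def by auto
    then have "card (Q - nb R v Q) = card Q - dg R v Q" "dg R v Q \<le> card Q"
      unfolding dg_def by (auto simp: card_Diff_subset finite_subset[OF _ finQ] card_mono[OF finQ])
    then show ?thesis unfolding W_def using cardQ by simp
  qed
  have W50: "n < 50 * card W" using crossP_small[OF v(1)] cW by linarith
  have nR: "w \<in> Q" "\<not> R v w" if "w \<in> W" for w using that unfolding W_def nb_def by auto
  have minsum: "dg R w Q * card W' \<le> s2" if "W' \<subseteq> W" "\<And>u. u \<in> W' \<Longrightarrow> dg R w Q \<le> dg R u Q" for w W'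
  proof -
    have "card W' * dg R w Q \<le> (\<Sum>u\<in>W'. dg R u Q)" using sum_mono[of W' "\<lambda>_. dg R w Q" "\<lambda>u. dg R u Q"] that(2) by simp
    also have "\<dots> \<le> s2" unfolding s2_def using that(1) W_def by (intro sum_mono2) auto
    finally show ?thesis by (simp add: mult.commute)
  qed
  have ec: "dg R v Q \<le> e3" unfolding e3_def using v(1) by (intro member_le_sum) auto
  have "Q \<noteq> {}" using n_big cardQ by auto
  then have Qne: "\<exists>q. q \<in> Q" by blast
  have Dc: "dg R u Q \<le> D + 4" if "u \<in> P" for u using Qne DQP[OF that] by fastforce
  have main: False if w: "w \<in> W" and SL: "SL \<subseteq> outN v" "\<And>s. s \<in> SL \<Longrightarrow> dg R s P \<le> L"
      and B: "dg R w Q * L \<le> B" "dg R w Q \<le> E" "B \<le> 120" "E \<le> 110"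
      and room: "\<And>y. y \<in> nb R w Q \<Longrightarrow> B + E \<le> card {s \<in> SL. \<not> R s y}"
      and c: "\<And>u. u \<in> P \<Longrightarrow> u \<noteq> v \<Longrightarrow> dg R u Q + dg R w Q * l + B + E + 2 \<le> n"
      and cost: "B * l + E * l + B + 3 * E + 3 \<le> dg R v (P \<union> Q)" for w SL L B E
  proof (rule place_light[OF v(1) nR(1)[OF w] nR(2)[OF w] SL, of l "dg R w Q * l + B"])
    have El: "dg R w Q * l \<le> E * l" using B(2) by (rule mult_le_mono1)
    have El': "E * l \<le> 110 * l" using B(4) by (rule mult_le_mono1)
    have "dg R w Q * L * l \<le> B * l" using B(1) by (rule mult_le_mono1)
    then have Bl: "dg R w Q * (L * l) \<le> B * l" by (simp add: mult.assoc)
    show "dg R w Q * (L + 1) \<le> card {s \<in> SL. \<not> R s y}" if "y \<in> nb R w Q" for y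
      using room[OF that] B(1,2) by simp
    show "dg R w Q * (L * l) + (dg R w Q * l + B) + 3 * dg R w Q + 3 \<le> dg R v (P \<union> Q)"
      using cost Bl El B(2) by linarith
    show "dg R w Q \<le> 900" using B by linarith
    show "dg R u Q + (dg R w Q * l + B) + dg R w Q + 2 \<le> n" if "u \<in> P" "u \<noteq> v" for u
      using c[OF that] B(2) by linarith
    show "dg R u P + (dg R w Q * l + B) + dg R w Q + 2 \<le> n" if "u \<in> Q" for u
      using yl(2)[OF that] El El' B l n_big by linarith
  qed (use B yl in \<open>auto simp: nb_def\<close>)
  show False
  proof (cases "49 * n \<le> 50 * dg R v P")
    case near: True
    \<comment> \<open>Choosing \<open>w\<close> outside \<open>H\<close> keeps exceptional vertices
      out of its neighbourhood.\<close>
    define H where "H = (\<Union>y\<in>Bad v. nb R y Q)"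
    define W' where "W' = W - H"
    have "card H \<le> (\<Sum>y\<in>Bad v. dg R y Q)" unfolding H_def dg_def
      using Bad_card[OF v(1)] by (intro card_UN_le)
    also have "\<dots> \<le> (\<Sum>y\<in>Bad v. l)" using yl(1) Bad_deg(2)[OF v(1)] by (intro sum_mono) blast
    also have "\<dots> \<le> 2 * l" using Bad_card[OF v(1)] by simp
    finally have cH: "card H \<le> 2 * l" .
    have fH: "finite H" unfolding H_def using Bad_card[OF v(1)] by (auto simp: nb_def)
    have cW': "card W \<le> card W' + 2 * l"
      using diff_card_le_card_Diff[OF fH, of W] cH unfolding W'_def by linarith
    have "W' \<noteq> {}" using cW' W50 l n_big by auto
    moreover have "finite W'" unfolding W'_def using fW by simp
    ultimately obtain w where w: "w \<in> W'" "\<And>u. u \<in> W' \<Longrightarrow> dg R w Q \<le> dg R u Q"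
      using finite_argmin[of W' "\<lambda>u. dg R u Q"] by blast
    have WW: "W' \<subseteq> W" unfolding W'_def by blast
    have k: "s2 + 4 * dg R v P + 2 * dg R v Q \<le> 6 * n"
      using own_sum_outN[OF v(1)] DP[OF v(1)] ec by linarith
    have "dg R w Q \<le> 7"
    proof (rule ccontr)
      assume "\<not> ?thesis"
      then have "8 * card W' \<le> dg R w Q * card W'" by (intro mult_le_mono1) simp
      then show False using minsum[OF WW w(2)] k cW cW' l W50 near n_big by linarith
    qed
    show False
    proof (rule main[of w "SLn v" 16 112 7])
      show "w \<in> W" using w WW by blast
      show "dg R w Q * 16 \<le> 112" "dg R w Q \<le> 7" using \<open>dg R w Q \<le> 7\<close> by auto
      show "112 + 7 \<le> card {s \<in> SLn v. \<not> R s y}" if "y \<in> nb R w Q" for y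
      proof -
        have "y \<in> Q" "R y w" using that sym unfolding nb_def by auto
        moreover have "y \<notin> Bad v"
        proof
          assume "y \<in> Bad v"
          then have "w \<in> H" unfolding H_def nb_def using nR[of w] w(1) WW \<open>R y w\<close> by blast
          then show False using w(1) unfolding W'_def by blast
        qed
        ultimately show ?thesis using SLn_room[OF near, of y] by simp
      qed
      have "dg R w Q * l \<le> 7 * l" using \<open>dg R w Q \<le> 7\<close> by (rule mult_le_mono1)
      then show "dg R u Q + dg R w Q * l + 112 + 7 + 2 \<le> n" if "u \<in> P" "u \<noteq> v" for u
        using crossP_small[OF that(1)] l n_big by linarith
      show "112 * l + 7 * l + 112 + 3 * 7 + 3 \<le> dg R v (P \<union> Q)"
        using near deg_own[of v] l n_big by linarith
    qed (use SLn_sub in \<open>auto simp: SLn_def\<close>)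
  next
    case far: False
    have "W \<noteq> {}" using W50 n_big by auto
    then obtain w where w: "w \<in> W" "\<And>u. u \<in> W \<Longrightarrow> dg R w Q \<le> dg R u Q"
      using finite_argmin[OF fW, of "\<lambda>u. dg R u Q"] by blast
    define c where "c = dg R w Q"
    have cs: "c * card W \<le> s2" unfolding c_def using minsum[OF _ w(2)] by blast
    define S where "S = outN v"
    have Sf: "finite S" "S \<subseteq> P" unfolding S_def using outN_sub by auto
    have cS: "card S + dg R v P + 1 = n" unfolding S_def using card_outN[OF v(1)] .
    have S50: "n \<le> 50 * card S + 50" using far cS by linarith
    define X where "X = (\<Sum>s\<in>S. dg R s P)"
    have X: "X + s2 + 2 * e3 + 2 * dg R v P + 2 * D + 836558 \<le> 6 * n"
      using own_sum_outN[OF v(1)] unfolding X_def S_def .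
    have X1: "X + s2 \<le> 4 * card S + 2 * card W" and X2: "X + s2 \<le> 2 * card S + 4 * card W"
      using X DP[OF v(1)] Dc[OF v(1)] ec cS cW by linarith+
    \<comment> \<open>Twice the average, so more than half of \<open>S\<close> has degree at most
      \<open>L\<close>.\<close>
    define L where "L = (2 * X) div card S"
    have Spos: "0 < card S" using S50 n_big by linarith
    have L1: "L * card S \<le> 2 * X" unfolding L_def by simp
    have L2: "2 * X < (L + 1) * card S" unfolding L_def using Spos
      by (metis Suc_eq_plus1 dividend_less_times_div mult.commute mult_Suc_right)
    define SL where "SL = {s \<in> S. dg R s P \<le> L}"
    have "(L + 1) * card S \<le> (L + 1) * card SL + X"
      using card_low[OF Sf(1), of L "\<lambda>s. dg R s P"] unfolding SL_def X_def .
    then have "(L + 1) * card S < (L + 1) * (2 * card SL)" using L2 by (simp add: algebra_simps)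
    then have SLc: "card S < 2 * card SL" by (simp only: mult_less_cancel1)
    have SLs: "SL \<subseteq> outN v" "SL \<subseteq> P" unfolding SL_def S_def using outN_sub by auto
    have room: "m \<le> card {s \<in> SL. \<not> R s y}" if "y \<in> nb R w Q" "m \<le> 250" for y m
    proof -
      have "600 * dg R y P < n" using that yl unfolding nb_def by blast
      then show ?thesis using card_nonnb_le[OF SLs(2), of y] SLc S50 n_big that(2) by linarith
    qed
    \<comment> \<open>The new edges at \<open>u\<close> could fill its cross degree. But if
      \<open>c\<close> exceeds 2, all vertices of \<open>W\<close> have degree at least
      \<open>c\<close>, and these edges reduce the room for cross edges at \<open>u\<close> by more
      than \<open>c * l\<close> can add.\<close>
    have cross: "dg R u Q + c * l + 240 \<le> n" if u: "u \<in> P" "u \<noteq> v" for u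
    proof -
      have e: "dg R v Q + dg R u Q \<le> e3" using cross_le_rest[OF v(1) u] by linarith
      have "s2 + 2 * dg R v Q + 4 * dg R u Q \<le> 6 * n" using X Dc[OF u(1)] e by linarith
      then have c2: "c * card W + 4 * dg R u Q \<le> 2 * card W + 4 * n" using cs cW by linarith
      have cu: "50 * dg R u Q < 49 * n" using crossP_small[OF u(1)] .
      show ?thesis
      proof (cases "c \<le> 2")
        case True
        then have "c * l \<le> 2 * l" by (rule mult_le_mono1)
        then show ?thesis using l cu n_big by linarith
      next
        case False
        then obtain m where m: "c = 2 + m" by (metis le_add_diff_inverse nat_le_linear)
        have "m * card W + 4 * dg R u Q \<le> 4 * n" using c2 m by (simp add: algebra_simps)
        moreover have "m * (12 * l) \<le> m * card W" using l W50 by (intro mult_le_mono2) linarith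
        ultimately have "12 * (m * l) + 4 * dg R u Q \<le> 4 * n" by (simp only: mult.left_commute)
        moreover have "c * l = 2 * l + m * l" using m by (simp add: algebra_simps)
        ultimately show ?thesis using l cu n_big by linarith
      qed
    qed
    have go: False if k: "card W \<le> k * card S" "card S \<le> k * card W" "k \<le> 51"
        "(16 + 2 * k) * l + (2 * k + 4) * l + (16 + 2 * k) + 3 * (2 * k + 4) + 3 \<le> dg R v (P \<union> Q)" for k
    proof (rule main[of w SL L "16 + 2 * k" "2 * k + 4"])
      have Wpos: "0 < card W" using W50 by linarith
      show "dg R w Q * L \<le> 16 + 2 * k" "dg R w Q \<le> 2 * k + 4"
        using prod_bound[OF cs L1 X1 X2 Wpos Spos k(1,2)] unfolding c_def by auto
      show "16 + 2 * k + (2 * k + 4) \<le> card {s \<in> SL. \<not> R s y}" if "y \<in> nb R w Q" for y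
        using room[OF that] k(3) by simp
      show "dg R u Q + dg R w Q * l + (16 + 2 * k) + (2 * k + 4) + 2 \<le> n" if "u \<in> P" "u \<noteq> v" for u
        using cross[OF that] k(3) unfolding c_def by linarith
    qed (use w k SLs in \<open>auto simp: SL_def\<close>)
    \<comment> \<open>Both sets of non-neighbours have about \<open>n/50\<close> vertices at least,
      so ratio 51 always holds, with cost below \<open>n/2\<close>. If the degree of
      \<open>v\<close> is below \<open>n/2\<close>, both sets have about \<open>n/2\<close>
      vertices, ratio 3 suffices, and the cost stays below \<open>n/10\<close>.\<close>
    show False
    proof (cases "n \<le> 2 * dg R v (P \<union> Q)")
      case True
      show False
      proof (rule go[of 51])
        show "card W \<le> 51 * card S" "card S \<le> 51 * card W" using S50 W50 cS cW n_big by linarith+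
        show "(16 + 2 * 51) * l + (2 * 51 + 4) * l + (16 + 2 * 51) + 3 * (2 * 51 + 4) + 3 \<le> dg R v (P \<union> Q)"
          using True l n_big by simp
      qed simp
    next
      case False
      show False
      proof (rule go[of 3])
        show "card W \<le> 3 * card S" "card S \<le> 3 * card W"
          using False deg_own[of v] deg_cross[of v] cS cW n_big by linarith+
        show "(16 + 2 * 3) * l + (2 * 3 + 4) * l + (16 + 2 * 3) + 3 * (2 * 3 + 4) + 3 \<le> dg R v (P \<union> Q)"
          using v(2) l n_big by simp
      qed simp
    qed
  qed
qed

end

section \<open>Packing when the degrees are moderate\<close>

lemma card_inj_pre:
  assumes "inj_on f P" "finite S" shows "card {v \<in> P. f v \<in> S} \<le> card S"
proof -
  have "card (f ` {v \<in> P. f v \<in> S}) = card {v \<in> P. f v \<in> S}"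
    using assms(1) by (intro card_image) (auto intro: inj_on_subset)
  moreover have "card (f ` {v \<in> P. f v \<in> S}) \<le> card S" using assms(2) by (intro card_mono) auto
  ultimately show ?thesis by simp
qed

lemma card_UN_bound:
  assumes "finite I" "card I \<le> t" "\<And>i. i \<in> I \<Longrightarrow> card (A i) \<le> s"
  shows "card (\<Union>i\<in>I. A i) \<le> t * s"
proof -
  have "card (\<Union>i\<in>I. A i) \<le> (\<Sum>i\<in>I. card (A i))" using assms(1) by (rule card_UN_le)
  also have "\<dots> \<le> (\<Sum>i\<in>I. s)" using assms(3) by (intro sum_mono)
  also have "\<dots> \<le> t * s" using assms(2) by simp
  finally show ?thesis .
qed

text \<open>In a bijection with as few conflicting vertices as possible, a conflicting vertex could exchange its
  image with that of some other vertex so that neither of the two is in conflict any more.\<close>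

lemma pk_low_degree:
  assumes tr: "tri P Q R"
    and t: "\<And>v. v \<in> P \<Longrightarrow> dg R v P \<le> t" "\<And>y. y \<in> Q \<Longrightarrow> dg R y Q \<le> t"
    and F: "\<And>v. v \<in> P \<Longrightarrow> dg R v Q \<le> F1" "\<And>y. y \<in> Q \<Longrightarrow> dg R y P \<le> F2"
    and sz: "F1 + F2 + 2 * (t * t) + t + 1 < card P"
  shows "pk P Q R"
proof -
  have fin: "finite P" "finite Q" and cPQ: "card P = card Q" and sym: "\<And>u v. R u v \<Longrightarrow> R v u" and irr: "\<And>u. \<not> R u u"
    using tr unfolding tri_def by auto
  define conf where "conf f = {u \<in> P. R u (f u) \<or> (\<exists>v\<in>P. R u v \<and> R (f u) (f v))}" for f
  obtain f0 where "bij_betw f0 P Q" using finite_same_card_bij[OF fin cPQ] by blast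
  then obtain f where f: "bij_betw f P Q" and least: "\<And>h. bij_betw h P Q \<Longrightarrow> card (conf f) \<le> card (conf h)"
    using ex_has_least_nat[of "\<lambda>f. bij_betw f P Q" f0 "\<lambda>f. card (conf f)"] by blast
  have inj: "inj_on f P" and fQ: "\<And>v. v \<in> P \<Longrightarrow> f v \<in> Q" using f bij_betw_imp_inj_on bij_betwE by blast+
  show ?thesis
  proof (cases "conf f = {}")
    case True
    then show ?thesis unfolding pk_def conf_def using f by blast
  next
    case False
    then obtain u where u: "u \<in> conf f" by blast
    have uP: "u \<in> P" using u unfolding conf_def by blast
    \<comment> \<open>The partners \<open>v\<close> with which \<open>u\<close> must not exchange
      images: neighbours of \<open>u\<close> (\<open>X1\<close>), a cross conflict at
      \<open>u\<close> or at \<open>v\<close> (\<open>X2\<close>, \<open>X3\<close>), an edge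
      conflict at \<open>u\<close> or at \<open>v\<close> (\<open>X4\<close>,
      \<open>X5\<close>).\<close>
    define X1 where "X1 = nb R u P"
    define X2 where "X2 = {v \<in> P. f v \<in> nb R u Q}"
    define X3 where "X3 = nb R (f u) P"
    define X4 where "X4 = {v \<in> P. f v \<in> (\<Union>z\<in>nb R u P. nb R (f z) Q)}"
    define X5 where "X5 = (\<Union>z\<in>{z \<in> P. f z \<in> nb R (f u) Q}. nb R z P)"
    have fn: "finite (nb R x P)" "finite (nb R x Q)" for x using fin unfolding nb_def by auto
    have c1: "card X1 \<le> t" using t(1)[OF uP] unfolding X1_def dg_def .
    have c2: "card X2 \<le> F1" using card_inj_pre[OF inj fn(2), of u] F(1)[OF uP] unfolding X2_def dg_def by linarith
    have c3: "card X3 \<le> F2" using F(2)[OF fQ[OF uP]] unfolding X3_def dg_def .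
    have "card (\<Union>z\<in>nb R u P. nb R (f z) Q) \<le> t * t"
    proof (rule card_UN_bound)
      show "card (nb R u P) \<le> t" using t(1)[OF uP] unfolding dg_def .
      show "card (nb R (f z) Q) \<le> t" if "z \<in> nb R u P" for z
        using t(2)[OF fQ, of z] that unfolding dg_def nb_def by auto
    qed (rule fn)
    then have c4: "card X4 \<le> t * t" using card_inj_pre[OF inj, of "\<Union>z\<in>nb R u P. nb R (f z) Q"] fn
      unfolding X4_def by auto
    have c5: "card X5 \<le> t * t" unfolding X5_def
    proof (rule card_UN_bound)
      show "finite {z \<in> P. f z \<in> nb R (f u) Q}" using fin by simp
      show "card {z \<in> P. f z \<in> nb R (f u) Q} \<le> t"
        using card_inj_pre[OF inj fn(2), of "f u"] t(2)[OF fQ[OF uP]] unfolding dg_def by linarith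
      show "card (nb R z P) \<le> t" if "z \<in> {z \<in> P. f z \<in> nb R (f u) Q}" for z
        using t(1)[of z] that unfolding dg_def by simp
    qed
    have fX: "finite X1" "finite X2" "finite X3" "finite X4" "finite X5"
      unfolding X1_def X2_def X3_def X4_def X5_def using fn fin by auto
    have "\<exists>v\<in>P. v \<notin> {u} \<union> X1 \<union> X2 \<union> X3 \<union> X4 \<union> X5"
    proof (rule pickout)
      have "card ({u} \<union> X1 \<union> X2 \<union> X3 \<union> X4 \<union> X5) \<le> card {u} + card X1 + card X2 + card X3 + card X4 + card X5"
        by (meson add_mono card_Un_le le_trans order_refl)
      then show "card ({u} \<union> X1 \<union> X2 \<union> X3 \<union> X4 \<union> X5) < card P" using c1 c2 c3 c4 c5 sz by simp
    qed (use fX in simp)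
    then obtain v where v: "v \<in> P" "v \<noteq> u" "v \<notin> X1" "v \<notin> X2" "v \<notin> X3" "v \<notin> X4" "v \<notin> X5" by blast
    define \<tau> where "\<tau> x = (if x = u then v else if x = v then u else x)" for x
    define h where "h = f \<circ> \<tau>"
    have "bij_betw \<tau> P P" by (rule bij_betw_byWitness[where f' = \<tau>]) (use uP v in \<open>auto simp: \<tau>_def\<close>)
    then have h: "bij_betw h P Q" unfolding h_def using f by (rule bij_betw_trans)
    have hu: "h u = f v" and hv: "h v = f u" and hx: "\<And>x. x \<noteq> u \<Longrightarrow> x \<noteq> v \<Longrightarrow> h x = f x"
      unfolding h_def \<tau>_def using v(2) by auto
    have uv: "\<not> R u v" "\<not> R v u" using v(1,3) sym unfolding X1_def nb_def by auto
    have a1: "\<not> R u (f v)" using v(1,4) fQ unfolding X2_def nb_def by auto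
    have a2: "\<not> R v (f u)"
    proof
      assume "R v (f u)"
      then have "R (f u) v" by (rule sym)
      then show False using v(1,5) unfolding X3_def nb_def by simp
    qed
    have b1: "\<not> R (f v) (h z)" if "z \<in> P" "R u z" for z
    proof
      assume a: "R (f v) (h z)"
      have "z \<noteq> u" "z \<noteq> v" using that(2) irr uv by auto
      then have "R (f z) (f v)" using a hx[of z] sym by auto
      then have "f v \<in> (\<Union>z\<in>nb R u P. nb R (f z) Q)" using that fQ[OF v(1)] unfolding nb_def by blast
      then show False using v(1,6) unfolding X4_def by blast
    qed
    have b2: "\<not> R (f u) (h z)" if "z \<in> P" "R v z" for z
    proof
      assume a: "R (f u) (h z)"
      have "z \<noteq> u" "z \<noteq> v" using that(2) irr uv by auto
      then have "z \<in> {z \<in> P. f z \<in> nb R (f u) Q}" using a hx[of z] fQ[OF that(1)] that(1) unfolding nb_def by simp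
      moreover have "v \<in> nb R z P" using sym[OF that(2)] v(1) unfolding nb_def by simp
      ultimately show False using v(7) unfolding X5_def by blast
    qed
    have unc: "u \<notin> conf h" "v \<notin> conf h"
      unfolding conf_def hu hv using a1 a2 b1 b2 by (auto simp: hu hv)
    have "conf h \<subseteq> conf f"
    proof
      fix x assume x: "x \<in> conf h"
      have xne: "x \<noteq> u" "x \<noteq> v" using x unc by auto
      have xP: "x \<in> P" using x unfolding conf_def by blast
      consider "R x (h x)" | z where "z \<in> P" "R x z" "R (h x) (h z)" using x unfolding conf_def by blast
      then show "x \<in> conf f"
      proof cases
        case 1 then show ?thesis unfolding conf_def using xP hx[OF xne] by auto
      next
        case 2
        have zx: "R z x" "R (h z) (h x)" using 2 sym by auto
        have "z \<noteq> u" using b1[OF xP] zx hu by auto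
        moreover have "z \<noteq> v" using b2[OF xP] zx hv by auto
        ultimately have "R (f x) (f z)" using 2(3) hx[OF xne] hx[of z] by simp
        then show ?thesis unfolding conf_def using xP 2(1,2) by blast
      qed
    qed
    then have "conf h \<subset> conf f" using unc u by blast
    moreover have "finite (conf f)" unfolding conf_def using fin by simp
    ultimately have "card (conf h) < card (conf f)" by (simp add: psubset_card_mono)
    then show ?thesis using least[OF h] by linarith
  qed
qed

text \<open>Once the cross degree that the placed hubs create at a vertex of \<open>Q\<close> exceeds \<open>K\<close>, its neighbours
  are no longer used as images.\<close>

lemma place_hubs:
  assumes tr: "tri P Q R" and B: "B \<subseteq> P" and W: "W \<subseteq> Q"
    and d: "\<And>w. w \<in> W \<Longrightarrow> dg R w Q \<le> d"
    and a: "\<And>v. v \<in> B \<Longrightarrow> dg R v P \<le> \<alpha>" and b: "\<And>v. v \<in> B \<Longrightarrow> dg R v Q \<le> \<beta>"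
    and c: "\<And>y. y \<in> Q \<Longrightarrow> dg R y Q \<le> \<gamma>"
    and M: "(\<Sum>v\<in>B. dg R v P) * d < (M + 1) * (K + 1)"
    and sz: "card B + \<beta> + card B * d + M * \<gamma> < card W"
  shows "\<exists>g. ppk R P Q B g \<and> g ` B \<subseteq> W \<and> (\<forall>y\<in>Q. ny P R B g y \<le> K + \<alpha>)"
proof -
  have fin: "finite P" "finite Q" and sym: "\<And>u v. R u v \<Longrightarrow> R v u" and irr: "\<And>u. \<not> R u u"
    using tr unfolding tri_def by auto
  have symiff: "\<And>u v. R u v \<longleftrightarrow> R v u" using sym by blast
  define big where "big g C y = (\<Sum>x\<in>C. if R y (g x) then dg R x P else 0)" for g C y
  have fn: "finite (nb R x P)" "finite (nb R x Q)" for x using fin unfolding nb_def by auto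
  have fB: "finite B" using B fin finite_subset by blast
  have "\<exists>g. ppk R P Q C g \<and> g ` C \<subseteq> W \<and> (\<forall>y\<in>Q. big g C y \<le> K + \<alpha>)" if "C \<subseteq> B" for C
    using finite_subset[OF that fB] that
  proof (induction C rule: finite_induct)
    case empty then show ?case unfolding ppk_def big_def by simp
  next
    case (insert u C)
    then obtain g where g: "ppk R P Q C g" "g ` C \<subseteq> W" "\<And>y. y \<in> Q \<Longrightarrow> big g C y \<le> K + \<alpha>" by auto
    have uB: "u \<in> B" and uP: "u \<in> P" and CB: "C \<subseteq> B" using insert.prems B by auto
    have cC: "card C \<le> card B" using CB fB by (rule card_mono[rotated])
    \<comment> \<open>The saturated vertices. The weights \<open>big\<close> sum to at most
      \<open>d\<close> times the degree sum of the hubs, so \<open>M + 1\<close> vertices of weight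
      above \<open>K\<close> are impossible.\<close>
    define sat where "sat = {y \<in> Q. K + 1 \<le> big g C y}"
    have fsat: "finite sat" unfolding sat_def using fin by simp
    have gQ: "g x \<in> Q" "dg R (g x) Q \<le> d" if "x \<in> C" for x using g(2) that W d by auto
    have "card sat * (K + 1) \<le> (\<Sum>y\<in>Q. big g C y)" unfolding sat_def using fin(2) by (rule card_ge_le_sum)
    also have "\<dots> = (\<Sum>x\<in>C. \<Sum>y\<in>Q. if R y (g x) then dg R x P else 0)" unfolding big_def by (rule sum.swap)
    also have "\<dots> = (\<Sum>x\<in>C. dg R x P * dg R (g x) Q)"
    proof (rule sum.cong)
      fix x assume "x \<in> C"
      have "Q \<inter> {y. R y (g x)} = nb R (g x) Q" unfolding nb_def using symiff by blast
      then show "(\<Sum>y\<in>Q. if R y (g x) then dg R x P else 0) = dg R x P * dg R (g x) Q"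
        using fin by (simp add: sum.If_cases dg_def)
    qed simp
    also have "\<dots> \<le> (\<Sum>x\<in>C. dg R x P * d)" using gQ by (intro sum_mono mult_le_mono2)
    also have "\<dots> \<le> (\<Sum>x\<in>B. dg R x P * d)" using fB CB by (intro sum_mono2) auto
    also have "\<dots> < (M + 1) * (K + 1)" using M by (simp add: sum_distrib_right)
    finally have "card sat * (K + 1) < (M + 1) * (K + 1)" .
    then have "card sat < M + 1" by (simp only: mult_less_cancel2)
    then have csat: "card sat \<le> M" by simp
    define Y1 where "Y1 = (\<Union>x\<in>C. nb R (g x) Q)"
    define Y2 where "Y2 = (\<Union>y\<in>sat. nb R y Q)"
    have "card Y1 \<le> card B * d" unfolding Y1_def
      by (rule card_UN_bound) (use insert.hyps cC gQ in \<open>auto simp: dg_def\<close>)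
    moreover have "card Y2 \<le> M * \<gamma>" unfolding Y2_def
      by (rule card_UN_bound) (use fsat csat c in \<open>auto simp: dg_def sat_def\<close>)
    moreover have "card (g ` C) \<le> card B" using card_image_le[of C g] insert.hyps cC by linarith
    moreover have "card (nb R u Q) \<le> \<beta>" using b[OF uB] unfolding dg_def .
    moreover have "card (g ` C \<union> nb R u Q \<union> Y1 \<union> Y2) \<le> card (g ` C) + card (nb R u Q) + card Y1 + card Y2"
      by (meson add_mono card_Un_le le_trans order_refl)
    ultimately have "card (g ` C \<union> nb R u Q \<union> Y1 \<union> Y2) < card W" using sz by linarith
    moreover have "finite (g ` C \<union> nb R u Q \<union> Y1 \<union> Y2)"
      unfolding Y1_def Y2_def using insert.hyps fsat fn by auto
    ultimately obtain w where w: "w \<in> W" "w \<notin> g ` C" "w \<notin> nb R u Q" "w \<notin> Y1" "w \<notin> Y2"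
      using pickout[of "g ` C \<union> nb R u Q \<union> Y1 \<union> Y2" W] by blast
    have wQ: "w \<in> Q" using w W by blast
    define h where "h = g(u := w)"
    have hu: "h u = w" and hx: "\<And>x. x \<in> C \<Longrightarrow> h x = g x" unfolding h_def using insert.hyps by auto
    have him: "h ` insert u C = insert w (g ` C)" using hu hx by auto
    have uw: "\<not> R u w" using w(3) wQ unfolding nb_def by auto
    have gw: "\<not> R (g x) w" "\<not> R w (g x)" if "x \<in> C" for x
      using w(4) wQ that sym[of w "g x"] unfolding Y1_def nb_def by auto
    have gp: "C \<subseteq> P" "g ` C \<subseteq> Q" "inj_on g C" "\<And>x. x \<in> C \<Longrightarrow> \<not> R x (g x)"
      "\<And>x y. x \<in> C \<Longrightarrow> y \<in> C \<Longrightarrow> R x y \<Longrightarrow> \<not> R (g x) (g y)" using g(1) unfolding ppk_def by auto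
    have "ppk R P Q (insert u C) h"
      unfolding ppk_def
    proof (intro conjI ballI impI)
      show "insert u C \<subseteq> P" "h ` insert u C \<subseteq> Q" unfolding him using uP gp wQ by auto
      show "inj_on h (insert u C)"
      proof -
        have "inj_on h C" using inj_on_cong[of C h g] hx gp(3) by blast
        moreover have "h ` C = g ` C" using hx by (intro image_cong) auto
        moreover have "C - {u} = C" using insert.hyps by blast
        ultimately show ?thesis using w(2) hu by (simp add: inj_on_insert)
      qed
      show "\<not> R x (h x)" if "x \<in> insert u C" for x
        by (cases "x = u") (use that uw hu hx gp(4) in simp_all)
      show "\<not> R (h x) (h y)" if "x \<in> insert u C" "y \<in> insert u C" "R x y" for x y
        by (cases "x = u"; cases "y = u") (use that gw gp(5) hu hx irr in simp_all)
    qed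
    moreover have "h ` insert u C \<subseteq> W" unfolding him using w g(2) by blast
    moreover have "big h (insert u C) y \<le> K + \<alpha>" if y: "y \<in> Q" for y
    proof -
      have "big h (insert u C) y = (if R y w then dg R u P else 0) + big g C y"
        unfolding big_def using insert.hyps hu hx by (simp cong: sum.cong)
      moreover have "big g C y \<le> K" if "R y w"
      proof (rule ccontr)
        assume "\<not> ?thesis"
        then have "w \<in> Y2" unfolding Y2_def sat_def nb_def using y that wQ by auto
        then show False using w(5) by simp
      qed
      ultimately show ?thesis using g(3)[OF y] a[OF uB] by (cases "R y w") auto
    qed
    ultimately show ?case by blast
  qed
  from this[OF subset_refl] obtain g where
    g: "ppk R P Q B g" "g ` B \<subseteq> W" "\<forall>y\<in>Q. big g B y \<le> K + \<alpha>" by (elim exE conjE)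
  have "ny P R B g y \<le> big g B y" for y
  proof -
    have "{u \<in> P - B. newe R B g u y} \<subseteq> (\<Union>x\<in>B. if R y (g x) then nb R x P else {})"
      unfolding newe_def nb_def using sym by fastforce
    then have "ny P R B g y \<le> card (\<Union>x\<in>B. if R y (g x) then nb R x P else {})"
      unfolding ny_def using fB fn by (intro card_mono) auto
    also have "\<dots> \<le> (\<Sum>x\<in>B. card (if R y (g x) then nb R x P else {}))" using fB by (rule card_UN_le)
    also have "\<dots> = big g B y" unfolding big_def dg_def by (intro sum.cong) auto
    finally show ?thesis .
  qed
  then have "\<forall>y\<in>Q. ny P R B g y \<le> K + \<alpha>" using g(3) by (meson le_trans)
  then show ?thesis using g(1,2) by (intro exI[of _ g] conjI)
qed

lemma nx_le:
  assumes "finite P" "finite Q" "A \<subseteq> P" "\<And>x. x \<in> A \<Longrightarrow> dg R (g x) Q \<le> d" "dg R u P \<le> t" "\<And>u v. R u v \<Longrightarrow> R v u"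
  shows "nx Q R A g u \<le> t * d"
proof -
  have "{y \<in> Q - g ` A. newe R A g u y} \<subseteq> (\<Union>x\<in>{x \<in> A. R u x}. nb R (g x) Q)"
    unfolding newe_def nb_def using assms(6) by fastforce
  moreover have fA: "finite {x \<in> A. R u x}" using assms(1,3) finite_subset by fastforce
  ultimately have "nx Q R A g u \<le> card (\<Union>x\<in>{x \<in> A. R u x}. nb R (g x) Q)"
    unfolding nx_def using assms(2) by (intro card_mono) (auto simp: nb_def)
  also have "\<dots> \<le> t * d"
  proof (rule card_UN_bound[OF fA])
    have "card {x \<in> A. R u x} \<le> dg R u P" unfolding dg_def nb_def using assms(1,3) by (intro card_mono) auto
    then show "card {x \<in> A. R u x} \<le> t" using assms(5) by linarith
  qed (use assms(4) in \<open>auto simp: dg_def\<close>)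
  finally show ?thesis .
qed

section \<open>Numerical bounds, with the square root scale as threshold for large degrees\<close>

lemma sqrt_scale:
  fixes n :: nat shows "\<exists>T. 11 * (T * T) \<le> n \<and> n < 11 * ((T + 1) * (T + 1))"
proof -
  let ?P = "\<lambda>T. n < 11 * ((T + 1) * (T + 1))"
  have "n + 1 \<le> (n + 1) * (n + 1)" by simp
  then have "?P n" by linarith
  then have L: "?P (LEAST T. ?P T)" by (rule LeastI)
  have "11 * ((LEAST T. ?P T) * (LEAST T. ?P T)) \<le> n"
  proof (cases "LEAST T. ?P T")
    case (Suc m)
    then have "\<not> ?P m" using not_less_Least[of m ?P] by simp
    then show ?thesis unfolding Suc by simp
  qed simp
  then show ?thesis using L by blast
qed

text \<open>By Markov's inequality fewer than a third of the vertices exceed three times the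
  average.\<close>

lemma many_low:
  fixes f :: "'a \<Rightarrow> nat"
  assumes "finite Q" "0 < card Q"
  shows "2 * card Q < 3 * card {w \<in> Q. f w \<le> 3 * sum f Q div card Q}"
proof -
  let ?d = "3 * sum f Q div card Q"
  have "(?d + 1) * card Q \<le> (?d + 1) * card {w \<in> Q. f w \<le> ?d} + sum f Q" using card_low[OF assms(1)] .
  moreover have "3 * sum f Q < (?d + 1) * card Q" using assms(2)
    by (metis Suc_eq_plus1 dividend_less_times_div mult.commute mult_Suc_right)
  ultimately have "3 * ((?d + 1) * card Q) < (?d + 1) * (3 * card {w \<in> Q. f w \<le> ?d}) + (?d + 1) * card Q"
    by linarith
  also have "\<dots> = (?d + 1) * (3 * card {w \<in> Q. f w \<le> ?d} + card Q)" by (simp add: algebra_simps)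
  finally have "(?d + 1) * (3 * card Q) < (?d + 1) * (3 * card {w \<in> Q. f w \<le> ?d} + card Q)"
    by (simp only: mult.left_commute)
  then have "3 * card Q < 3 * card {w \<in> Q. f w \<le> ?d} + card Q" by (simp only: mult_less_cancel1)
  then show ?thesis by linarith
qed

lemma scale_bounds:
  fixes n T S1 S2 :: nat
  assumes S: "S1 + S2 + 836558 \<le> 6 * n" and T: "n < 11 * ((T + 1) * (T + 1))"
  shows "112 \<le> T" "28 * (S1 + S2) \<le> n * T" "21 * (S1 * S2) \<le> n * n * T" "S1 * S2 \<le> 9 * (n * n)"
proof -
  have n: "139427 \<le> n" using S by linarith
  have big: "m \<le> T" if "11 * (m * m) \<le> n" for m
  proof (rule ccontr)
    assume "\<not> m \<le> T"
    then have "(T + 1) * (T + 1) \<le> m * m" by (intro mult_le_mono) auto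
    then show False using T that by linarith
  qed
  show T112: "112 \<le> T" using big[of 112] n by simp
  have amgm: "4 * (S1 * S2) \<le> (S1 + S2) * (S1 + S2)"
  proof -
    have "0 \<le> (int S1 - int S2) * (int S1 - int S2)" by simp
    then have "int (4 * (S1 * S2)) \<le> int ((S1 + S2) * (S1 + S2))" by (simp add: algebra_simps)
    then show ?thesis by linarith
  qed
  have "(S1 + S2) * (S1 + S2) \<le> (6 * n) * (6 * n)" using S by (intro mult_le_mono) auto
  then show "S1 * S2 \<le> 9 * (n * n)" using amgm by linarith
  have m: "28 * (S1 + S2) \<le> n * T \<and> 21 * (S1 * S2) \<le> n * n * T" 
    if "28 * (S1 + S2) \<le> n * a" "S1 + S2 \<le> b * n" "21 * (b * b) \<le> 4 * a" "a \<le> T" for a b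
  proof
    show "28 * (S1 + S2) \<le> n * T" using that(1) mult_le_mono2[OF that(4), of n] by linarith
    have "(S1 + S2) * (S1 + S2) \<le> (b * n) * (b * n)" using that(2) by (intro mult_le_mono)
    then have "4 * (21 * (S1 * S2)) \<le> (21 * (b * b)) * (n * n)" using amgm by (simp add: algebra_simps)
    also have "\<dots> \<le> (4 * T) * (n * n)" using that(3,4) by (intro mult_le_mono1) linarith
    finally show "21 * (S1 * S2) \<le> n * n * T" by (simp add: algebra_simps)
  qed
  \<comment> \<open>The split is at \<open>n = C\<close>. Below it, \<open>6n - 2C\<close> is at
    most \<open>4n\<close> and \<open>T\<close> at least 112 suffices; above it the trivial
    \<open>6n\<close> is compensated by \<open>T\<close> at least 189, where
    \<open>21 * 36 = 4 * 189\<close>.\<close>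
  have "28 * (S1 + S2) \<le> n * T \<and> 21 * (S1 * S2) \<le> n * n * T"
  proof (cases "n \<le> 418279")
    case True
    show ?thesis by (rule m[of 112 4]) (use S T112 True in auto)
  next
    case False
    show ?thesis
    proof (rule m[of 189 6])
      show "189 \<le> T" using big[of 189] False by simp
    qed (use S in auto)
  qed
  then show "28 * (S1 + S2) \<le> n * T" "21 * (S1 * S2) \<le> n * n * T" by auto
qed

text \<open>Here \<open>b\<close> counts the vertices of degree at least \<open>T\<close> and
  \<open>d\<close> is three times the average degree of the other side. These fractions of
  \<open>n\<close> are what the hubs, the neighbours of their images, and the created edges may use
  up.\<close>

lemma hub_bounds:
  fixes b T S1 S2 d n :: nat
  assumes b: "b * T \<le> S1" and d: "d * n \<le> 3 * S2" and T: "0 < T" and n: "0 < n"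
    and 1: "28 * S1 \<le> n * T" and 2: "21 * (S1 * S2) \<le> n * n * T"
  shows "28 * b \<le> n" "7 * (b * d) \<le> n" "7 * (S1 * d) \<le> n * T"
proof -
  have "(28 * b) * T \<le> n * T" using b 1 by linarith
  then show "28 * b \<le> n" using T by simp
  have "S1 * (d * n) \<le> S1 * (3 * S2)" using d by (rule mult_le_mono2)
  moreover have "7 * (S1 * (d * n)) = (7 * (S1 * d)) * n" "S1 * (3 * S2) = 3 * (S1 * S2)" "n * n * T = (n * T) * n"
    by simp_all
  ultimately have "(7 * (S1 * d)) * n \<le> (n * T) * n" using 2 by linarith
  then show "7 * (S1 * d) \<le> n * T" using n by simp
  moreover have "b * T * d \<le> S1 * d" using b by (rule mult_le_mono1)
  moreover have "(7 * (b * d)) * T = 7 * (b * T * d)" by simp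
  ultimately have "(7 * (b * d)) * T \<le> n * T" by linarith
  then show "7 * (b * d) \<le> n" using T by simp
qed

lemma div_bound: "0 < k \<Longrightarrow> k * m \<le> n \<Longrightarrow> m \<le> n div (k :: nat)"
  by (simp add: less_eq_div_iff_mult_less_eq mult.commute)

text \<open>First the vertices of \<open>P\<close> of degree at least \<open>T\<close>, where \<open>T\<close> is about the square root of \<open>n / 11\<close>,
  go to vertices of small degree, then those of \<open>Q\<close>; the rest has low degree.\<close>

lemma pk_moderate_degree:
  assumes tr: "tri P Q R"
    and P: "\<And>v. v \<in> P \<Longrightarrow> 10 * dg R v P \<le> card P" "\<And>v. v \<in> P \<Longrightarrow> 10 * dg R v Q \<le> card P"
    and Q: "\<And>y. y \<in> Q \<Longrightarrow> 600 * dg R y Q \<le> card P" "\<And>y. y \<in> Q \<Longrightarrow> 600 * dg R y P \<le> card P"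
    and S: "(\<Sum>v\<in>P. dg R v P) + (\<Sum>y\<in>Q. dg R y Q) + 836558 \<le> 6 * card P"
  shows "pk P Q R"
proof -
  define n where "n = card P"
  define S1 where "S1 = (\<Sum>v\<in>P. dg R v P)"
  define S2 where "S2 = (\<Sum>y\<in>Q. dg R y Q)"
  have fin: "finite P" "finite Q" and cQ: "card Q = n" and sym: "\<And>u v. R u v \<Longrightarrow> R v u" and PQ: "P \<inter> Q = {}"
    using tr unfolding tri_def n_def by auto
  obtain T where T: "11 * (T * T) \<le> n" "n < 11 * ((T + 1) * (T + 1))" using sqrt_scale by blast
  have S12: "S1 + S2 + 836558 \<le> 6 * n" using S unfolding S1_def S2_def n_def .
  have n0: "139427 \<le> n" using S12 by linarith
  note sb = scale_bounds[OF S12 T(2)]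
  have TT: "112 * T \<le> T * T" using sb(1) by (intro mult_le_mono1)
  define d where "d = 3 * S2 div n"
  define d' where "d' = 3 * S1 div n"
  have d: "d * n \<le> 3 * S2" "d' * n \<le> 3 * S1" unfolding d_def d'_def by simp_all
  define W where "W = {w \<in> Q. dg R w Q \<le> d}"
  define V where "V = {w \<in> P. dg R w P \<le> d'}"
  have cW: "2 * n < 3 * card W" "2 * n < 3 * card V"
    using many_low[OF fin(2), of "\<lambda>w. dg R w Q"] many_low[OF fin(1), of "\<lambda>w. dg R w P"] n0 cQ
    unfolding W_def V_def d_def d'_def S1_def S2_def n_def by auto
  \<comment> \<open>\<open>K\<close> balances two demands: the created cross degree must leave room
    for \<open>pk_low_degree\<close>, yet \<open>181 * K\<close> must exceed the bound
    \<open>27 * n\<close> on created edges and \<open>(T + 1) * K\<close> the bound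
    \<open>n * T / 7\<close>.\<close>
  define K where "K = 3 * n div 20"
  have K: "20 * K \<le> 3 * n" "3 * n < 20 * (K + 1)" unfolding K_def by simp_all
  define a where "a = n div 10"
  define c where "c = n div 600"
  have ac: "10 * a \<le> n" "600 * c \<le> n" unfolding a_def c_def by simp_all
  have Pa: "dg R v P \<le> a" "dg R v Q \<le> a" if "v \<in> P" for v
    using P[OF that] unfolding a_def n_def by (auto intro: div_bound)
  have Qc: "dg R v Q \<le> c" "dg R v P \<le> c" if "v \<in> Q" for v
    using Q[OF that] unfolding c_def n_def by (auto intro: div_bound)
  define B where "B = {v \<in> P. T \<le> dg R v P}"
  have BP: "B \<subseteq> P" "finite B" unfolding B_def using fin by auto
  have "card B * T \<le> S1" unfolding B_def S1_def using fin(1) by (rule card_ge_le_sum)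
  then have hb: "28 * card B \<le> n" "7 * (card B * d) \<le> n" "7 * (S1 * d) \<le> n * T"
    using hub_bounds[of "card B" T S1 d n S2] d(1) sb n0 by auto
  have WQ: "W \<subseteq> Q" unfolding W_def by auto
  have S1d: "(S1 * d) * n \<le> (27 * n) * n"
  proof -
    have "S1 * (d * n) \<le> S1 * (3 * S2)" using d(1) by (rule mult_le_mono2)
    moreover have "S1 * (d * n) = (S1 * d) * n" "S1 * (3 * S2) = 3 * (S1 * S2)" "(27 * n) * n = 27 * (n * n)" by simp_all
    ultimately show ?thesis using sb(4) by linarith
  qed
  have "\<exists>g. ppk R P Q B g \<and> g ` B \<subseteq> W \<and> (\<forall>y\<in>Q. ny P R B g y \<le> K + a)"
  \<comment> \<open>At most 180 vertices get saturated because
    \<open>27 * n < 181 * (K + 1)\<close>; since degrees in \<open>Q\<close> are at most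
    \<open>n/600\<close>, avoiding their neighbours costs \<open>3n/10\<close> images.\<close>
  proof (rule place_hubs[OF tr BP(1) WQ, where \<alpha> = a and \<beta> = a and \<gamma> = c and M = 180 and d = d])
    have "(\<Sum>v\<in>B. dg R v P) * d \<le> S1 * d"
      unfolding S1_def using BP fin by (intro mult_le_mono1 sum_mono2) auto
    also have "\<dots> \<le> 27 * n" using S1d n0 by simp
    also have "\<dots> < (180 + 1) * (K + 1)" using K by simp
    finally show "(\<Sum>v\<in>B. dg R v P) * d < (180 + 1) * (K + 1)" .
    show "card B + a + card B * d + 180 * c < card W" using hb ac cW n0 by linarith
  qed (use Pa Qc BP in \<open>auto simp: W_def\<close>)
  then obtain g where g: "ppk R P Q B g" "g ` B \<subseteq> W" "\<And>y. y \<in> Q \<Longrightarrow> ny P R B g y \<le> K + a" by auto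
  define P' where "P' = P - B"
  define Q' where "Q' = Q - g ` B"
  define R' where "R' = resid P Q R B g"
  have tr': "tri P' Q' R'" unfolding P'_def Q'_def R'_def by (rule tri_resid[OF tr g(1)])
  have cP': "card P' + card B = n"
    unfolding P'_def n_def using BP fin card_mono[OF fin(1) BP(1)] by (simp add: card_Diff_subset)
  have fin': "finite P'" "finite Q'" "card P' = card Q'" and sym': "\<And>u v. R' u v \<Longrightarrow> R' v u"
    using tr' unfolding tri_def by auto
  have ownP': "dg R' u P' \<le> dg R u P" "dg R' u P' \<le> T" "dg R' u Q' \<le> a + T * d" if u: "u \<in> P'" for u
  proof -
    have e: "dg R' u P' = dg R u P'" using resid_dg(1)[OF tr g(1)] u unfolding P'_def R'_def by simp
    also have "\<dots> \<le> dg R u P" unfolding P'_def using fin by (intro dg_mono) auto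
    finally show e1: "dg R' u P' \<le> dg R u P" .
    have uT: "dg R u P \<le> T" using u unfolding P'_def B_def by auto
    then show "dg R' u P' \<le> T" using e1 by simp
    have "dg R' u Q' \<le> dg R u Q' + nx Q R B g u"
      using resid_dg(3)[OF tr g(1)] u unfolding P'_def Q'_def R'_def by simp
    moreover have "dg R u Q' \<le> dg R u Q" unfolding Q'_def using fin by (intro dg_mono) auto
    moreover have "nx Q R B g u \<le> T * d"
      by (rule nx_le[OF fin BP(1) _ uT sym]) (use g(2) in \<open>auto simp: W_def\<close>)
    ultimately show "dg R' u Q' \<le> a + T * d" using Pa(2)[of u] u unfolding P'_def by fastforce
  qed
  have ownQ': "dg R' y Q' \<le> dg R y Q" "dg R' y Q' \<le> c" "dg R' y P' \<le> c + K + a" if y: "y \<in> Q'" for y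
  proof -
    have yQ: "y \<in> Q" using y unfolding Q'_def by blast
    have e: "dg R' y Q' = dg R y Q'" using resid_dg(2)[OF tr g(1)] y unfolding Q'_def R'_def by simp
    also have "\<dots> \<le> dg R y Q" unfolding Q'_def using fin by (intro dg_mono) auto
    finally show e1: "dg R' y Q' \<le> dg R y Q" .
    then show "dg R' y Q' \<le> c" using Qc(1)[OF yQ] by linarith
    have "dg R' y P' \<le> dg R y P' + ny P R B g y"
      using resid_dg(4)[OF tr g(1)] y unfolding P'_def Q'_def R'_def by simp
    moreover have "dg R y P' \<le> dg R y P" unfolding P'_def using fin by (intro dg_mono) auto
    ultimately show "dg R' y P' \<le> c + K + a" using Qc(2)[OF yQ] g(3)[OF yQ] by linarith
  qed
  define B' where "B' = {y \<in> Q'. T \<le> dg R' y Q'}"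
  have BQ': "B' \<subseteq> Q'" "finite B'" unfolding B'_def using fin' by auto
  have S2': "(\<Sum>y\<in>Q'. dg R' y Q') \<le> S2"
  proof -
    have "(\<Sum>y\<in>Q'. dg R' y Q') \<le> (\<Sum>y\<in>Q'. dg R y Q)" using ownQ' by (intro sum_mono) auto
    also have "\<dots> \<le> S2" unfolding S2_def Q'_def using fin by (intro sum_mono2) auto
    finally show ?thesis .
  qed
  have "card B' * T \<le> (\<Sum>y\<in>Q'. dg R' y Q')" unfolding B'_def using fin'(2) by (rule card_ge_le_sum)
  then have hb': "28 * card B' \<le> n" "7 * (card B' * d') \<le> n" "7 * (S2 * d') \<le> n * T"
    using hub_bounds[of "card B'" T S2 d' n S1] S2' d(2) sb n0 by (auto simp: mult.commute)
  define V' where "V' = {u \<in> P'. dg R' u P' \<le> d'}"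
  have VP': "V' \<subseteq> P'" unfolding V'_def by auto
  have "V - B \<subseteq> V'" unfolding V'_def V_def P'_def using ownP'(1) unfolding P'_def by fastforce
  then have "card (V - B) \<le> card V'" unfolding V'_def using fin' by (intro card_mono) auto
  then have cV': "card V \<le> card V' + card B" using diff_card_le_card_Diff[OF BP(2), of V] by linarith
  have trs: "tri Q' P' R'" using tr' by (rule tri_swap)
  have "\<exists>h. ppk R' Q' P' B' h \<and> h ` B' \<subseteq> V' \<and> (\<forall>u\<in>P'. ny Q' R' B' h u \<le> K + c)"
  \<comment> \<open>The images now lie in \<open>P'\<close>, where own degrees are at most
    \<open>T\<close>; hence up to \<open>T\<close> saturated vertices are affordable, as
    \<open>T * T\<close> is at most \<open>n/11\<close>.\<close>
  proof (rule place_hubs[OF trs BQ'(1) VP', where \<alpha> = c and \<beta> = "c + K + a" and \<gamma> = T and M = T and d = d'])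
    have "(\<Sum>v\<in>B'. dg R' v Q') \<le> (\<Sum>y\<in>Q'. dg R' y Q')" using BQ' fin' by (intro sum_mono2) auto
    then have "(\<Sum>v\<in>B'. dg R' v Q') * d' \<le> S2 * d'" using S2' by (intro mult_le_mono1) linarith
    moreover have "(T + 1) * (3 * n) \<le> (T + 1) * (20 * (K + 1))" using K(2) by (intro mult_le_mono2) simp
    then have "3 * (n * T) + 3 * n \<le> 20 * ((T + 1) * (K + 1))" by (simp add: algebra_simps)
    ultimately show "(\<Sum>v\<in>B'. dg R' v Q') * d' < (T + 1) * (K + 1)" using hb'(3) n0 by linarith
    show "card B' + (c + K + a) + card B' * d' + T * T < card V'"
      using hb(1) hb' ac K(1) cW(2) cV' T(1) n0 by linarith
  qed (use ownP' ownQ' BQ' in \<open>auto simp: V'_def\<close>)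
  then obtain h where h: "ppk R' Q' P' B' h" "h ` B' \<subseteq> V'" "\<And>u. u \<in> P' \<Longrightarrow> ny Q' R' B' h u \<le> K + c" by auto
  let ?Q = "Q' - B'" and ?P = "P' - h ` B'" and ?R = "resid Q' P' R' B' h"
  have cQ': "card ?Q + card B' = card Q'"
    using BQ' fin' card_mono[OF fin'(2) BQ'(1)] by (simp add: card_Diff_subset)
  have "pk ?Q ?P ?R"
  proof (rule pk_low_degree[OF tri_resid[OF trs h(1)], of T "c + K + a + T * d'" "a + T * d + K + c"])
    fix y assume y: "y \<in> ?Q"
    have e: "dg ?R y ?Q = dg R' y ?Q" using resid_dg(1)[OF trs h(1) y] .
    have "dg R' y ?Q \<le> dg R' y Q'" using fin' by (intro dg_mono) auto
    moreover have yT: "dg R' y Q' \<le> T" using y unfolding B'_def by auto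
    ultimately show "dg ?R y ?Q \<le> T" using e by linarith
    have "dg ?R y ?P \<le> dg R' y ?P + nx P' R' B' h y" using resid_dg(3)[OF trs h(1) y] .
    moreover have "dg R' y ?P \<le> dg R' y P'" using fin' by (intro dg_mono) auto
    moreover have "nx P' R' B' h y \<le> T * d'"
      by (rule nx_le[OF fin'(2,1) BQ'(1) _ yT sym']) (use h(2) in \<open>auto simp: V'_def\<close>)
    ultimately show "dg ?R y ?P \<le> c + K + a + T * d'" using ownQ'(3)[of y] y by fastforce
  next
    fix u assume u: "u \<in> ?P"
    have e: "dg ?R u ?P = dg R' u ?P" using resid_dg(2)[OF trs h(1) u] .
    have "dg R' u ?P \<le> dg R' u P'" using fin' by (intro dg_mono) auto
    then show "dg ?R u ?P \<le> T" using e ownP'(2)[of u] u by fastforce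
    have "dg ?R u ?Q \<le> dg R' u ?Q + ny Q' R' B' h u" using resid_dg(4)[OF trs h(1) u] .
    moreover have "dg R' u ?Q \<le> dg R' u Q'" using fin' by (intro dg_mono) auto
    ultimately show "dg ?R u ?Q \<le> a + T * d + K + c" using ownP'(3)[of u] h(3)[of u] u by fastforce
  next
    have "T * (d * n) \<le> T * (3 * S2)" "T * (d' * n) \<le> T * (3 * S1)" using d by (auto intro: mult_le_mono2)
    moreover have "T * (28 * (S1 + S2)) \<le> T * (n * T)" using sb(2) by (rule mult_le_mono2)
    moreover have "T * (28 * (S1 + S2)) = 28 * (T * S1) + 28 * (T * S2)" "T * (3 * S2) = 3 * (T * S2)"
      "T * (3 * S1) = 3 * (T * S1)" "(28 * (T * d) + 28 * (T * d')) * n = 28 * (T * (d * n)) + 28 * (T * (d' * n))"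
      "(3 * (T * T)) * n = 3 * (T * (n * T))" by (simp_all add: algebra_simps)
    ultimately have "(28 * (T * d) + 28 * (T * d')) * n \<le> (3 * (T * T)) * n" by linarith
    then have "28 * (T * d) + 28 * (T * d') \<le> 3 * (T * T)" using n0 by simp
    then show "c + K + a + T * d' + (a + T * d + K + c) + 2 * (T * T) + T + 1 < card ?Q"
      using hb(1) hb'(1) ac K(1) T(1) TT cP' cQ' fin'(3) n0 by linarith
  qed
  then have "pk Q' P' R'" using pk_resid[OF trs h(1)] by blast
  then have "pk P' Q' R'" using pk_swap[OF tr'] by blast
  then show ?thesis using pk_resid[OF tr g(1)] unfolding P'_def Q'_def R'_def by blast
qed

section \<open>Crossing two pairs of stars\<close>

lemma pigeon2:
  assumes "finite H" "c ` L \<subseteq> H" "card H < card L"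
  shows "\<exists>w\<in>L. \<exists>w'\<in>L. w \<noteq> w' \<and> c w = c w'"
proof -
  have "card (c ` L) \<le> card H" using assms by (intro card_mono) auto
  then have "\<not> inj_on c L" using assms(3) pigeonhole[of c L] by linarith
  then show ?thesis unfolding inj_on_def by blast
qed

context mincx
begin

text \<open>Each vertex of \<open>Sp\<close> has one heavy neighbour \<open>a x\<close> and at most
  one light one. By \<open>big\<close>, every vertex of \<open>P\<close> misses some vertex of
  \<open>Sp\<close> other than any prescribed one, and it remains to avoid the heavy and the light
  neighbour at the same time.\<close>

lemma disjoint_spots:
  assumes Sp: "Sp \<subseteq> P - H"
    and a: "\<And>x. x \<in> Sp \<Longrightarrow> a x \<in> H \<inter> P \<and> nb R x P \<inter> H = {a x} \<and> card (nb R x P - {a x}) \<le> 1"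
    and big: "\<And>v. v \<in> P \<Longrightarrow> dg R v P + 5 \<le> card Sp"
  shows "\<exists>x1\<in>Sp. \<exists>x2\<in>Sp. x1 \<noteq> x2 \<and> \<not> R x1 x2 \<and> nb R x1 P \<inter> nb R x2 P = {}"
proof -
  have fSp: "finite Sp" using Sp finP finite_subset by blast
  have heavy: "z = a x" if "x \<in> Sp" "R x z" "z \<in> P" "z \<in> H" for x z
    using a[OF that(1)] that(2-4) unfolding nb_def by blast
  have ax: "a x \<in> P" "a x \<in> H" "R x (a x)" "R (a x) x" if "x \<in> Sp" for x
    using a[OF that] sym[of x "a x"] unfolding nb_def by blast+
  have light: "z = u" if "x \<in> Sp" "z \<in> P" "R x z" "z \<notin> H" "u \<in> P" "R x u" "u \<notin> H" for x z u
  proof -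
    have "finite (nb R x P - {a x})" unfolding nb_def by simp
    moreover have "z \<in> nb R x P - {a x}" "u \<in> nb R x P - {a x}" using that ax(2)[OF that(1)] unfolding nb_def by auto
    ultimately show ?thesis using a[OF that(1)] by (metis card_le_Suc0_iff_eq One_nat_def)
  qed
  have avoid: "\<exists>x\<in>Sp. \<not> R v x \<and> x \<noteq> u" if "v \<in> P" for v u
  proof -
    have "card (insert u (nb R v P)) \<le> dg R v P + 1" unfolding dg_def nb_def by (simp add: card_insert_if)
    then have "\<exists>x\<in>Sp. x \<notin> insert u (nb R v P)"
      using big[OF that] by (intro pickout) (auto simp: nb_def)
    then show ?thesis using Sp unfolding nb_def by auto
  qed
  have "P \<noteq> {}" using n_big by auto
  then obtain p where "p \<in> P" by blast
  then obtain x1 where x1: "x1 \<in> Sp" using avoid by blast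
  have key: ?thesis if x: "x \<in> Sp" "y \<in> Sp" and axy: "\<not> R (a x) y" and yn: "y \<notin> nb R x P"
    and l: "\<And>z. z \<in> P \<Longrightarrow> z \<notin> H \<Longrightarrow> R x z \<Longrightarrow> R y z \<Longrightarrow> False" for x y
  proof -
    have "x \<noteq> y" using axy ax(4)[OF x(1)] by blast
    moreover have "\<not> R x y" using yn x(2) Sp unfolding nb_def by blast
    moreover have "nb R x P \<inter> nb R y P = {}"
    proof (rule equals0I)
      fix z assume "z \<in> nb R x P \<inter> nb R y P"
      then have z: "z \<in> P" "R x z" "R y z" unfolding nb_def by auto
      have "z \<in> H" using l z by blast
      then have "z = a x" using heavy x(1) z by blast
      then show False using axy z(3) sym by blast
    qed
    ultimately show ?thesis using x by blast
  qed
  show ?thesis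
  proof (cases "\<exists>u\<in>P. u \<notin> H \<and> R x1 u")
    case False
    obtain y where y: "y \<in> Sp" "\<not> R (a x1) y" using avoid[OF ax(1)[OF x1]] by blast
    show ?thesis
    proof (rule key[OF x1 y])
      show "y \<notin> nb R x1 P" using False y(1) Sp unfolding nb_def by blast
    qed (use False in blast)
  next
    case True
    then obtain u where u: "u \<in> P" "u \<notin> H" "R x1 u" by blast
    show ?thesis
    proof (cases "\<exists>y\<in>Sp. \<not> R (a x1) y \<and> y \<noteq> u \<and> \<not> R u y")
      case True
      then obtain y where y: "y \<in> Sp" "\<not> R (a x1) y" "y \<noteq> u" "\<not> R u y" by blast
      show ?thesis
      proof (rule key[OF x1 y(1,2)])
        show "y \<notin> nb R x1 P"
        proof
          assume "y \<in> nb R x1 P"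
          then have "y = u" using light[OF x1 _ _ _ u(1,3,2), of y] y(1) Sp unfolding nb_def by auto
          then show False using y(3) by simp
        qed
        show False if z: "z \<in> P" "z \<notin> H" "R x1 z" "R y z" for z
        proof -
          have "z = u" using light[OF x1 z(1,3,2) u(1,3,2)] .
          then show False using y(4) z(4) sym by blast
        qed
      qed
    next
      \<comment> \<open>Every vertex of \<open>Sp\<close> other than \<open>u\<close> is joined to
        \<open>a x1\<close> or to \<open>u\<close>. So take \<open>y\<close> joined to
        \<open>u\<close> but not to \<open>a x1\<close>, and \<open>z\<close> joined to
        \<open>a x1\<close> but not to \<open>u\<close>: this pair has neither its heavy nor its
        light neighbour in common.\<close>
      case False
      obtain y where y: "y \<in> Sp" "\<not> R (a x1) y" "y \<noteq> u" using avoid[OF ax(1)[OF x1]] by blast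
      obtain z where z: "z \<in> Sp" "\<not> R u z" "z \<noteq> u" using avoid[OF u(1)] by blast
      have uy: "R y u" using False y sym by blast
      have "R (a x1) z" using False z by blast
      then have az: "a z = a x1" using heavy[OF z(1), of "a x1"] ax[OF x1] sym by auto
      show ?thesis
      proof (rule key[OF z(1) y(1)])
        show "\<not> R (a z) y" using az y(2) by simp
        show "y \<notin> nb R z P"
        proof
          assume "y \<in> nb R z P"
          then have "R y z" "z \<in> P" "z \<notin> H" using sym[of z y] z(1) Sp unfolding nb_def by auto
          then have "z = u" using light[OF y(1) _ _ _ u(1) uy u(2)] by blast
          then show False using z(3) by simp
        qed
        show False if t: "t \<in> P" "t \<notin> H" "R z t" "R y t" for t
        proof -
          have "t = u" using light[OF y(1) t(1,4,2) u(1) uy u(2)] .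
          then show False using z(2) t(3) sym by blast
        qed
      qed
    qed
  qed
qed

text \<open>\<open>x1\<close> goes to \<open>b1\<close> and \<open>x2\<close> to \<open>b2\<close>,
  but the neighbours of \<open>x1\<close> go to leaves of \<open>b2\<close> and those of
  \<open>x2\<close> to leaves of \<open>b1\<close>. Because of this crossing no edge is mapped to an
  edge. No new edge arises either: the neighbours of \<open>x1\<close> and \<open>x2\<close> are all
  placed, and each leaf has its only neighbour among the images.\<close>

lemma crossing_stars:
  assumes fH: "finite H" and H6: "\<And>h. h \<in> H \<Longrightarrow> 6 \<le> dg R h (P \<union> Q)"
    and L: "L \<subseteq> Q - H" "\<And>w. w \<in> L \<Longrightarrow> c w \<in> H \<inter> Q \<and> nb R w (P \<union> Q) = {c w}"
    and Lbig: "\<And>y. y \<in> Q \<Longrightarrow> dg R y Q + card H + 1 \<le> card L"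
    and Sp: "Sp \<subseteq> P - H"
    and a: "\<And>x. x \<in> Sp \<Longrightarrow> a x \<in> H \<inter> P \<and> nb R x (P \<union> Q) \<inter> H = {a x} \<and> card (nb R x P - {a x}) \<le> 1"
    and Sbig: "\<And>v. v \<in> P \<Longrightarrow> dg R v P + 5 \<le> card Sp"
  shows False
proof -
  have fL: "finite L" using L(1) finQ finite_subset by blast
  have cL: "c ` L \<subseteq> H" using L(2) by blast
  have only: "z = c w" if "w \<in> L" "R w z" for w z
    using L(2)[OF that(1)] Rin(2)[OF that(2)] that(2) unfolding nb_def by blast
  have cw: "c w \<in> Q" "c w \<in> H" "R (c w) w" "w \<in> Q" "w \<notin> H" if "w \<in> L" for w
    using L(2)[OF that] L(1) that sym[of w "c w"] unfolding nb_def by blast+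
  have "Q \<noteq> {}" using n_big cardQ by auto
  then obtain q where "q \<in> Q" by blast
  then have "card H < card L" using Lbig[of q] by linarith
  then obtain w1 w1' where w1: "w1 \<in> L" "w1' \<in> L" "w1 \<noteq> w1'" "c w1 = c w1'"
    using pigeon2[OF fH cL] by blast
  define b1 where "b1 = c w1"
  have b1: "b1 \<in> Q" "b1 \<in> H" unfolding b1_def using cw[OF w1(1)] by auto
  define L2 where "L2 = {w \<in> L. c w \<noteq> b1}"
  have "L \<subseteq> L2 \<union> nb R b1 Q" unfolding L2_def nb_def using cw by blast
  then have "card L \<le> card (L2 \<union> nb R b1 Q)" unfolding L2_def using fL by (intro card_mono) (auto simp: nb_def)
  then have "card L \<le> card L2 + dg R b1 Q" unfolding dg_def using card_Un_le[of L2 "nb R b1 Q"] by linarith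
  then have "card H < card L2" using Lbig[OF b1(1)] by linarith
  moreover have "c ` L2 \<subseteq> H" using cL unfolding L2_def by blast
  ultimately obtain w2 w2' where w2: "w2 \<in> L2" "w2' \<in> L2" "w2 \<noteq> w2'" "c w2 = c w2'"
    using pigeon2[OF fH, of c L2] by blast
  define b2 where "b2 = c w2"
  have w2L: "w2 \<in> L" "w2' \<in> L" and b12: "b2 \<noteq> b1" using w2 unfolding L2_def b2_def by auto
  have b2: "b2 \<in> Q" "b2 \<in> H" unfolding b2_def using cw[OF w2L(1)] by auto
  have axP: "nb R x P \<inter> H = {a x}" if "x \<in> Sp" for x
    using a[OF that] unfolding nb_def by blast
  have "\<exists>x1\<in>Sp. \<exists>x2\<in>Sp. x1 \<noteq> x2 \<and> \<not> R x1 x2 \<and> nb R x1 P \<inter> nb R x2 P = {}"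
    by (rule disjoint_spots[of Sp H a]) (use Sp a axP Sbig in auto)
  then obtain x1 x2 where x: "x1 \<in> Sp" "x2 \<in> Sp" "x1 \<noteq> x2" "\<not> R x1 x2" "nb R x1 P \<inter> nb R x2 P = {}" by blast
  define N1 where "N1 = nb R x1 P"
  define N2 where "N2 = nb R x2 P"
  have xP: "x1 \<in> P" "x2 \<in> P" "x1 \<notin> H" "x2 \<notin> H" using x Sp by auto
  have N12: "N1 \<inter> N2 = {}" unfolding N1_def N2_def by (rule x(5))
  have NP: "N1 \<subseteq> P" "N2 \<subseteq> P" "finite N1" "finite N2" unfolding N1_def N2_def nb_def by auto
  have NI: "z \<in> N1 \<longleftrightarrow> z \<in> P \<and> R x1 z" "z \<in> N2 \<longleftrightarrow> z \<in> P \<and> R x2 z" for z unfolding N1_def N2_def nb_def by auto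
  have c2: "card (nb R x P) \<le> 2" if "x \<in> Sp" for x
  proof -
    have "card (nb R x P) \<le> card (nb R x P - {a x}) + 1"
      by (metis Suc_eq_plus1 card_Suc_Diff1 card.infinite diff_card_le_card_Diff le_diff_conv finite.emptyI finite_insert is_singletonI is_singleton_altdef)
    then show ?thesis using a[OF that] by linarith
  qed
  have "\<exists>f. f ` N1 \<subseteq> {w2, w2'} \<and> inj_on f N1"
    using c2[OF x(1)] w2(3) NP by (intro card_le_inj) (auto simp: N1_def)
  then obtain f1 where f1: "f1 ` N1 \<subseteq> {w2, w2'}" "inj_on f1 N1" by blast
  have "\<exists>f. f ` N2 \<subseteq> {w1, w1'} \<and> inj_on f N2"
    using c2[OF x(2)] w1(3) NP by (intro card_le_inj) (auto simp: N2_def)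
  then obtain f2 where f2: "f2 ` N2 \<subseteq> {w1, w1'}" "inj_on f2 N2" by blast
  have f1L: "f1 z \<in> L" "c (f1 z) = b2" if "z \<in> N1" for z
    using f1(1) that w2L w2(4) unfolding b2_def by auto
  have f2L: "f2 z \<in> L" "c (f2 z) = b1" if "z \<in> N2" for z
    using f2(1) that w1(1,2,4) unfolding b1_def by auto
  have xN: "x1 \<notin> N1" "x1 \<notin> N2" "x2 \<notin> N1" "x2 \<notin> N2"
    using NI x(4) sym[of x2 x1] by auto
  define A where "A = {x1, x2} \<union> N1 \<union> N2"
  define g where "g z = (if z = x1 then b1 else if z = x2 then b2 else if z \<in> N1 then f1 z else f2 z)" for z
  have g: "g x1 = b1" "g x2 = b2" unfolding g_def using x(3) by auto
  have g1: "g z = f1 z" if "z \<in> N1" for z using that xN unfolding g_def by auto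
  have g2: "g z = f2 z" if "z \<in> N2" for z using that xN N12 unfolding g_def by auto
  have gL1: "g z \<in> L" "c (g z) = b2" if "z \<in> N1" for z using f1L[OF that] g1[OF that] by auto
  have gL2: "g z \<in> L" "c (g z) = b1" if "z \<in> N2" for z using f2L[OF that] g2[OF that] by auto
  have AP: "A \<subseteq> P" unfolding A_def using xP NP by auto
  have gne: "g z \<noteq> b1" "g z \<noteq> b2" if "z \<in> N1 \<union> N2" for z
    using that gL1(1) gL2(1) cw(5) b1(2) b2(2) by blast+
  have inj: "inj_on g A"
  proof -
    have "g z \<noteq> g z'" if "z \<in> N1" "z' \<in> N2" for z z' using gL1(2)[OF that(1)] gL2(2)[OF that(2)] b12 by auto
    moreover have "z = z'" if "z \<in> N1" "z' \<in> N1" "g z = g z'" for z z'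
      using f1(2) that g1 unfolding inj_on_def by auto
    moreover have "z = z'" if "z \<in> N2" "z' \<in> N2" "g z = g z'" for z z'
      using f2(2) that g2 unfolding inj_on_def by auto
    ultimately show ?thesis
    proof (intro inj_onI)
      fix z z' assume N: "\<And>z z'. z \<in> N1 \<Longrightarrow> z' \<in> N2 \<Longrightarrow> g z \<noteq> g z'"
        "\<And>z z'. z \<in> N1 \<Longrightarrow> z' \<in> N1 \<Longrightarrow> g z = g z' \<Longrightarrow> z = z'" "\<And>z z'. z \<in> N2 \<Longrightarrow> z' \<in> N2 \<Longrightarrow> g z = g z' \<Longrightarrow> z = z'"
        and z: "z \<in> A" "z' \<in> A" and e: "g z = g z'"
      have c: "z = x1 \<or> z = x2 \<or> z \<in> N1 \<or> z \<in> N2" "z' = x1 \<or> z' = x2 \<or> z' \<in> N1 \<or> z' \<in> N2"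
        using z unfolding A_def by auto
      show "z = z'" 
        using c(1)
      proof (elim disjE)
        assume "z = x1" then show ?thesis using c(2) e gne[of z'] g b12 by auto
      next
        assume "z = x2" then show ?thesis using c(2) e gne[of z'] g b12 by auto
      next
        assume "z \<in> N1" then show ?thesis using c(2) e gne[of z] g N(1)[of z z'] N(2)[of z z'] by auto
      next
        assume "z \<in> N2" then show ?thesis using c(2) e gne[of z] g N(1)[of z' z] N(3)[of z z'] by auto
      qed
    qed
  qed
  have gQ: "g ` A \<subseteq> Q" unfolding A_def using g b1 b2 gL1(1) gL2(1) cw(4) by auto
  have mem: "z = x1 \<or> z = x2 \<or> z \<in> N1 \<or> z \<in> N2" if "z \<in> A" for z using that unfolding A_def by blast
  have xA: "x1 \<in> A" "x2 \<in> A" unfolding A_def by auto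
  have noedge: "\<not> R (g z) (g z')" if "z \<in> N1 \<union> N2" "z' \<in> A" "R z z'" for z z'
  proof
    assume r: "R (g z) (g z')"
    show False
    proof (cases "z \<in> N1")
      case True
      have "g z' = g x2" using only[OF gL1(1)[OF True] r] gL1(2)[OF True] g by simp
      then have "z' = x2" using inj that(2) xA by (auto dest: inj_onD)
      then have "z \<in> N2" using that(3) True NI sym[of z x2] by auto
      then show False using True N12 by blast
    next
      case False
      then have z2: "z \<in> N2" using that by blast
      have "g z' = g x1" using only[OF gL2(1)[OF z2] r] gL2(2)[OF z2] g by simp
      then have "z' = x1" using inj that(2) xA by (auto dest: inj_onD)
      then have "z \<in> N1" using that(3) z2 NI sym[of z x1] by auto
      then show False using False by blast
    qed
  qed
  have xb: "\<not> R x1 b1" "\<not> R x2 b2"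
  proof -
    have "b \<notin> nb R x (P \<union> Q) \<inter> H" if "x \<in> Sp" "b \<in> Q" for x b
      using a[OF that(1)] that(2) PQ by auto
    then show "\<not> R x1 b1" "\<not> R x2 b2" using x(1,2) b1 b2 unfolding nb_def by blast+
  qed
  have p: "ppk R P Q A g"
    unfolding ppk_def
  proof (intro conjI ballI impI)
    show "\<not> R z (g z)" if "z \<in> A" for z
    proof
      assume r: "R z (g z)"
      have "z = x1 \<or> z = x2 \<or> z \<in> N1 \<or> z \<in> N2" using mem that by blast
      then show False
      proof (elim disjE)
        assume "z \<in> N1"
        then have "z = b2" using only[OF gL1(1) sym[OF r]] gL1(2) by simp
        then show False using \<open>z \<in> N1\<close> NP b2 PQ by blast
      next
        assume "z \<in> N2"
        then have "z = b1" using only[OF gL2(1) sym[OF r]] gL2(2) by simp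
        then show False using \<open>z \<in> N2\<close> NP b1 PQ by blast
      qed (use r g xb in auto)
    qed
    fix z z' assume z: "z \<in> A" "z' \<in> A" "R z z'"
    show "\<not> R (g z) (g z')"
    proof (cases "z \<in> N1 \<union> N2")
      case True then show ?thesis using noedge z by blast
    next
      case F: False
      show ?thesis
      proof (cases "z' \<in> N1 \<union> N2")
        case True then show ?thesis using noedge[OF True z(1) sym[OF z(3)]] sym by blast
      next
        case False
        then have "z \<in> {x1, x2}" "z' \<in> {x1, x2}" using F z mem by blast+
        then show ?thesis using z(3) x(4) sym[of x2 x1] irr by auto
      qed
    qed
  qed (use AP gQ inj in auto)
  have cA: "card A \<le> 6"
  proof -
    have "card A \<le> card {x1, x2} + card N1 + card N2" unfolding A_def
      by (meson add_mono card_Un_le le_trans order_refl)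
    moreover have "card {x1, x2} \<le> 2" by (simp add: card_insert_if)
    ultimately show ?thesis using c2[OF x(1)] c2[OF x(2)] unfolding N1_def N2_def by linarith
  qed
  \<comment> \<open>Four vertices of degree at least 6 give \<open>2 * 4 * 6 = 48\<close>, exactly
    the 12 for edges among them plus 36 for at most six pairs.\<close>
  define Z where "Z = {b1, b2, a x1, a x2}"
  have aN: "a x1 \<in> N1" "a x1 \<in> H" "a x2 \<in> N2" "a x2 \<in> H"
    using axP[OF x(1)] axP[OF x(2)] unfolding N1_def N2_def by blast+
  have aP: "a x1 \<in> P" "a x2 \<in> P" using aN NP by auto
  have "a x1 \<noteq> a x2" using aN N12 by auto
  moreover have "a x1 \<noteq> b1" "a x1 \<noteq> b2" "a x2 \<noteq> b1" "a x2 \<noteq> b2" using aP b1 b2 PQ by blast+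
  ultimately have cZ: "card Z = 4" unfolding Z_def using b12 by auto
  have ZH: "Z \<subseteq> H" unfolding Z_def using b1 b2 aN by blast
  show False
  proof (rule reduction_free[OF p, of Z])
    show "A \<noteq> {}" unfolding A_def by blast
    show "Z \<subseteq> A \<union> g ` A" unfolding Z_def using aN g xA unfolding A_def by force
    show "50 * card A + 50 \<le> n" using cA n_big by linarith
    have "(\<Sum>z\<in>Z. 6) \<le> (\<Sum>z\<in>Z. dg R z (P \<union> Q))" using H6 ZH by (intro sum_mono) blast
    moreover have "sd R Z \<le> card Z * (card Z - 1)" by (rule sd_le_square) (auto simp: Z_def)
    ultimately show "sd R Z + 6 * card A \<le> 2 * (\<Sum>z\<in>Z. dg R z (P \<union> Q))" using cZ cA by simp
  next
    fix v assume "v \<in> P - A"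
    moreover have "dg R v (P - A) \<le> dg R v P" by (auto intro!: dg_mono)
    ultimately show "dg R v (P - A) + 2 \<le> n - card A" using own1000[of v] cA by auto
  next
    fix y assume "y \<in> Q - g ` A"
    moreover have "dg R y (Q - g ` A) \<le> dg R y Q" by (auto intro!: dg_mono)
    ultimately show "dg R y (Q - g ` A) + 2 \<le> n - card A" using own1000Q[of y] cA by auto
  next
    fix z u y assume z: "z \<in> A" "u \<in> P - A" "y \<in> Q - g ` A" "R z u" "R (g z) y"
    have "z = x1 \<or> z = x2 \<or> z \<in> N1 \<or> z \<in> N2" using mem z by blast
    then show False
    proof (elim disjE)
      assume "z = x1" then show False using z NI unfolding A_def by blast
    next
      assume "z = x2" then show False using z NI unfolding A_def by blast
    next
      assume "z \<in> N1"
      then have "y = g x2" using only[OF gL1(1) z(5)] gL1(2) g by simp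
      then show False using z(3) xA by blast
    next
      assume "z \<in> N2"
      then have "y = g x1" using only[OF gL2(1) z(5)] gL2(2) g by simp
      then show False using z(3) xA by blast
    qed
  qed
qed


section \<open>Heavy vertices, weighted counting and the final contradiction\<close>

lemma mega_in_Q: "\<exists>y\<in>Q. n \<le> 600 * dg R y (P \<union> Q)"
proof (rule ccontr)
  assume "\<not> ?thesis"
  then have q: "600 * dg R y (P \<union> Q) < n" if "y \<in> Q" for y using that by (meson not_le)
  have p: "10 * dg R v (P \<union> Q) < n" if "v \<in> P" for v using mega_lonely[OF that _ q] by (meson not_le)
  have "pk P Q R"
  proof (rule pk_moderate_degree[OF tr])
    show "10 * dg R v P \<le> n" "10 * dg R v Q \<le> n" if "v \<in> P" for v
      using p[OF that] deg_own[of v] deg_cross[of v] by linarith+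
    show "600 * dg R v Q \<le> n" "600 * dg R v P \<le> n" if "v \<in> Q" for v
      using q[OF that] deg_own[of v] deg_cross[of v] by linarith+
    show "(\<Sum>v\<in>P. dg R v P) + (\<Sum>y\<in>Q. dg R y Q) + 836558 \<le> 6 * n"
      using Feq unfolding s1_def s2_def by linarith
  qed
  then show False using npk by blast
qed

text \<open>Light vertices joined to \<open>v\<close> or \<open>y\<close> are discarded; for the
  others \<open>fQ\<close> and \<open>fP\<close> force the heavy neighbour onto the own side. The
  summand \<open>D\<close> in the counts matches this loss: the degrees of \<open>v\<close> and
  \<open>y\<close> together with any own degree are at most \<open>D + 4\<close>.\<close>

lemma many_pendants_contradiction:
  assumes V: "V = P \<union> Q" and fH: "finite H" "card H \<le> 162004" and H6: "\<And>h. h \<in> H \<Longrightarrow> 6 \<le> dg R h V"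
    and v: "v \<in> P" and y: "y \<in> Q"
    and fP: "\<And>x. x \<in> P - H \<Longrightarrow> dg R x P \<le> 3 \<Longrightarrow> nb R x P \<inter> H = {} \<Longrightarrow> R y x"
    and fQ: "\<And>w. w \<in> Q - H \<Longrightarrow> dg R w Q \<le> 3 \<Longrightarrow> nb R w Q \<inter> H = {} \<Longrightarrow> R v w"
    and q0: "D + 175273 \<le> card {w \<in> Q - H. card (nb R w V \<inter> H) = 1 \<and> card (nb R w V - H) = 0}"
    and p1: "D + 94271 \<le> card {x \<in> P - H. card (nb R x V \<inter> H) = 1 \<and> card (nb R x V - H) \<le> 1}"
  shows False
proof -
  let ?L0 = "{w \<in> Q - H. card (nb R w V \<inter> H) = 1 \<and> card (nb R w V - H) = 0}"
  let ?S0 = "{x \<in> P - H. card (nb R x V \<inter> H) = 1 \<and> card (nb R x V - H) \<le> 1}"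
  define L where "L = ?L0 - nb R v Q"
  define Sp where "Sp = ?S0 - nb R y P"
  have fV: "finite V" unfolding V by simp
  have fnV: "finite (nb R x V)" for x unfolding nb_def using fV by simp
  have cL: "D + 175273 \<le> card L + dg R v Q"
    using diff_card_le_card_Diff[of "nb R v Q" ?L0] q0 unfolding L_def dg_def by (simp add: nb_def)
  have cS: "D + 94271 \<le> card Sp + dg R y P"
    using diff_card_le_card_Diff[of "nb R y P" ?S0] p1 unfolding Sp_def dg_def by (simp add: nb_def)
  have sub: "nb R x P \<subseteq> nb R x V" "nb R x Q \<subseteq> nb R x V" for x unfolding nb_def V by auto
  have one: "\<exists>b. nb R x V \<inter> H = {b}" if "card (nb R x V \<inter> H) = 1" for x
    using that by (metis card_1_singletonE)
  have "\<exists>b. b \<in> H \<inter> Q \<and> nb R w V = {b}" if w: "w \<in> L" for w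
  proof -
    have w': "w \<in> Q - H" "card (nb R w V \<inter> H) = 1" "card (nb R w V - H) = 0" "\<not> R v w"
      using w unfolding L_def nb_def by auto
    have "nb R w V - H = {}" using w'(3) fnV by simp
    moreover obtain b where b: "nb R w V \<inter> H = {b}" using one[OF w'(2)] by blast
    ultimately have nbw: "nb R w V = {b}" by blast
    have "b \<in> Q"
    proof (rule ccontr)
      assume "b \<notin> Q"
      then have "b \<notin> nb R w Q" unfolding nb_def by simp
      then have "nb R w Q = {}" using nbw sub(2)[of w] by auto
      then have "R v w" using fQ[OF w'(1)] unfolding dg_def by simp
      then show False using w'(4) by blast
    qed
    then show ?thesis using nbw b by blast
  qed
  then obtain c where c: "\<And>w. w \<in> L \<Longrightarrow> c w \<in> H \<inter> Q \<and> nb R w (P \<union> Q) = {c w}" unfolding V by metis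
  have "\<exists>a. a \<in> H \<inter> P \<and> nb R x V \<inter> H = {a} \<and> card (nb R x P - {a}) \<le> 1" if x: "x \<in> Sp" for x
  proof -
    have x': "x \<in> P - H" "card (nb R x V \<inter> H) = 1" "card (nb R x V - H) \<le> 1" "\<not> R y x"
      using x unfolding Sp_def nb_def by auto
    obtain a where a: "nb R x V \<inter> H = {a}" using one[OF x'(2)] by blast
    have "nb R x P - {a} \<subseteq> nb R x V - H" using a sub(1)[of x] by blast
    then have "card (nb R x P - {a}) \<le> card (nb R x V - H)" using fnV by (intro card_mono) auto
    then have 1: "card (nb R x P - {a}) \<le> 1" using x'(3) by linarith
    have "a \<in> P"
    proof (rule ccontr)
      assume "a \<notin> P"
      then have "a \<notin> nb R x P" unfolding nb_def by simp
      then have e: "nb R x P \<inter> H = {}" "nb R x P - {a} = nb R x P" using a sub(1)[of x] by auto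
      then have "R y x" using fP[OF x'(1)] 1 unfolding dg_def by simp
      then show False using x'(4) by blast
    qed
    then show ?thesis using a 1 by blast
  qed
  then obtain a where a: "\<And>x. x \<in> Sp \<Longrightarrow> a x \<in> H \<inter> P \<and> nb R x (P \<union> Q) \<inter> H = {a x} \<and> card (nb R x P - {a x}) \<le> 1"
    unfolding V by metis
  show False
  proof (rule crossing_stars[OF fH(1) _ _ c _ _ a])
    show "L \<subseteq> Q - H" "Sp \<subseteq> P - H" unfolding L_def Sp_def by auto
    show "6 \<le> dg R h (P \<union> Q)" if "h \<in> H" for h using H6[OF that] unfolding V .
    show "dg R q Q + card H + 1 \<le> card L" if "q \<in> Q" for q using DQP[OF v that] cL fH(2) by linarith
    show "dg R u P + 5 \<le> card Sp" if "u \<in> P" for u using DPQ[OF that y] cS by linarith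
  qed
qed

text \<open>A light vertex without heavy neighbour has at least four light ones. So if heavy neighbours count
  twice, then all light vertices have weighted degree at least 2, and the weights sum up to at most
  the degree sum.\<close>

lemma weighted_count:
  assumes V: "V = P \<union> Q" and H: "H \<subseteq> V" "card H \<le> 162004"
    and four: "\<And>x. x \<in> V - H \<Longrightarrow> nb R x V \<inter> H = {} \<Longrightarrow> 4 \<le> dg R x V"
  defines "X0 S \<equiv> {x \<in> S - H. card (nb R x V \<inter> H) = 1 \<and> card (nb R x V - H) = 0}"
    and "X1 S \<equiv> {x \<in> S - H. card (nb R x V \<inter> H) = 1 \<and> card (nb R x V - H) \<le> 1}"
  shows "D + 94271 \<le> card (X1 P)" "D + 94271 \<le> card (X1 Q)" "D + 175273 \<le> card (X0 P) \<or> D + 175273 \<le> card (X0 Q)"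
proof -
  have fV: "finite V" unfolding V by simp
  have fH: "finite H" using H(1) fV finite_subset by blast
  have fn: "finite (nb R x V)" for x unfolding nb_def using fV by simp
  define hv where "hv x = card (nb R x V \<inter> H)" for x
  define lt where "lt x = card (nb R x V - H)" for x
  have hvd: "hv x = dg R x H" and ltd: "lt x = dg R x (V - H)" for x
    unfolding hv_def lt_def dg_def nb_def using H(1) by (auto intro!: arg_cong[where f = card])
  have dx: "dg R x V = lt x + hv x" for x unfolding hvd ltd using dg_Diff[OF fV H(1)] .
  \<comment> \<open>Weight 4 is the doubled form of weighted degree 2. A vertex with one heavy
    neighbour lacks 2 if it is a leaf and 1 if it has one light neighbour; membership in
    \<open>X0\<close> and \<open>X1\<close>, where \<open>X0\<close> lies in \<open>X1\<close>,
    counts exactly this deficit.\<close>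
  have pt: "4 \<le> 2 * hv x + lt x + (if x \<in> X0 V then 1 else 0) + (if x \<in> X1 V then 1 else 0)" if x: "x \<in> V - H" for x
  proof -
    have m: "x \<in> X0 V \<longleftrightarrow> hv x = 1 \<and> lt x = 0" "x \<in> X1 V \<longleftrightarrow> hv x = 1 \<and> lt x \<le> 1"
      using x unfolding X0_def X1_def hv_def lt_def by auto
    have "4 \<le> lt x" if "hv x = 0"
      using that four[OF x] dx[of x] fn[of x] unfolding hv_def by simp
    then show ?thesis unfolding m by (cases "hv x = 0"; cases "hv x = 1"; cases "lt x = 0"; cases "lt x = 1") auto
  qed
  have "(\<Sum>x\<in>V - H. 4) \<le> (\<Sum>x\<in>V - H. (2 * hv x + lt x) + (if x \<in> X0 V then 1 else 0) + (if x \<in> X1 V then 1 else 0))"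
    using pt by (intro sum_mono) simp
  also have "\<dots> = (\<Sum>x\<in>V - H. 2 * hv x + lt x) + card ((V - H) \<inter> X0 V) + card ((V - H) \<inter> X1 V)"
    using fV by (simp only: sum.distrib) (simp add: sum.If_cases Int_def)
  also have "(V - H) \<inter> X0 V = X0 V" unfolding X0_def by blast
  also have "(V - H) \<inter> X1 V = X1 V" unfolding X1_def by blast
  finally have 4: "4 * card (V - H) \<le> (\<Sum>x\<in>V - H. 2 * hv x + lt x) + card (X0 V) + card (X1 V)" by simp
  have "2 * hv x + lt x = dg R x V + dg R x H" for x using dx[of x] hvd[of x] by simp
  then have "(\<Sum>x\<in>V - H. 2 * hv x + lt x) = (\<Sum>x\<in>V - H. dg R x V) + (\<Sum>x\<in>V - H. dg R x H)"
    by (simp add: sum.distrib)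
  also have "(\<Sum>x\<in>V - H. dg R x H) = (\<Sum>h\<in>H. dg R h (V - H))" by (rule dg_sum_swap) (use fV fH symiff in auto)
  also have "\<dots> \<le> (\<Sum>h\<in>H. dg R h V)" using fV by (intro sum_mono dg_mono) auto
  also have "(\<Sum>x\<in>V - H. dg R x V) + (\<Sum>h\<in>H. dg R h V) = sd R V"
    unfolding sd_def using sum.subset_diff[OF H(1) fV, of "\<lambda>x. dg R x V"] by simp
  finally have s: "(\<Sum>x\<in>V - H. 2 * hv x + lt x) \<le> sd R V" by simp
  have cV: "card V = 2 * n" unfolding V using card_Un_disjoint[OF finP finQ PQ] cardQ by simp
  have cVH: "card (V - H) + card H = 2 * n" 
    using cV card_mono[OF fV H(1)] by (simp add: card_Diff_subset fH H(1))
  have split: "card (X0 V) = card (X0 P) + card (X0 Q)" "card (X1 V) = card (X1 P) + card (X1 Q)"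
  proof -
    have "X0 V = X0 P \<union> X0 Q" "X1 V = X1 P \<union> X1 Q" unfolding X0_def X1_def V by blast+
    moreover have "X0 P \<inter> X0 Q = {}" "X1 P \<inter> X1 Q = {}" unfolding X0_def X1_def using PQ by blast+
    moreover have "finite (X0 P)" "finite (X0 Q)" "finite (X1 P)" "finite (X1 Q)" unfolding X0_def X1_def by simp_all
    ultimately show "card (X0 V) = card (X0 P) + card (X0 Q)" "card (X1 V) = card (X1 P) + card (X1 Q)"
      by (simp_all add: card_Un_disjoint)
  qed
  have fX1: "finite (X1 V)" "finite (X1 P)" "finite (X1 Q)" unfolding X1_def using fV by simp_all
  have "X1 V \<subseteq> V - H" "X0 V \<subseteq> X1 V" "X0 P \<subseteq> X1 P" "X0 Q \<subseteq> X1 Q" "X1 P \<subseteq> P" "X1 Q \<subseteq> Q"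
    unfolding X0_def X1_def by auto
  then have c: "card (X1 V) \<le> card (V - H)" "card (X0 V) \<le> card (X1 V)"
      "card (X0 P) \<le> card (X1 P)" "card (X0 Q) \<le> card (X1 Q)" "card (X1 P) \<le> n" "card (X1 Q) \<le> n"
    using card_mono[OF _ \<open>X1 V \<subseteq> V - H\<close>] card_mono[OF fX1(1) \<open>X0 V \<subseteq> X1 V\<close>] card_mono[OF fX1(2) \<open>X0 P \<subseteq> X1 P\<close>]
      card_mono[OF fX1(3) \<open>X0 Q \<subseteq> X1 Q\<close>] card_mono[OF finP \<open>X1 P \<subseteq> P\<close>] card_mono[OF finQ \<open>X1 Q \<subseteq> Q\<close>] fV cardQ
    by auto
  have F: "sd R V + 2 * D + 836558 \<le> 6 * n" using Fin unfolding V .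
  have t: "8 * n + 2 * D + 836558 \<le> 6 * n + card (X0 V) + card (X1 V) + 4 * card H"
    using 4 s F cVH by linarith
  \<comment> \<open>\<open>836558 - 4 * 162004 = 2 * 94271\<close>, using that \<open>X1\<close> has
    at most \<open>n\<close> vertices on the other side. For \<open>X0\<close> the bound
    \<open>card (V - H)\<close> on \<open>X1\<close> gives back one \<open>card H\<close>, and
    \<open>836558 - 3 * 162004 = 2 * 175273\<close>.\<close>
  show "D + 94271 \<le> card (X1 P)" "D + 94271 \<le> card (X1 Q)" using t split c H(2) by linarith+
  show "D + 175273 \<le> card (X0 P) \<or> D + 175273 \<le> card (X0 Q)" using t split c H(2) cVH by linarith
qed

lemma no_counterexample: False
proof -
  interpret S: mincx Q P R D by (rule swap)
  define V where "V = P \<union> Q"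
  have V': "V = Q \<union> P" unfolding V_def by blast
  have fV: "finite V" unfolding V_def by simp
  obtain y where y: "y \<in> Q" "n \<le> 600 * dg R y V" using mega_in_Q unfolding V_def by blast
  obtain v where v: "v \<in> P" "n \<le> 600 * dg R v V" using S.mega_in_Q unfolding V'[symmetric] cardQ by blast
  define H1 where "H1 = {x \<in> V. n \<le> 27000 * dg R x V}"
  define H where "H = H1 \<union> Bad v \<union> S.Bad y"
  have fB: "finite (Bad v)" "card (Bad v) \<le> 2" "finite (S.Bad y)" "card (S.Bad y) \<le> 2"
    using Bad_card[OF v(1)] S.Bad_card[OF y(1)] by auto
  have fH1: "finite H1" unfolding H1_def using fV by simp
  have "card H1 * n \<le> (\<Sum>x\<in>V. 27000 * dg R x V)" unfolding H1_def using fV by (rule card_ge_le_sum)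
  also have "\<dots> = 27000 * sd R V" unfolding sd_def by (simp add: sum_distrib_left)
  also have "\<dots> \<le> 162000 * n" using Fin unfolding V_def by linarith
  finally have "card H1 \<le> 162000" using n_big by simp
  then have cH: "card H \<le> 162004" unfolding H_def
    using card_Un_le[of H1 "Bad v"] card_Un_le[of "H1 \<union> Bad v" "S.Bad y"] fB by linarith
  have fH: "finite H" unfolding H_def using fH1 fB by simp
  have B1: "h \<in> Q" "1000 \<le> dg R h P" if "h \<in> Bad v" for h using Bad_deg[OF v(1) that] by auto
  have B2: "h \<in> P" "1000 \<le> dg R h Q" if "h \<in> S.Bad y" for h using S.Bad_deg[OF y(1) that] by auto
  have HV: "H \<subseteq> V" unfolding H_def H1_def V_def using B1(1) B2(1) by blast
  have H6: "6 \<le> dg R h V" if hH: "h \<in> H" for h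
  proof -
    consider "h \<in> H1" | "h \<in> Bad v" | "h \<in> S.Bad y" using hH unfolding H_def by blast
    then show ?thesis
    proof cases
      \<comment> \<open>Degree 5 is excluded because \<open>27000 * 5\<close> is less than
        \<open>139427\<close>, the least possible order.\<close>
      case 1 then show ?thesis unfolding H1_def using n_big by auto
    next
      case 2 then show ?thesis using B1(2)[OF 2] deg_own[of h] unfolding V_def by linarith
    next
      case 3 then show ?thesis using B2(2)[OF 3] deg_cross[of h] unfolding V_def by linarith
    qed
  qed
  have vH: "v \<in> H" "y \<in> H" unfolding H_def H1_def using v y V_def by auto
  have notH: "27000 * dg R x V < n \<and> x \<notin> Bad v \<and> x \<notin> S.Bad y" if "x \<in> V" "x \<notin> H" for x
    using that unfolding H_def H1_def by auto
  have fQ: "R v w" if w: "w \<in> Q - H" "dg R w Q \<le> 3" "nb R w Q \<inter> H = {}" for w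
  proof (rule ccontr)
    assume nv: "\<not> R v w"
    show False
    proof (rule mega_dense_light[OF v(1) _ _ nv w(2)])
      show "27000 * dg R z (P \<union> Q) < n \<and> z \<notin> Bad v" if z: "z \<in> nb R w Q" for z
      proof -
        have "z \<in> V" "z \<notin> H" using z w(3) unfolding nb_def V_def by auto
        then show ?thesis using notH[of z] unfolding V_def by blast
      qed
    qed (use v w in \<open>auto simp: V_def\<close>)
  qed
  have fP: "R y w" if w: "w \<in> P - H" "dg R w P \<le> 3" "nb R w P \<inter> H = {}" for w
  proof (rule ccontr)
    assume nv: "\<not> R y w"
    show False
    proof (rule S.mega_dense_light[OF y(1) _ _ nv w(2)])
      show "27000 * dg R z (Q \<union> P) < card Q \<and> z \<notin> S.Bad y" if z: "z \<in> nb R w P" for z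
      proof -
        have "z \<in> V" "z \<notin> H" using z w(3) unfolding nb_def V_def by auto
        then show ?thesis using notH[of z] cardQ unfolding V' by auto
      qed
      show "card Q \<le> 600 * dg R y (Q \<union> P)" using y(2) cardQ unfolding V' by simp
    qed (use y w in auto)
  qed
  \<comment> \<open>With at most three neighbours, none heavy, such a vertex would be joined to
    \<open>v\<close> or \<open>y\<close> by \<open>fQ\<close> or \<open>fP\<close>; but
    \<open>v\<close> and \<open>y\<close> are heavy.\<close>
  have four: "4 \<le> dg R x V" if x: "x \<in> V - H" "nb R x V \<inter> H = {}" for x
  proof (rule ccontr)
    assume "\<not> ?thesis"
    then have d: "dg R x P \<le> 3" "dg R x Q \<le> 3" using deg_split[of x] unfolding V_def by linarith+
    have sub: "nb R x P \<inter> H = {}" "nb R x Q \<inter> H = {}" using x(2) unfolding nb_def V_def by blast+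
    consider "x \<in> P" | "x \<in> Q" using x(1) unfolding V_def by blast
    then show False
    proof cases
      case 1
      then have "R x y" using fP[OF _ d(1) sub(1)] x(1) sym[of y x] by blast
      then show False using x(2) vH(2) y(1) unfolding nb_def V_def by blast
    next
      case 2
      then have "R x v" using fQ[OF _ d(2) sub(2)] x(1) sym[of v x] by blast
      then show False using x(2) vH(1) v(1) unfolding nb_def V_def by blast
    qed
  qed
  note wc = weighted_count[OF V_def HV cH four]
  show False using wc(3)
  proof
    assume "D + 175273 \<le> card {x \<in> Q - H. card (nb R x V \<inter> H) = 1 \<and> card (nb R x V - H) = 0}"
    then show False using many_pendants_contradiction[OF V_def fH cH H6 v(1) y(1) fP fQ _ wc(1)] by blast
  next
    assume "D + 175273 \<le> card {x \<in> P - H. card (nb R x V \<inter> H) = 1 \<and> card (nb R x V - H) = 0}"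
    then show False using S.many_pendants_contradiction[OF V' fH cH H6 y(1) v(1) fQ fP _ wc(2)] by blast
  qed
qed

end

theorem good_packs: "good P Q R D \<Longrightarrow> pk P Q R"
proof (induction "card P" arbitrary: P Q R D rule: less_induct)
  case less
  show ?case
  proof (rule ccontr)
    assume "\<not> pk P Q R"
    then have "mincx P Q R D" using less by unfold_locales auto
    then show False by (rule mincx.no_counterexample)
  qed
qed

section \<open>The main theorem\<close>

lemma deg_eq_card:
  assumes "\<And>e. e \<in> E \<Longrightarrow> v \<in> e \<Longrightarrow> \<exists>u\<in>S. e = {v, u}"
  shows "deg E v = card {u \<in> S. {v, u} \<in> E}"
proof -
  have "inj_on (\<lambda>u. {v, u}) {u \<in> S. {v, u} \<in> E}" by (auto intro!: inj_onI simp: doubleton_eq_iff)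
  then have "card ((\<lambda>u. {v, u}) ` {u \<in> S. {v, u} \<in> E}) = card {u \<in> S. {v, u} \<in> E}" by (rule card_image)
  moreover have "(\<lambda>u. {v, u}) ` {u \<in> S. {v, u} \<in> E} = {e \<in> E. v \<in> e}" using assms by fastforce
  ultimately show ?thesis unfolding deg_def by simp
qed

lemma deg_le_maxdeg: "finite V \<Longrightarrow> v \<in> V \<Longrightarrow> deg E v \<le> maxdeg E V"
  unfolding maxdeg_def by simp

lemma handshake:
  assumes V: "finite V" and E: "\<And>e. e \<in> E \<Longrightarrow> \<exists>u\<in>V. \<exists>v\<in>V. u \<noteq> v \<and> e = {u, v}"
  shows "(\<Sum>v\<in>V. deg E v) = 2 * card E"
proof -
  have fE: "finite E" by (rule finite_subset[of _ "Pow V"]) (use E V in auto)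
  have "(\<Sum>v\<in>V. deg E v) = (\<Sum>v\<in>V. \<Sum>e\<in>E. if v \<in> e then 1 else 0)"
    unfolding deg_def using fE by (simp add: sum.If_cases Int_def)
  also have "\<dots> = (\<Sum>e\<in>E. \<Sum>v\<in>V. if v \<in> e then 1 else 0)" by (rule sum.swap)
  also have "\<dots> = (\<Sum>e\<in>E. 2)"
  proof (rule sum.cong)
    fix e assume "e \<in> E"
    then obtain u v where e: "u \<in> V" "v \<in> V" "u \<noteq> v" "e = {u, v}" using E by blast
    have "V \<inter> {w. w \<in> e} = {u, v}" using e by auto
    then show "(\<Sum>v\<in>V. if v \<in> e then 1 else 0) = (2::nat)" using V e(3) by (simp add: sum.If_cases)
  qed simp
  finally show ?thesis by simp
qed

theorem mainTheorem3:
  fixes n :: nat and V1 V2 :: "'a set" and E1 E2 E3 :: "'a set set"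
  assumes "n \<ge> 2"
    and "graph_triple n V1 V2 E1 E2 E3"
    and "maxdeg E1 V1 \<le> n - 2" and "maxdeg E2 V2 \<le> n - 2"
    and "maxdeg E3 (V1 \<union> V2) \<le> n - 1"
    and "int (card E1 + card E2 + card E3 + calD V1 V2 E1 E2 E3)
           \<le> 3 * int n - (11 * 195^2 + 4)"
  shows "packs V1 V2 E1 E2 E3"
proof -
  have f: "finite V1" "finite V2" "V1 \<inter> V2 = {}" "card V1 = n" "card V2 = n"
    using assms(2) unfolding graph_triple_def by auto
  have e1: "\<exists>u\<in>V1. \<exists>v\<in>V1. u \<noteq> v \<and> e = {u, v}" if "e \<in> E1" for e
    using assms(2) that unfolding graph_triple_def graph_on_def by blast
  have e2: "\<exists>u\<in>V2. \<exists>v\<in>V2. u \<noteq> v \<and> e = {u, v}" if "e \<in> E2" for e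
    using assms(2) that unfolding graph_triple_def graph_on_def by blast
  have e3: "\<exists>u\<in>V1. \<exists>v\<in>V2. e = {u, v}" if "e \<in> E3" for e
    using assms(2) that unfolding graph_triple_def bipartite_on_def by blast
  let ?E = "E1 \<union> E2 \<union> E3" and ?D = "calD V1 V2 E1 E2 E3" and ?V = "V1 \<union> V2"
  \<comment> \<open>No information is lost by merging the edge sets: the sides of the endpoints
    decide to which of the three graphs an edge belongs.\<close>
  define R where "R u v \<longleftrightarrow> {u, v} \<in> ?E" for u v
  have eV: "\<exists>u\<in>?V. \<exists>v\<in>?V. u \<noteq> v \<and> e = {u, v}" if "e \<in> ?E" for e
  proof -
    consider "e \<in> E1" | "e \<in> E2" | "e \<in> E3" using \<open>e \<in> ?E\<close> by blast
    then show ?thesis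
    proof cases
      case 1 then show ?thesis using e1[OF 1] by blast
    next
      case 2 then show ?thesis using e2[OF 2] by blast
    next
      case 3
      then obtain u v where uv: "u \<in> V1" "v \<in> V2" "e = {u, v}" using e3 by blast
      then have "u \<noteq> v" using f(3) by auto
      then show ?thesis using uv by blast
    qed
  qed
  have R1: "R u v \<longleftrightarrow> {u, v} \<in> E1" if "u \<in> V1" "v \<in> V1" for u v
  proof -
    have "{u, v} \<notin> E2" using e2[of "{u, v}"] that f(3) by (auto simp: doubleton_eq_iff)
    moreover have "{u, v} \<notin> E3" using e3[of "{u, v}"] that f(3) by (auto simp: doubleton_eq_iff)
    ultimately show ?thesis unfolding R_def by blast
  qed
  have R2: "R u v \<longleftrightarrow> {u, v} \<in> E2" if "u \<in> V2" "v \<in> V2" for u v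
  proof -
    have "{u, v} \<notin> E1" using e1[of "{u, v}"] that f(3) by (auto simp: doubleton_eq_iff)
    moreover have "{u, v} \<notin> E3" using e3[of "{u, v}"] that f(3) by (auto simp: doubleton_eq_iff)
    ultimately show ?thesis unfolding R_def by blast
  qed
  have R3: "R u v \<longleftrightarrow> {u, v} \<in> E3" "R v u \<longleftrightarrow> {v, u} \<in> E3" if "u \<in> V1" "v \<in> V2" for u v
  proof -
    have "{u, v} \<notin> E1" using e1[of "{u, v}"] that f(3) by (auto simp: doubleton_eq_iff)
    moreover have "{u, v} \<notin> E2" using e2[of "{u, v}"] that f(3) by (auto simp: doubleton_eq_iff)
    ultimately show "R u v \<longleftrightarrow> {u, v} \<in> E3" "R v u \<longleftrightarrow> {v, u} \<in> E3"
      unfolding R_def by (auto simp: insert_commute)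
  qed
  have d1: "dg R v V1 = deg E1 v" if v: "v \<in> V1" for v
  proof -
    have "deg E1 v = card {u \<in> V1. {v, u} \<in> E1}" by (rule deg_eq_card) (use e1 in blast)
    then show ?thesis unfolding dg_def nb_def using R1[OF v] by (simp cong: conj_cong)
  qed
  have d2: "dg R v V2 = deg E2 v" if v: "v \<in> V2" for v
  proof -
    have "deg E2 v = card {u \<in> V2. {v, u} \<in> E2}" by (rule deg_eq_card) (use e2 in blast)
    then show ?thesis unfolding dg_def nb_def using R2[OF v] by (simp cong: conj_cong)
  qed
  have d3: "dg R v V2 = deg E3 v" if v: "v \<in> V1" for v
  proof -
    have "deg E3 v = card {u \<in> V2. {v, u} \<in> E3}" by (rule deg_eq_card) (use e3 v f(3) in blast)
    then show ?thesis unfolding dg_def nb_def using R3(1)[OF v] by (simp cong: conj_cong)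
  qed
  have d4: "dg R y V1 = deg E3 y" if y: "y \<in> V2" for y
  proof -
    have "deg E3 y = card {u \<in> V1. {y, u} \<in> E3}"
    proof (rule deg_eq_card)
      fix e assume "e \<in> E3" "y \<in> e"
      then show "\<exists>u\<in>V1. e = {y, u}" using e3[of e] y f(3) by auto
    qed
    then show ?thesis unfolding dg_def nb_def using R3(2)[OF _ y] by (simp cong: conj_cong)
  qed
  have tri: "tri V1 V2 R" unfolding tri_def
  proof (intro conjI allI impI)
    show "\<not> R u u" for u using eV[of "{u, u}"] unfolding R_def by (auto simp: doubleton_eq_iff)
    show "u \<in> ?V" if "R u v" for u v using eV[of "{u, v}"] that unfolding R_def by (auto simp: doubleton_eq_iff)
    show "R v u" if "R u v" for u v using that unfolding R_def by (simp add: insert_commute)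
  qed (use f in auto)
  have "sd R ?V = (\<Sum>v\<in>?V. deg ?E v)" unfolding sd_def
  proof (rule sum.cong)
    fix v assume "v \<in> ?V"
    have "deg ?E v = card {u \<in> ?V. {v, u} \<in> ?E}"
    proof (rule deg_eq_card)
      fix e assume "e \<in> ?E" "v \<in> e"
      then show "\<exists>u\<in>?V. e = {v, u}" using eV[of e] by auto
    qed
    then show "dg R v ?V = deg ?E v" unfolding dg_def nb_def R_def by simp
  qed simp
  also have "\<dots> = 2 * card ?E" by (rule handshake) (use eV f in auto)
  also have "card ?E \<le> card E1 + card E2 + card E3"
    using card_Un_le[of "E1 \<union> E2" E3] card_Un_le[of E1 E2] by linarith
  finally have sd: "sd R ?V \<le> 2 * (card E1 + card E2 + card E3)" by simp
  have F: "sd R ?V + 2 * ?D + 836558 \<le> 6 * n" using sd assms(6) by simp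
  have m: "deg E1 v \<le> maxdeg E1 V1" "deg E3 v \<le> maxdeg E3 V1" "deg E3 v \<le> maxdeg E3 ?V" if "v \<in> V1" for v
    using that f by (auto intro: deg_le_maxdeg)
  have m': "deg E2 v \<le> maxdeg E2 V2" "deg E3 v \<le> maxdeg E3 V2" "deg E3 v \<le> maxdeg E3 ?V" if "v \<in> V2" for v
    using that f by (auto intro: deg_le_maxdeg)
  have D: "maxdeg E1 V1 \<le> ?D" "maxdeg E2 V2 \<le> ?D" "maxdeg E1 V1 + maxdeg E3 V2 \<le> ?D + 4"
    "maxdeg E2 V2 + maxdeg E3 V1 \<le> ?D + 4" unfolding calD_def by auto
  have "good V1 V2 R ?D" unfolding good_def bnd_def
  proof (intro conjI ballI)
    fix v assume v: "v \<in> V1"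
    show "dg R v V1 \<le> ?D" "dg R v V1 + 2 \<le> card V1" "dg R v V2 + 1 \<le> card V1"
      using d1[OF v] d3[OF v] m[OF v] D assms(1,3,5) f by linarith+
    fix y assume y: "y \<in> V2"
    show "dg R v V1 + dg R y V1 \<le> ?D + 4" "dg R y V2 + dg R v V2 \<le> ?D + 4"
      using d1[OF v] d3[OF v] d2[OF y] d4[OF y] m[OF v] m'[OF y] D by linarith+
  next
    fix y assume y: "y \<in> V2"
    show "dg R y V2 \<le> ?D" "dg R y V2 + 2 \<le> card V1" "dg R y V1 + 1 \<le> card V1"
      using d2[OF y] d4[OF y] m'[OF y] D assms(1,4,5) f by linarith+
  qed (use tri F f in auto)
  then have "pk V1 V2 R" by (rule good_packs)
  then show ?thesis unfolding pk_def packs_def R_def by blast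
qed

end
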